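(* Assume propositional resizing and let $\mathcal{U}$ be a universe. The algebraically injective sets in $\mathcal{U}$ are the retracts of powersets of (arbitrary) types in $\mathcal{U}$: a type $D:\mathcal{U}$ is a set that is algebraically $\mathcal{U},\mathcal{U}$-injective if and only if there is a designated type $X:\mathcal{U}$ such that $D$ is a retract of the powerset $X\to\Omega_{\mathcal{U}}$.
   Context: Foundation: intensional Martin-Löf type theory with $\mathbb{0},\mathbb{1},\mathbb{N},+,\Pi,\Sigma,\mathrm{Id}$ and universes $\mathcal{U},\mathcal{V},\mathcal{W},\mathcal{T}$ (not assumed cumulative), with successor $\mathcal{U}^+$ and least upper bound $\mathcal{U}\sqcup\mathcal{V}$; if $X:\mathcal{U}$ and $A:X\to\mathcal{V}$ then $\Pi A,\Sigma A:\mathcal{U}\sqcup\mathcal{V}$. Univalence (hence function and propositional extensionality) and existence of propositional truncations are assumed. Excluded middle is neither assumed nor rejected. A proposition (subsingleton) is a type any two of whose elements are equal; a set is a type whose identity types are all subsingletons. $\Omega_{\mathcal{U}}:\mathcal{U}^+$ is the type of propositions in $\mathcal{U}$. A map $j:X\to Y$ is an embedding if each fiber $j^{-1}(y):=\Sigma(x:X),\,j\,x=y$ is a subsingleton; $X\hookrightarrow Y$ is the type of embeddings. $f\sim g$ means pointwise equality. "$A$ is a retract of $B$" means there are designated $s:A\to B$, $r:B\to A$ and $r\circ s\sim\mathrm{id}$. "If and only if" is a logical equivalence (constructions in both directions). A type $D$ (in any universe) is algebraically $\mathcal{U},\mathcal{V}$-injective if it is equipped with an element of $$\Pi(X:\mathcal{U})\,\Pi(Y:\mathcal{V})\,\Pi(j:X\hookrightarrow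 Y)\,\Pi(f:X\to D),\ \Sigma(g:Y\to D),\ g\circ j\sim f.$$ Propositional resizing: for any two universes $\mathcal{U},\mathcal{V}$, every proposition in $\mathcal{U}$ has an equivalent copy in $\mathcal{V}$. *)

theory Defs
  imports Main
begin

text \<open>
  The foundation is represented by a deep embedding: raw terms with de Bruijn indices, and
  Martin-Loef's judgements for contexts, typing and judgemental equality.  The only binders are
  \<open>Pi\<close> and \<open>Lam\<close>; every other type former, constructor and eliminator is a constant with a closed
  type, so that e.g. a family over \<open>A\<close> is a term of type \<open>A \<rightarrow> \<U>\<close>.
\<close>

section \<open>Universe levels\<close>

text \<open>
  Universes are indexed by an arbitrary join-semilattice with a successor: \<open>usuc u\<close> is the level
  of \<open>\<U>\<^sup>+\<close> and \<open>sup u v\<close> that of \<open>\<U> \<squnion> \<V>\<close>.  The natural numbers (a tower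
  \<open>\<U>\<^sub>0, \<U>\<^sub>1, \<dots>\<close>) are one instance.
\<close>

class universe_level = semilattice_sup +
  fixes usuc :: "'a \<Rightarrow> 'a"
  assumes less_usuc: "u < usuc u"

instantiation nat :: universe_level
begin
definition usuc_nat :: "nat \<Rightarrow> nat" where "usuc_nat = Suc"
instance by standard (simp add: usuc_nat_def)
end


section \<open>Raw terms\<close>

datatype 'l const =
    EmptyT 'l | EmptyInd 'l 'l
  | UnitT 'l | UnitPt 'l | UnitInd 'l 'l
  | NatT 'l | NatZero 'l | NatSuc 'l | NatInd 'l 'l
  | SumT 'l 'l | SumInl 'l 'l | SumInr 'l 'l | SumInd 'l 'l 'l
  | SigT 'l 'l | SigPair 'l 'l | SigInd 'l 'l 'l
  | IdT 'l | IdRefl 'l | IdInd 'l 'l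
  | Trunc 'l | TruncIn 'l | TruncProp 'l | TruncRec 'l 'l
  | Univalence 'l

datatype 'l tm =
    Var nat
  | Univ 'l
  | Pi "'l tm" "'l tm"
  | Lam "'l tm" "'l tm"
  | App "'l tm" "'l tm"  (infixl \<open>\<cdot>\<close> 90)
  | Const "'l const"

primrec ren :: "(nat \<Rightarrow> nat) \<Rightarrow> 'l tm \<Rightarrow> 'l tm" where
  "ren \<rho> (Var i) = Var (\<rho> i)"
| "ren \<rho> (Univ u) = Univ u"
| "ren \<rho> (Pi A B) = Pi (ren \<rho> A) (ren (case_nat 0 (\<lambda>i. Suc (\<rho> i))) B)"
| "ren \<rho> (Lam A b) = Lam (ren \<rho> A) (ren (case_nat 0 (\<lambda>i. Suc (\<rho> i))) b)"
| "ren \<rho> (f \<cdot> a) = ren \<rho> f \<cdot> ren \<rho> a"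
| "ren \<rho> (Const c) = Const c"

definition wk :: "nat \<Rightarrow> 'l tm \<Rightarrow> 'l tm" where
  "wk n = ren (\<lambda>i. i + n)"

primrec sub :: "(nat \<Rightarrow> 'l tm) \<Rightarrow> 'l tm \<Rightarrow> 'l tm" where
  "sub \<sigma> (Var i) = \<sigma> i"
| "sub \<sigma> (Univ u) = Univ u"
| "sub \<sigma> (Pi A B) = Pi (sub \<sigma> A) (sub (case_nat (Var 0) (\<lambda>i. wk 1 (\<sigma> i))) B)"
| "sub \<sigma> (Lam A b) = Lam (sub \<sigma> A) (sub (case_nat (Var 0) (\<lambda>i. wk 1 (\<sigma> i))) b)"
| "sub \<sigma> (f \<cdot> a) = sub \<sigma> f \<cdot> sub \<sigma> a"
| "sub \<sigma> (Const c) = Const c"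

definition inst :: "'l tm \<Rightarrow> 'l tm \<Rightarrow> 'l tm" where
  "inst B a = sub (case_nat a Var) B"


section \<open>Internal definitions\<close>

text \<open>
  Each operation takes terms in a common context, preceded by the levels of the types involved.
  An argument that lives in the context extended by one variable is said to be a family.
\<close>

definition arr :: "'l tm \<Rightarrow> 'l tm \<Rightarrow> 'l tm"  (infixr \<open>\<rightarrow>\<^sub>t\<close> 80) where
  "A \<rightarrow>\<^sub>t B = Pi A (wk 1 B)"

definition Eq :: "'l \<Rightarrow> 'l tm \<Rightarrow> 'l tm \<Rightarrow> 'l tm \<Rightarrow> 'l tm" where
  "Eq u A a b = Const (IdT u) \<cdot> A \<cdot> a \<cdot> b"

definition Refl :: "'l \<Rightarrow> 'l tm \<Rightarrow> 'l tm \<Rightarrow> 'l tm" where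
  "Refl u A a = Const (IdRefl u) \<cdot> A \<cdot> a"

\<comment> \<open>In \<open>Sg\<close>, \<open>Pr\<close> and \<open>Fst\<close>, the term \<open>B\<close> is a family over \<open>A\<close>.\<close>
definition Sg :: "'l \<Rightarrow> 'l \<Rightarrow> 'l tm \<Rightarrow> 'l tm \<Rightarrow> 'l tm" where
  "Sg u v A B = Const (SigT u v) \<cdot> A \<cdot> Lam A B"

definition Pr :: "'l \<Rightarrow> 'l \<Rightarrow> 'l tm \<Rightarrow> 'l tm \<Rightarrow> 'l tm \<Rightarrow> 'l tm \<Rightarrow> 'l tm" where
  "Pr u v A B a b = Const (SigPair u v) \<cdot> A \<cdot> Lam A B \<cdot> a \<cdot> b"

definition Fst :: "'l \<Rightarrow> 'l \<Rightarrow> 'l tm \<Rightarrow> 'l tm \<Rightarrow> 'l tm \<Rightarrow> 'l tm" where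
  "Fst u v A B p = Const (SigInd u v u) \<cdot> A \<cdot> Lam A B \<cdot> Lam (Sg u v A B) (wk 1 A)
     \<cdot> Lam A (Lam B (Var 1)) \<cdot> p"

definition Prod :: "'l \<Rightarrow> 'l \<Rightarrow> 'l tm \<Rightarrow> 'l tm \<Rightarrow> 'l tm" where
  "Prod u v A B = Sg u v A (wk 1 B)"

definition is_prop :: "'l \<Rightarrow> 'l tm \<Rightarrow> 'l tm" where
  "is_prop u A = Pi A (Pi (wk 1 A) (Eq u (wk 2 A) (Var 1) (Var 0)))"

definition is_set :: "'l \<Rightarrow> 'l tm \<Rightarrow> 'l tm" where
  "is_set u A = Pi A (Pi (wk 1 A) (is_prop u (Eq u (wk 2 A) (Var 1) (Var 0))))"

definition Omega :: "'l::universe_level \<Rightarrow> 'l tm" where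
  "Omega u = Sg (usuc u) u (Univ u) (is_prop u (Var 0))"

definition powerset :: "'l::universe_level \<Rightarrow> 'l tm \<Rightarrow> 'l tm" where
  "powerset u X = X \<rightarrow>\<^sub>t Omega u"

\<comment> \<open>\<open>(\<Sigma>(s : B \<rightarrow> A). f \<circ> s \<sim> id) \<times> (\<Sigma>(r : B \<rightarrow> A). r \<circ> f \<sim> id)\<close>\<close>
definition is_equiv :: "'l::universe_level \<Rightarrow> 'l \<Rightarrow> 'l tm \<Rightarrow> 'l tm \<Rightarrow> 'l tm \<Rightarrow> 'l tm" where
  "is_equiv u v A B f = Prod (sup u v) (sup u v)
     (Sg (sup u v) v (B \<rightarrow>\<^sub>t A) (Pi (wk 1 B) (Eq v (wk 2 B) (wk 2 f \<cdot> (Var 1 \<cdot> Var 0)) (Var 0))))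
     (Sg (sup u v) u (B \<rightarrow>\<^sub>t A) (Pi (wk 1 A) (Eq u (wk 2 A) (Var 1 \<cdot> (wk 2 f \<cdot> Var 0)) (Var 0))))"

definition Equiv :: "'l::universe_level \<Rightarrow> 'l \<Rightarrow> 'l tm \<Rightarrow> 'l tm \<Rightarrow> 'l tm" where
  "Equiv u v A B = Sg (sup u v) (sup u v) (A \<rightarrow>\<^sub>t B) (is_equiv u v (wk 1 A) (wk 1 B) (Var 0))"

definition id_equiv :: "'l::universe_level \<Rightarrow> 'l tm \<Rightarrow> 'l tm" where
  "id_equiv u A =
    (let I = Lam A (Var 0);
         R = Lam A (Refl u (wk 1 A) (Var 0));
         S = Pi (wk 1 A) (Eq u (wk 2 A) (wk 2 I \<cdot> (Var 1 \<cdot> Var 0)) (Var 0));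
         T = Pi (wk 1 A) (Eq u (wk 2 A) (Var 1 \<cdot> (wk 2 I \<cdot> Var 0)) (Var 0))
     in Pr u u (A \<rightarrow>\<^sub>t A) (is_equiv u u (wk 1 A) (wk 1 A) (Var 0)) I
          (Pr u u (Sg u u (A \<rightarrow>\<^sub>t A) S) (wk 1 (Sg u u (A \<rightarrow>\<^sub>t A) T))
             (Pr u u (A \<rightarrow>\<^sub>t A) S I R)
             (Pr u u (A \<rightarrow>\<^sub>t A) T I R)))"

\<comment> \<open>\<open>\<Pi>(X Y : \<U>). X = Y \<rightarrow> X \<simeq> Y\<close>, by path induction.\<close>
definition id_to_equiv :: "'l::universe_level \<Rightarrow> 'l tm" where
  "id_to_equiv u = Const (IdInd (usuc u) u) \<cdot> Univ u
     \<cdot> Lam (Univ u) (Lam (Univ u) (Lam (Eq (usuc u) (Univ u) (Var 1) (Var 0))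
         (Equiv u u (Var 2) (Var 1))))
     \<cdot> Lam (Univ u) (id_equiv u (Var 0))"

definition fiber :: "'l \<Rightarrow> 'l \<Rightarrow> 'l tm \<Rightarrow> 'l tm \<Rightarrow> 'l tm \<Rightarrow> 'l tm \<Rightarrow> 'l tm" where
  "fiber u v X Y j y = Sg u v X (Eq v (wk 1 Y) (wk 1 j \<cdot> Var 0) (wk 1 y))"

definition is_embedding ::
    "'l::universe_level \<Rightarrow> 'l \<Rightarrow> 'l tm \<Rightarrow> 'l tm \<Rightarrow> 'l tm \<Rightarrow> 'l tm" where
  "is_embedding u v X Y j =
     Pi Y (is_prop (sup u v) (fiber u v (wk 1 X) (wk 1 Y) (wk 1 j) (Var 0)))"

definition Emb :: "'l::universe_level \<Rightarrow> 'l \<Rightarrow> 'l tm \<Rightarrow> 'l tm \<Rightarrow> 'l tm" where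
  "Emb u v X Y =
     Sg (sup u v) (sup u v) (X \<rightarrow>\<^sub>t Y) (is_embedding u v (wk 1 X) (wk 1 Y) (Var 0))"

\<comment> \<open>The underlying map of \<open>j : X \<hookrightarrow> Y\<close>.\<close>
definition emb_map ::
    "'l::universe_level \<Rightarrow> 'l \<Rightarrow> 'l tm \<Rightarrow> 'l tm \<Rightarrow> 'l tm \<Rightarrow> 'l tm" where
  "emb_map u v X Y j =
     Fst (sup u v) (sup u v) (X \<rightarrow>\<^sub>t Y) (is_embedding u v (wk 1 X) (wk 1 Y) (Var 0)) j"

\<comment> \<open>\<open>\<Pi>(X : \<U>) (Y : \<V>) (j : X \<hookrightarrow> Y) (f : X \<rightarrow> D). \<Sigma>(g : Y \<rightarrow> D). \<Pi>(x : X). g (j x) = f x\<close>, for \<open>D : \<W>\<close>.\<close>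
definition alg_injective ::
    "'l::universe_level \<Rightarrow> 'l \<Rightarrow> 'l \<Rightarrow> 'l tm \<Rightarrow> 'l tm" where
  "alg_injective u v w D =
     Pi (Univ u) (Pi (Univ v) (Pi (Emb u v (Var 1) (Var 0)) (Pi (Var 2 \<rightarrow>\<^sub>t wk 3 D)
       (Sg (sup v w) (sup u w) (Var 2 \<rightarrow>\<^sub>t wk 4 D)
         (Pi (Var 4) (Eq w (wk 6 D)
           (Var 1 \<cdot> (emb_map u v (Var 5) (Var 4) (Var 3) \<cdot> Var 0))
           (Var 2 \<cdot> Var 0)))))))"

\<comment> \<open>\<open>A\<close> is a retract of \<open>B\<close>: \<open>\<Sigma>(s : A \<rightarrow> B) (r : B \<rightarrow> A). \<Pi>(a : A). r (s a) = a\<close>.\<close>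
definition retract :: "'l::universe_level \<Rightarrow> 'l \<Rightarrow> 'l tm \<Rightarrow> 'l tm \<Rightarrow> 'l tm" where
  "retract u v A B =
     Sg (sup u v) (sup u v) (A \<rightarrow>\<^sub>t B)
       (Sg (sup u v) u (wk 1 B \<rightarrow>\<^sub>t wk 1 A)
         (Pi (wk 2 A) (Eq u (wk 3 A) (Var 1 \<cdot> (Var 2 \<cdot> Var 0)) (Var 0))))"

definition Iff :: "'l::universe_level \<Rightarrow> 'l \<Rightarrow> 'l tm \<Rightarrow> 'l tm \<Rightarrow> 'l tm" where
  "Iff u v A B = Prod (sup u v) (sup u v) (A \<rightarrow>\<^sub>t B) (B \<rightarrow>\<^sub>t A)"


section \<open>Types of the constants\<close>

abbreviation (input) "UnitTy u \<equiv> Const (UnitT u)"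
abbreviation (input) "NatTy u \<equiv> Const (NatT u)"
abbreviation (input) "SumTy u v A B \<equiv> Const (SumT u v) \<cdot> A \<cdot> B"
abbreviation (input) "SigTy u v A B \<equiv> Const (SigT u v) \<cdot> A \<cdot> B"

text \<open>
  The empty type, the unit type and the natural numbers have a copy in every universe (in the
  absence of cumulativity).  Eliminators are dependent and eliminate into every universe.
  Truncation satisfies its universal property with respect to propositions in every universe.
\<close>

primrec const_type :: "'l::universe_level const \<Rightarrow> 'l tm" where
  "const_type (EmptyT u) = Univ u"
| "const_type (EmptyInd u w) =
     Pi (Const (EmptyT u) \<rightarrow>\<^sub>t Univ w) (Pi (Const (EmptyT u)) (Var 1 \<cdot> Var 0))"
| "const_type (UnitT u) = Univ u"
| "const_type (UnitPt u) = UnitTy u"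
| "const_type (UnitInd u w) =
     Pi (UnitTy u \<rightarrow>\<^sub>t Univ w) (Pi (Var 0 \<cdot> Const (UnitPt u)) (Pi (UnitTy u) (Var 2 \<cdot> Var 0)))"
| "const_type (NatT u) = Univ u"
| "const_type (NatZero u) = NatTy u"
| "const_type (NatSuc u) = NatTy u \<rightarrow>\<^sub>t NatTy u"
| "const_type (NatInd u w) =
     Pi (NatTy u \<rightarrow>\<^sub>t Univ w) (Pi (Var 0 \<cdot> Const (NatZero u))
       (Pi (Pi (NatTy u) (Var 2 \<cdot> Var 0 \<rightarrow>\<^sub>t Var 2 \<cdot> (Const (NatSuc u) \<cdot> Var 0)))
         (Pi (NatTy u) (Var 3 \<cdot> Var 0))))"
| "const_type (SumT u v) = Univ u \<rightarrow>\<^sub>t Univ v \<rightarrow>\<^sub>t Univ (sup u v)"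
| "const_type (SumInl u v) =
     Pi (Univ u) (Pi (Univ v) (Var 1 \<rightarrow>\<^sub>t SumTy u v (Var 1) (Var 0)))"
| "const_type (SumInr u v) =
     Pi (Univ u) (Pi (Univ v) (Var 0 \<rightarrow>\<^sub>t SumTy u v (Var 1) (Var 0)))"
| "const_type (SumInd u v w) =
     Pi (Univ u) (Pi (Univ v) (Pi (SumTy u v (Var 1) (Var 0) \<rightarrow>\<^sub>t Univ w)
       (Pi (Pi (Var 2) (Var 1 \<cdot> (Const (SumInl u v) \<cdot> Var 3 \<cdot> Var 2 \<cdot> Var 0)))
         (Pi (Pi (Var 2) (Var 2 \<cdot> (Const (SumInr u v) \<cdot> Var 4 \<cdot> Var 3 \<cdot> Var 0)))
           (Pi (SumTy u v (Var 4) (Var 3)) (Var 3 \<cdot> Var 0))))))"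
| "const_type (SigT u v) = Pi (Univ u) ((Var 0 \<rightarrow>\<^sub>t Univ v) \<rightarrow>\<^sub>t Univ (sup u v))"
| "const_type (SigPair u v) =
     Pi (Univ u) (Pi (Var 0 \<rightarrow>\<^sub>t Univ v)
       (Pi (Var 1) (Var 1 \<cdot> Var 0 \<rightarrow>\<^sub>t SigTy u v (Var 2) (Var 1))))"
| "const_type (SigInd u v w) =
     Pi (Univ u) (Pi (Var 0 \<rightarrow>\<^sub>t Univ v) (Pi (SigTy u v (Var 1) (Var 0) \<rightarrow>\<^sub>t Univ w)
       (Pi (Pi (Var 2) (Pi (Var 2 \<cdot> Var 0)
              (Var 2 \<cdot> (Const (SigPair u v) \<cdot> Var 4 \<cdot> Var 3 \<cdot> Var 1 \<cdot> Var 0))))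
         (Pi (SigTy u v (Var 3) (Var 2)) (Var 2 \<cdot> Var 0)))))"
| "const_type (IdT u) = Pi (Univ u) (Var 0 \<rightarrow>\<^sub>t Var 0 \<rightarrow>\<^sub>t Univ u)"
| "const_type (IdRefl u) = Pi (Univ u) (Pi (Var 0) (Eq u (Var 1) (Var 0) (Var 0)))"
| "const_type (IdInd u w) =
     Pi (Univ u) (Pi (Pi (Var 0) (Pi (Var 1) (Eq u (Var 2) (Var 1) (Var 0) \<rightarrow>\<^sub>t Univ w)))
       (Pi (Pi (Var 1) (Var 1 \<cdot> Var 0 \<cdot> Var 0 \<cdot> Refl u (Var 2) (Var 0)))
         (Pi (Var 2) (Pi (Var 3) (Pi (Eq u (Var 4) (Var 1) (Var 0))
           (Var 4 \<cdot> Var 2 \<cdot> Var 1 \<cdot> Var 0))))))"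
| "const_type (Trunc u) = Univ u \<rightarrow>\<^sub>t Univ u"
| "const_type (TruncIn u) = Pi (Univ u) (Var 0 \<rightarrow>\<^sub>t Const (Trunc u) \<cdot> Var 0)"
| "const_type (TruncProp u) = Pi (Univ u) (is_prop u (Const (Trunc u) \<cdot> Var 0))"
| "const_type (TruncRec u v) =
     Pi (Univ u) (Pi (Univ v)
       (is_prop v (Var 0) \<rightarrow>\<^sub>t (Var 1 \<rightarrow>\<^sub>t Var 0) \<rightarrow>\<^sub>t Const (Trunc u) \<cdot> Var 1 \<rightarrow>\<^sub>t Var 0))"
| "const_type (Univalence u) =
     Pi (Univ u) (Pi (Univ u)
       (is_equiv (usuc u) u (Eq (usuc u) (Univ u) (Var 1) (Var 0)) (Equiv u u (Var 1) (Var 0))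
         (id_to_equiv u \<cdot> Var 1 \<cdot> Var 0)))"


section \<open>Judgements\<close>

text \<open>Defining equations of the eliminators; they are imposed only on well-typed terms below.\<close>

inductive iota :: "'l tm \<Rightarrow> 'l tm \<Rightarrow> bool" where
  iota_unit: "iota (Const (UnitInd u w) \<cdot> C \<cdot> c \<cdot> Const (UnitPt u)) c"
| iota_zero: "iota (Const (NatInd u w) \<cdot> C \<cdot> z \<cdot> s \<cdot> Const (NatZero u)) z"
| iota_suc: "iota (Const (NatInd u w) \<cdot> C \<cdot> z \<cdot> s \<cdot> (Const (NatSuc u) \<cdot> n))
    (s \<cdot> n \<cdot> (Const (NatInd u w) \<cdot> C \<cdot> z \<cdot> s \<cdot> n))"
| iota_inl: "iota (Const (SumInd u v w) \<cdot> A \<cdot> B \<cdot> C \<cdot> f \<cdot> g \<cdot> (Const (SumInl u v) \<cdot> A \<cdot> B \<cdot> a)) (f \<cdot> a)"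
| iota_inr: "iota (Const (SumInd u v w) \<cdot> A \<cdot> B \<cdot> C \<cdot> f \<cdot> g \<cdot> (Const (SumInr u v) \<cdot> A \<cdot> B \<cdot> b)) (g \<cdot> b)"
| iota_pair: "iota (Const (SigInd u v w) \<cdot> A \<cdot> B \<cdot> C \<cdot> f \<cdot> (Const (SigPair u v) \<cdot> A \<cdot> B \<cdot> a \<cdot> b))
    (f \<cdot> a \<cdot> b)"
| iota_refl: "iota (Const (IdInd u w) \<cdot> A \<cdot> C \<cdot> d \<cdot> a \<cdot> a \<cdot> (Const (IdRefl u) \<cdot> A \<cdot> a)) (d \<cdot> a)"

text \<open>Contexts are lists whose head is the type of variable 0.\<close>

inductive
  wf_ctx :: "'l::universe_level tm list \<Rightarrow> bool"
  and typed :: "'l tm list \<Rightarrow> 'l tm \<Rightarrow> 'l tm \<Rightarrow> bool"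
    (\<open>(_ \<turnstile> _ \<Colon> _)\<close> [50, 50, 50] 50)
  and equal :: "'l tm list \<Rightarrow> 'l tm \<Rightarrow> 'l tm \<Rightarrow> 'l tm \<Rightarrow> bool"
    (\<open>(_ \<turnstile> _ \<doteq> _ \<Colon> _)\<close> [50, 50, 50, 50] 50)
where
  ctx_nil: "wf_ctx []"
| ctx_cons: "wf_ctx \<Gamma> \<Longrightarrow> \<Gamma> \<turnstile> A \<Colon> Univ u \<Longrightarrow> wf_ctx (A # \<Gamma>)"

| ty_var: "wf_ctx \<Gamma> \<Longrightarrow> i < length \<Gamma> \<Longrightarrow> \<Gamma> \<turnstile> Var i \<Colon> wk (Suc i) (\<Gamma> ! i)"
| ty_univ: "wf_ctx \<Gamma> \<Longrightarrow> \<Gamma> \<turnstile> Univ u \<Colon> Univ (usuc u)"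
| ty_const: "wf_ctx \<Gamma> \<Longrightarrow> \<Gamma> \<turnstile> Const c \<Colon> const_type c"
| ty_pi: "\<Gamma> \<turnstile> A \<Colon> Univ u \<Longrightarrow> A # \<Gamma> \<turnstile> B \<Colon> Univ v \<Longrightarrow> \<Gamma> \<turnstile> Pi A B \<Colon> Univ (sup u v)"
| ty_lam: "\<Gamma> \<turnstile> A \<Colon> Univ u \<Longrightarrow> A # \<Gamma> \<turnstile> b \<Colon> B \<Longrightarrow> \<Gamma> \<turnstile> Lam A b \<Colon> Pi A B"
| ty_app: "\<Gamma> \<turnstile> f \<Colon> Pi A B \<Longrightarrow> \<Gamma> \<turnstile> a \<Colon> A \<Longrightarrow> \<Gamma> \<turnstile> f \<cdot> a \<Colon> inst B a"
| ty_conv: "\<Gamma> \<turnstile> a \<Colon> A \<Longrightarrow> \<Gamma> \<turnstile> A \<doteq> B \<Colon> Univ u \<Longrightarrow> \<Gamma> \<turnstile> a \<Colon> B"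

| eq_refl: "\<Gamma> \<turnstile> a \<Colon> A \<Longrightarrow> \<Gamma> \<turnstile> a \<doteq> a \<Colon> A"
| eq_sym: "\<Gamma> \<turnstile> a \<doteq> b \<Colon> A \<Longrightarrow> \<Gamma> \<turnstile> b \<doteq> a \<Colon> A"
| eq_trans: "\<Gamma> \<turnstile> a \<doteq> b \<Colon> A \<Longrightarrow> \<Gamma> \<turnstile> b \<doteq> c \<Colon> A \<Longrightarrow> \<Gamma> \<turnstile> a \<doteq> c \<Colon> A"
| eq_conv: "\<Gamma> \<turnstile> a \<doteq> b \<Colon> A \<Longrightarrow> \<Gamma> \<turnstile> A \<doteq> B \<Colon> Univ u \<Longrightarrow> \<Gamma> \<turnstile> a \<doteq> b \<Colon> B"
| eq_pi: "\<Gamma> \<turnstile> A \<Colon> Univ u \<Longrightarrow> \<Gamma> \<turnstile> A \<doteq> A' \<Colon> Univ u \<Longrightarrow> A # \<Gamma> \<turnstile> B \<doteq> B' \<Colon> Univ v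
    \<Longrightarrow> \<Gamma> \<turnstile> Pi A B \<doteq> Pi A' B' \<Colon> Univ (sup u v)"
| eq_lam: "\<Gamma> \<turnstile> A \<Colon> Univ u \<Longrightarrow> \<Gamma> \<turnstile> A \<doteq> A' \<Colon> Univ u \<Longrightarrow> A # \<Gamma> \<turnstile> b \<doteq> b' \<Colon> B
    \<Longrightarrow> \<Gamma> \<turnstile> Lam A b \<doteq> Lam A' b' \<Colon> Pi A B"
| eq_app: "\<Gamma> \<turnstile> f \<doteq> f' \<Colon> Pi A B \<Longrightarrow> \<Gamma> \<turnstile> a \<doteq> a' \<Colon> A \<Longrightarrow> \<Gamma> \<turnstile> f \<cdot> a \<doteq> f' \<cdot> a' \<Colon> inst B a"
| eq_beta: "\<Gamma> \<turnstile> A \<Colon> Univ u \<Longrightarrow> A # \<Gamma> \<turnstile> b \<Colon> B \<Longrightarrow> \<Gamma> \<turnstile> a \<Colon> A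
    \<Longrightarrow> \<Gamma> \<turnstile> Lam A b \<cdot> a \<doteq> inst b a \<Colon> inst B a"
| eq_eta: "\<Gamma> \<turnstile> f \<Colon> Pi A B \<Longrightarrow> \<Gamma> \<turnstile> f \<doteq> Lam A (wk 1 f \<cdot> Var 0) \<Colon> Pi A B"
| eq_iota: "iota a b \<Longrightarrow> \<Gamma> \<turnstile> a \<Colon> A \<Longrightarrow> \<Gamma> \<turnstile> b \<Colon> A \<Longrightarrow> \<Gamma> \<turnstile> a \<doteq> b \<Colon> A"

text \<open>
  The closed type \<open>A\<close> is inhabited under the hypotheses \<open>H\<close>, a set of closed types: a construction
  may use variables ranging over finitely many members of \<open>H\<close>.
\<close>

definition inhabited_under :: "'l::universe_level tm set \<Rightarrow> 'l tm \<Rightarrow> bool" where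
  "inhabited_under H A \<longleftrightarrow> (\<exists>\<Delta> t. set \<Delta> \<subseteq> H \<and> \<Delta> \<turnstile> t \<Colon> A)"

\<comment> \<open>\<open>\<Pi>(P : \<U>). is_prop P \<rightarrow> \<Sigma>(Q : \<V>). P \<simeq> Q\<close>, for all universes \<open>\<U>\<close>, \<open>\<V>\<close>.\<close>
definition propositional_resizing :: "'l::universe_level tm set" where
  "propositional_resizing =
     {Pi (Univ u) (is_prop u (Var 0) \<rightarrow>\<^sub>t
        Sg (usuc v) (sup u v) (Univ v) (Equiv u v (Var 1) (Var 0))) | u v. True}"

end

theory Submission
  imports Defs
begin

text \<open>
  Both directions avoid resizing.  If \<open>D\<close> is an injective set, then \<open>s x y = (x = y)\<close> embeds \<open>D\<close>
  into \<open>D \<rightarrow> \<Omega>\<close>.  For \<open>A : D \<rightarrow> \<Omega>\<close> the type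
  \<open>P = \<Sigma>(x : D). \<parallel>\<Pi> y. A y \<rightarrow> x = y\<parallel> \<times> A x\<close> is a proposition in the \<^emph>\<open>small\<close> universe, so that
  extending the first projection along the embedding \<open>P \<rightarrow> \<one>\<close> gives a point of \<open>D\<close>, which is
  \<open>x\<close> if \<open>A = s x\<close>.

  Conversely, let \<open>D\<close> be a retract of \<open>X \<rightarrow> \<Omega>\<close>.  Mutual inclusion of the associated subsets is a
  reflexive proposition-valued relation on \<open>D\<close> which implies equality, so \<open>D\<close> is a set by
  Hedberg's argument; and \<open>X \<rightarrow> \<Omega>\<close> is injective because \<open>F : X' \<rightarrow> X \<rightarrow> \<Omega>\<close> extends along an
  embedding \<open>j\<close> to \<open>\<lambda>y x. \<parallel>\<Sigma> x'. (j x' = y) \<times> F x' x\<parallel>\<close>.  This needs extensionality: precomposition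
  with the diagonal \<open>B \<rightarrow> \<Sigma>(x y : B). x = y\<close> is injective by univalence, and function extensionality
  follows since the two projections agree after it; a product of propositions is a proposition
  because each inhabited proposition equals \<open>\<one>\<close>, hence so does the family.

  The proof terms are written with natural numbers as levels and checked by a type checker that is
  proved sound and evaluated by rewriting.  The map sending \<open>n\<close> to the \<open>n\<close>-th successor of \<open>\<U>\<close>
  carries the resulting derivation to an arbitrary universe.
\<close>

section \<open>Renaming and substitution\<close>

abbreviation lift_ren :: "(nat \<Rightarrow> nat) \<Rightarrow> nat \<Rightarrow> nat" where
  "lift_ren \<rho> \<equiv> case_nat 0 (\<lambda>i. Suc (\<rho> i))"

abbreviation lift_sub :: "(nat \<Rightarrow> 'l tm) \<Rightarrow> nat \<Rightarrow> 'l tm" where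
  "lift_sub \<sigma> \<equiv> case_nat (Var 0) (\<lambda>i. wk (Suc 0) (\<sigma> i))"

lemma ren_ren: "ren \<rho> (ren \<rho>' t) = ren (\<lambda>i. \<rho> (\<rho>' i)) t"
proof (induction t arbitrary: \<rho> \<rho>')
  have *: "(\<lambda>i. lift_ren \<rho> (lift_ren \<rho>' i)) = lift_ren (\<lambda>i. \<rho> (\<rho>' i))" for \<rho> \<rho>' :: "nat \<Rightarrow> nat"
    by (auto simp: fun_eq_iff split: nat.split)
  {
    case (Pi A B)
    then show ?case by (simp add: *)
  next
    case (Lam A b)
    then show ?case by (simp add: *)
  }
qed auto

lemma sub_ren: "sub \<sigma> (ren \<rho> t) = sub (\<lambda>i. \<sigma> (\<rho> i)) t"
proof (induction t arbitrary: \<sigma> \<rho>)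
  have *: "(\<lambda>i. lift_sub \<sigma> (lift_ren \<rho> i)) = lift_sub (\<lambda>i. \<sigma> (\<rho> i))"
    for \<sigma> :: "nat \<Rightarrow> 'l tm" and \<rho> :: "nat \<Rightarrow> nat"
    by (auto simp: fun_eq_iff split: nat.split)
  {
    case (Pi A B)
    then show ?case by (simp add: *)
  next
    case (Lam A b)
    then show ?case by (simp add: *)
  }
qed auto

lemma ren_lift_wk: "ren (lift_ren \<rho>) (wk (Suc 0) t) = wk (Suc 0) (ren \<rho> t)"
  by (simp add: wk_def ren_ren)

lemma ren_sub: "ren \<rho> (sub \<sigma> t) = sub (\<lambda>i. ren \<rho> (\<sigma> i)) t"
proof (induction t arbitrary: \<sigma> \<rho>)
  have *: "(\<lambda>i. ren (lift_ren \<rho>) (lift_sub \<sigma> i)) = lift_sub (\<lambda>i. ren \<rho> (\<sigma> i))"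
    for \<sigma> :: "nat \<Rightarrow> 'l tm" and \<rho> :: "nat \<Rightarrow> nat"
    using ren_lift_wk[of \<rho>] by (auto simp: fun_eq_iff split: nat.split)
  {
    case (Pi A B)
    then show ?case by (simp add: *)
  next
    case (Lam A b)
    then show ?case by (simp add: *)
  }
qed auto

lemma sub_lift_wk: "sub (lift_sub \<sigma>) (wk (Suc 0) t) = wk (Suc 0) (sub \<sigma> t)"
proof -
  have "wk (Suc 0) (sub \<sigma> t) = sub (\<lambda>i. wk (Suc 0) (\<sigma> i)) t" by (simp add: wk_def ren_sub)
  then show ?thesis by (simp add: wk_def sub_ren)
qed

lemma sub_sub: "sub \<sigma> (sub \<tau> t) = sub (\<lambda>i. sub \<sigma> (\<tau> i)) t"
proof (induction t arbitrary: \<sigma> \<tau>)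
  have *: "(\<lambda>i. sub (lift_sub \<sigma>) (lift_sub \<tau> i)) = lift_sub (\<lambda>i. sub \<sigma> (\<tau> i))"
    for \<sigma> \<tau> :: "nat \<Rightarrow> 'l tm"
    using sub_lift_wk[of \<sigma>] by (auto simp: fun_eq_iff split: nat.split)
  {
    case (Pi A B)
    then show ?case by (simp add: *)
  next
    case (Lam A b)
    then show ?case by (simp add: *)
  }
qed auto

lemma lift_sub_Var: "lift_sub Var = Var"
  by (auto simp: fun_eq_iff wk_def split: nat.split)

lemma sub_Var [simp]: "sub Var t = t"
  by (induction t) (simp_all add: lift_sub_Var)

lemma ren_eq_sub: "ren \<rho> t = sub (\<lambda>i. Var (\<rho> i)) t"
  using sub_ren[of Var \<rho> t] by simp

lemma wk_eq_sub: "wk n t = sub (\<lambda>i. Var (i + n)) t"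
  by (simp add: wk_def ren_eq_sub)

lemma wk_0 [simp]: "wk 0 t = t"
  by (simp add: wk_eq_sub)

lemma wk_wk: "wk m (wk n t) = wk (n + m) t"
  by (simp add: wk_def ren_ren add.assoc)

lemma sub_inst: "sub \<sigma> (inst B a) = inst (sub (lift_sub \<sigma>) B) (sub \<sigma> a)"
proof -
  have "(\<lambda>i. sub \<sigma> (case_nat a Var i)) = (\<lambda>i. sub (case_nat (sub \<sigma> a) Var) (lift_sub \<sigma> i))"
    by (auto simp: fun_eq_iff wk_eq_sub sub_sub split: nat.split)
  then show ?thesis by (simp add: inst_def sub_sub)
qed

lemma ren_inst: "ren \<rho> (inst B a) = inst (ren (lift_ren \<rho>) B) (ren \<rho> a)"
proof -
  have "(\<lambda>i. ren \<rho> (case_nat a Var i)) = (\<lambda>i. case_nat (ren \<rho> a) Var (lift_ren \<rho> i))"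
    by (auto simp: fun_eq_iff split: nat.split)
  then show ?thesis by (simp add: inst_def ren_sub sub_ren)
qed

lemma inst_wk [simp]: "inst (wk (Suc n) t) a = wk n t"
  by (simp add: inst_def wk_eq_sub sub_sub)

text \<open>Substituting under a binder and then instantiating is one substitution with
  \<open>a\<close> in front. The checker relies on this when a delayed environment is extended by
  one more argument.\<close>

lemma inst_sub_lift: "inst (sub (lift_sub \<sigma>) B) a = sub (case_nat a \<sigma>) B"
proof -
  have "(\<lambda>i. sub (case_nat a Var) (lift_sub \<sigma> i)) = case_nat a \<sigma>"
    by (auto simp: fun_eq_iff wk_eq_sub sub_sub split: nat.split)
  then show ?thesis by (simp add: inst_def sub_sub)
qed

section \<open>Scopes and closed terms\<close>

primrec scoped :: "nat \<Rightarrow> 'l tm \<Rightarrow> bool" where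
  "scoped n (Var i) = (i < n)"
| "scoped n (Univ u) = True"
| "scoped n (Pi A B) = (scoped n A \<and> scoped (Suc n) B)"
| "scoped n (Lam A b) = (scoped n A \<and> scoped (Suc n) b)"
| "scoped n (f \<cdot> a) = (scoped n f \<and> scoped n a)"
| "scoped n (Const c) = True"

lemma sub_scoped: "scoped n t \<Longrightarrow> (\<And>i. i < n \<Longrightarrow> \<sigma> i = Var i) \<Longrightarrow> sub \<sigma> t = t"
proof (induction t arbitrary: n \<sigma>)
  have *: "i < Suc n \<Longrightarrow> lift_sub \<sigma> i = Var i" if "\<And>i. i < n \<Longrightarrow> \<sigma> i = Var i"
    for n i and \<sigma> :: "nat \<Rightarrow> 'l tm"
    using that by (cases i) (auto simp: wk_def)
  {
    case (Pi A B)
    then show ?case using Pi.prems Pi.IH(1)[of n \<sigma>] Pi.IH(2)[of "Suc n" "lift_sub \<sigma>"] *[OF Pi.prems(2)] by simp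
  next
    case (Lam A b)
    then show ?case using Lam.prems Lam.IH(1)[of n \<sigma>] Lam.IH(2)[of "Suc n" "lift_sub \<sigma>"] *[OF Lam.prems(2)] by simp
  }
qed auto

lemma sub_closed: "scoped 0 t \<Longrightarrow> sub \<sigma> t = t"
  using sub_scoped by blast

lemma ren_closed: "scoped 0 t \<Longrightarrow> ren \<rho> t = t"
  by (simp add: ren_eq_sub sub_closed)

lemma scoped_ren: "scoped n t \<Longrightarrow> (\<And>i. i < n \<Longrightarrow> \<rho> i < m) \<Longrightarrow> scoped m (ren \<rho> t)"
proof (induction t arbitrary: n m \<rho>)
  have *: "i < Suc n \<Longrightarrow> lift_ren \<rho> i < Suc m" if "\<And>i. i < n \<Longrightarrow> \<rho> i < m" for n m i and \<rho> :: "nat \<Rightarrow> nat"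
    using that by (cases i) auto
  {
    case (Pi A B)
    then show ?case using Pi.prems Pi.IH(1)[of n \<rho> m] Pi.IH(2)[of "Suc n" "lift_ren \<rho>" "Suc m"] *[OF Pi.prems(2)] by simp
  next
    case (Lam A b)
    then show ?case using Lam.prems Lam.IH(1)[of n \<rho> m] Lam.IH(2)[of "Suc n" "lift_ren \<rho>" "Suc m"] *[OF Lam.prems(2)] by simp
  }
qed auto

lemma scoped_wk: "k \<le> n \<Longrightarrow> scoped (n - k) t \<Longrightarrow> scoped n (wk k t)"
  by (auto simp: wk_def intro: scoped_ren)

text \<open>Closedness makes the types of constants invariant under \<open>ren\<close> and
  \<open>sub\<close>, which settles the \<open>ty_const\<close> cases of the stability
  theorems.\<close>

lemma scoped_const_type: "scoped 0 (const_type c)"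
  by (cases c) (simp_all add: arr_def Eq_def Refl_def Sg_def Pr_def Fst_def Prod_def is_prop_def
      is_equiv_def Equiv_def id_equiv_def id_to_equiv_def Let_def scoped_wk)

lemmas sub_const_type [simp] = sub_closed[OF scoped_const_type]
lemmas ren_const_type [simp] = ren_closed[OF scoped_const_type]

section \<open>Admissible rules\<close>

lemma iota_sub: "iota a b \<Longrightarrow> iota (sub \<sigma> a) (sub \<sigma> b)"
  by (induction rule: iota.induct) (auto intro: iota.intros)

lemma iota_ren: "iota a b \<Longrightarrow> iota (ren \<rho> a) (ren \<rho> b)"
  by (simp add: ren_eq_sub iota_sub)

lemma typed_wf: "\<Gamma> \<turnstile> t \<Colon> T \<Longrightarrow> wf_ctx \<Gamma>"
  and equal_wf: "\<Gamma> \<turnstile> t \<doteq> s \<Colon> T \<Longrightarrow> wf_ctx \<Gamma>"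
  by (induction rule: wf_ctx_typed_equal.inducts(2,3)[where ?P1.0="\<lambda>_. True"]) auto

section \<open>Stability of the judgements under renaming\<close>

definition is_ren :: "'l::universe_level tm list \<Rightarrow> (nat \<Rightarrow> nat) \<Rightarrow> 'l tm list \<Rightarrow> bool" where
  "is_ren \<Delta> \<rho> \<Gamma> \<longleftrightarrow> wf_ctx \<Delta> \<and>
     (\<forall>i<length \<Gamma>. \<rho> i < length \<Delta> \<and> wk (Suc (\<rho> i)) (\<Delta> ! \<rho> i) = ren \<rho> (wk (Suc i) (\<Gamma> ! i)))"

lemma is_ren_lift:
  assumes "is_ren \<Delta> \<rho> \<Gamma>" "\<Delta> \<turnstile> ren \<rho> A \<Colon> Univ u"
  shows "is_ren (ren \<rho> A # \<Delta>) (lift_ren \<rho>) (A # \<Gamma>)"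
  unfolding is_ren_def
proof (intro conjI allI impI)
  show "wf_ctx (ren \<rho> A # \<Delta>)" using assms ctx_cons by (auto simp: is_ren_def)
next
  fix i assume i: "i < length (A # \<Gamma>)"
  show "lift_ren \<rho> i < length (ren \<rho> A # \<Delta>)"
    using i assms(1) by (auto simp: is_ren_def split: nat.split)
  show "wk (Suc (lift_ren \<rho> i)) ((ren \<rho> A # \<Delta>) ! lift_ren \<rho> i) = ren (lift_ren \<rho>) (wk (Suc i) ((A # \<Gamma>) ! i))"
  proof (cases i)
    case 0
    then show ?thesis using ren_lift_wk[of \<rho> A] by simp
  next
    case (Suc k)
    then have "wk (Suc (\<rho> k)) (\<Delta> ! \<rho> k) = ren \<rho> (wk (Suc k) (\<Gamma> ! k))"
      using i assms(1) by (auto simp: is_ren_def)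
    then have "wk (Suc 0) (wk (Suc (\<rho> k)) (\<Delta> ! \<rho> k)) = wk (Suc 0) (ren \<rho> (wk (Suc k) (\<Gamma> ! k)))"
      by simp
    then show ?thesis using Suc ren_lift_wk[of \<rho> "wk (Suc k) (\<Gamma> ! k)"] by (simp add: wk_wk)
  qed
qed

text \<open>Typing and equality are treated together because \<open>ty_conv\<close> and
  \<open>eq_refl\<close> pass between them. Every binder rule carries a typing of its domain, which
  after renaming makes the extended target context well formed.\<close>

lemma typed_ren: "\<Gamma> \<turnstile> t \<Colon> T \<Longrightarrow> is_ren \<Delta> \<rho> \<Gamma> \<Longrightarrow> \<Delta> \<turnstile> ren \<rho> t \<Colon> ren \<rho> T"
  and equal_ren: "\<Gamma> \<turnstile> t \<doteq> s \<Colon> T \<Longrightarrow> is_ren \<Delta> \<rho> \<Gamma> \<Longrightarrow> \<Delta> \<turnstile> ren \<rho> t \<doteq> ren \<rho> s \<Colon> ren \<rho> T"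
proof (induction arbitrary: \<Delta> \<rho> and \<Delta> \<rho> rule: wf_ctx_typed_equal.inducts(2,3)[where ?P1.0="\<lambda>_. True"])
  case (ty_var \<Gamma> i)
  then have "\<rho> i < length \<Delta>" "ren \<rho> (wk (Suc i) (\<Gamma> ! i)) = wk (Suc (\<rho> i)) (\<Delta> ! \<rho> i)" "wf_ctx \<Delta>"
    by (auto simp: is_ren_def)
  then show ?case by (simp add: wf_ctx_typed_equal.ty_var)
next
  case (ty_pi \<Gamma> A u B v)
  have "\<Delta> \<turnstile> ren \<rho> A \<Colon> Univ u" using ty_pi by simp
  then show ?case using ty_pi is_ren_lift by (simp) (blast intro: wf_ctx_typed_equal.ty_pi)
next
  case (ty_lam \<Gamma> A u b B)
  have "\<Delta> \<turnstile> ren \<rho> A \<Colon> Univ u" using ty_lam by simp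
  then show ?case using ty_lam is_ren_lift by (simp) (blast intro: wf_ctx_typed_equal.ty_lam)
next
  case (ty_app \<Gamma> f A B a)
  then show ?case by (simp add: ren_inst) (blast intro: wf_ctx_typed_equal.ty_app)
next
  case (eq_pi \<Gamma> A u A' B B' v)
  have "\<Delta> \<turnstile> ren \<rho> A \<Colon> Univ u" using eq_pi by simp
  then show ?case using eq_pi is_ren_lift by (simp) (blast intro: wf_ctx_typed_equal.eq_pi)
next
  case (eq_lam \<Gamma> A u A' b b' B)
  have "\<Delta> \<turnstile> ren \<rho> A \<Colon> Univ u" using eq_lam by simp
  then show ?case using eq_lam is_ren_lift by (simp) (blast intro: wf_ctx_typed_equal.eq_lam)
next
  case (eq_app \<Gamma> f f' A B a a')
  then show ?case by (simp add: ren_inst) (blast intro: wf_ctx_typed_equal.eq_app)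
next
  case (eq_beta \<Gamma> A u b B a)
  have "\<Delta> \<turnstile> ren \<rho> A \<Colon> Univ u" using eq_beta by simp
  then show ?case using eq_beta is_ren_lift by (simp add: ren_inst) (blast intro: wf_ctx_typed_equal.eq_beta)
next
  case (eq_eta \<Gamma> f A B)
  have "ren (lift_ren \<rho>) (wk (Suc 0) f) = wk (Suc 0) (ren \<rho> f)" by (rule ren_lift_wk)
  then show ?case using eq_eta wf_ctx_typed_equal.eq_eta by fastforce
next
  case (eq_iota a b \<Gamma> A)
  then show ?case by (blast intro: wf_ctx_typed_equal.eq_iota iota_ren)
next
  case (ty_conv \<Gamma> a A B u)
  then show ?case by simp (blast intro: wf_ctx_typed_equal.ty_conv)
next
  case (eq_trans \<Gamma> a b A c)
  then show ?case by (blast intro: wf_ctx_typed_equal.eq_trans)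
next
  case (eq_conv \<Gamma> a b A B u)
  then show ?case by simp (blast intro: wf_ctx_typed_equal.eq_conv)
qed (auto simp: is_ren_def intro: wf_ctx_typed_equal.intros)

lemma is_ren_wk: "wf_ctx (\<Gamma>' @ \<Gamma>) \<Longrightarrow> is_ren (\<Gamma>' @ \<Gamma>) (\<lambda>i. i + length \<Gamma>') \<Gamma>"
  by (auto simp: is_ren_def wk_def[symmetric] wk_wk nth_append)

lemma typed_wk: "\<Gamma> \<turnstile> t \<Colon> T \<Longrightarrow> wf_ctx (A # \<Gamma>) \<Longrightarrow> A # \<Gamma> \<turnstile> wk (Suc 0) t \<Colon> wk (Suc 0) T"
  using typed_ren[OF _ is_ren_wk[of "[A]"]] by (simp add: wk_def)

lemma equal_wk: "\<Gamma> \<turnstile> t \<doteq> s \<Colon> T \<Longrightarrow> wf_ctx (A # \<Gamma>) \<Longrightarrow> A # \<Gamma> \<turnstile> wk (Suc 0) t \<doteq> wk (Suc 0) s \<Colon> wk (Suc 0) T"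
  using equal_ren[OF _ is_ren_wk[of "[A]"]] by (simp add: wk_def)

section \<open>Stability of the judgements under substitution\<close>

definition is_sub :: "'l::universe_level tm list \<Rightarrow> (nat \<Rightarrow> 'l tm) \<Rightarrow> 'l tm list \<Rightarrow> bool" where
  "is_sub \<Delta> \<sigma> \<Gamma> \<longleftrightarrow> wf_ctx \<Delta> \<and> (\<forall>i<length \<Gamma>. \<Delta> \<turnstile> \<sigma> i \<Colon> sub \<sigma> (wk (Suc i) (\<Gamma> ! i)))"

lemma is_sub_lift:
  assumes "is_sub \<Delta> \<sigma> \<Gamma>" "\<Delta> \<turnstile> sub \<sigma> A \<Colon> Univ u"
  shows "is_sub (sub \<sigma> A # \<Delta>) (lift_sub \<sigma>) (A # \<Gamma>)"
  unfolding is_sub_def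
proof (intro conjI allI impI)
  show wf: "wf_ctx (sub \<sigma> A # \<Delta>)" using assms ctx_cons by (auto simp: is_sub_def)
  fix i assume i: "i < length (A # \<Gamma>)"
  show "sub \<sigma> A # \<Delta> \<turnstile> lift_sub \<sigma> i \<Colon> sub (lift_sub \<sigma>) (wk (Suc i) ((A # \<Gamma>) ! i))"
  proof (cases i)
    case 0
    then show ?thesis using ty_var[OF wf, of 0] sub_lift_wk[of \<sigma> A] by simp
  next
    case (Suc k)
    then have "\<Delta> \<turnstile> \<sigma> k \<Colon> sub \<sigma> (wk (Suc k) (\<Gamma> ! k))" using i assms(1) by (auto simp: is_sub_def)
    from typed_wk[OF this wf] show ?thesis
      using Suc sub_lift_wk[of \<sigma> "wk (Suc k) (\<Gamma> ! k)"] by (simp add: wk_wk)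
  qed
qed

text \<open>The induction repeats that for renamings, which had to come first: lifting a
  substitution under a binder weakens its components.\<close>

lemma typed_sub: "\<Gamma> \<turnstile> t \<Colon> T \<Longrightarrow> is_sub \<Delta> \<sigma> \<Gamma> \<Longrightarrow> \<Delta> \<turnstile> sub \<sigma> t \<Colon> sub \<sigma> T"
  and equal_sub: "\<Gamma> \<turnstile> t \<doteq> s \<Colon> T \<Longrightarrow> is_sub \<Delta> \<sigma> \<Gamma> \<Longrightarrow> \<Delta> \<turnstile> sub \<sigma> t \<doteq> sub \<sigma> s \<Colon> sub \<sigma> T"
proof (induction arbitrary: \<Delta> \<sigma> and \<Delta> \<sigma> rule: wf_ctx_typed_equal.inducts(2,3)[where ?P1.0="\<lambda>_. True"])
  case (ty_var \<Gamma> i)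
  then show ?case by (auto simp: is_sub_def)
next
  case (ty_pi \<Gamma> A u B v)
  have "\<Delta> \<turnstile> sub \<sigma> A \<Colon> Univ u" using ty_pi by simp
  then show ?case using ty_pi is_sub_lift by (simp) (blast intro: wf_ctx_typed_equal.ty_pi)
next
  case (ty_lam \<Gamma> A u b B)
  have "\<Delta> \<turnstile> sub \<sigma> A \<Colon> Univ u" using ty_lam by simp
  then show ?case using ty_lam is_sub_lift by (simp) (blast intro: wf_ctx_typed_equal.ty_lam)
next
  case (ty_app \<Gamma> f A B a)
  then show ?case by (simp add: sub_inst) (blast intro: wf_ctx_typed_equal.ty_app)
next
  case (eq_pi \<Gamma> A u A' B B' v)
  have "\<Delta> \<turnstile> sub \<sigma> A \<Colon> Univ u" using eq_pi by simp
  then show ?case using eq_pi is_sub_lift by (simp) (blast intro: wf_ctx_typed_equal.eq_pi)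
next
  case (eq_lam \<Gamma> A u A' b b' B)
  have "\<Delta> \<turnstile> sub \<sigma> A \<Colon> Univ u" using eq_lam by simp
  then show ?case using eq_lam is_sub_lift by (simp) (blast intro: wf_ctx_typed_equal.eq_lam)
next
  case (eq_app \<Gamma> f f' A B a a')
  then show ?case by (simp add: sub_inst) (blast intro: wf_ctx_typed_equal.eq_app)
next
  case (eq_beta \<Gamma> A u b B a)
  have "\<Delta> \<turnstile> sub \<sigma> A \<Colon> Univ u" using eq_beta by simp
  then show ?case using eq_beta is_sub_lift by (simp add: sub_inst) (blast intro: wf_ctx_typed_equal.eq_beta)
next
  case (eq_eta \<Gamma> f A B)
  have "sub (lift_sub \<sigma>) (wk (Suc 0) f) = wk (Suc 0) (sub \<sigma> f)" by (rule sub_lift_wk)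
  then show ?case using eq_eta wf_ctx_typed_equal.eq_eta by fastforce
next
  case (eq_iota a b \<Gamma> A)
  then show ?case by (blast intro: wf_ctx_typed_equal.eq_iota iota_sub)
next
  case (ty_conv \<Gamma> a A B u)
  then show ?case by simp (blast intro: wf_ctx_typed_equal.ty_conv)
next
  case (eq_trans \<Gamma> a b A c)
  then show ?case by (blast intro: wf_ctx_typed_equal.eq_trans)
next
  case (eq_conv \<Gamma> a b A B u)
  then show ?case by simp (blast intro: wf_ctx_typed_equal.eq_conv)
qed (auto simp: is_sub_def intro: wf_ctx_typed_equal.intros)

lemma is_sub_inst:
  assumes "\<Gamma> \<turnstile> a \<Colon> A"
  shows "is_sub \<Gamma> (case_nat a Var) (A # \<Gamma>)"
  unfolding is_sub_def
proof (intro conjI allI impI)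
  show wf: "wf_ctx \<Gamma>" using assms by (rule typed_wf)
  fix i assume "i < length (A # \<Gamma>)"
  then show "\<Gamma> \<turnstile> case_nat a Var i \<Colon> sub (case_nat a Var) (wk (Suc i) ((A # \<Gamma>) ! i))"
    using assms ty_var[OF wf] by (cases i) (simp_all flip: inst_def)
qed

lemma typed_inst: "A # \<Gamma> \<turnstile> b \<Colon> B \<Longrightarrow> \<Gamma> \<turnstile> a \<Colon> A \<Longrightarrow> \<Gamma> \<turnstile> inst b a \<Colon> inst B a"
  using typed_sub[OF _ is_sub_inst] by (simp add: inst_def)

text \<open>The identity is a substitution between the two contexts once variable 0 is retyped by
  \<open>ty_conv\<close>, so this is an instance of \<open>typed_sub\<close>.\<close>

lemma typed_ctx_conv:
  assumes "A' # \<Gamma> \<turnstile> b \<Colon> B" "\<Gamma> \<turnstile> A \<doteq> A' \<Colon> Univ u" "\<Gamma> \<turnstile> A \<Colon> Univ v"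
  shows "A # \<Gamma> \<turnstile> b \<Colon> B"
proof -
  have wf: "wf_ctx (A # \<Gamma>)" using ctx_cons[OF typed_wf] assms(3) by blast
  have "A # \<Gamma> \<turnstile> Var 0 \<Colon> wk (Suc 0) A" using ty_var[OF wf, of 0] by simp
  then have "A # \<Gamma> \<turnstile> Var 0 \<Colon> wk (Suc 0) A'"
    using ty_conv equal_wk[OF assms(2) wf] by (fastforce simp: wk_def)
  then have "is_sub (A # \<Gamma>) Var (A' # \<Gamma>)"
    using ty_var[OF wf, of "Suc i" for i] by (auto simp: is_sub_def wf nth_Cons split: nat.split)
  from typed_sub[OF assms(1) this] show ?thesis by simp
qed

text \<open>Only \<open>ty_pi\<close> and \<open>ty_conv\<close> give a \<open>Pi\<close> a type,
  and conversion leaves the subject alone.\<close>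

lemma typed_Pi_inv: "\<Gamma> \<turnstile> Pi A B \<Colon> T \<Longrightarrow> (\<exists>u. \<Gamma> \<turnstile> A \<Colon> Univ u) \<and> (\<exists>v. A # \<Gamma> \<turnstile> B \<Colon> Univ v)"
  by (induction \<Gamma> "Pi A B" T rule: wf_ctx_typed_equal.inducts(2)[where ?P1.0="\<lambda>_. True" and ?P3.0="\<lambda>_ _ _ _. True"]) auto

lemma typed_scoped: "\<Gamma> \<turnstile> t \<Colon> T \<Longrightarrow> scoped (length \<Gamma>) t"
  by (induction rule: wf_ctx_typed_equal.inducts(2)[where ?P1.0="\<lambda>_. True" and ?P3.0="\<lambda>_ _ _ _. True"]) auto

text \<open>Congruence of \<open>inst\<close> is not among the rules. It comes from applying
  \<open>Lam A B\<close> to both points: \<open>eq_app\<close> relates the applications and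
  \<open>eq_beta\<close> evaluates them.\<close>

lemma equal_inst:
  assumes A: "\<Gamma> \<turnstile> A \<Colon> Univ u" and B: "A # \<Gamma> \<turnstile> B \<Colon> Univ v"
    and a: "\<Gamma> \<turnstile> a \<Colon> A" and a': "\<Gamma> \<turnstile> a' \<Colon> A" and e: "\<Gamma> \<turnstile> a \<doteq> a' \<Colon> A"
  shows "\<Gamma> \<turnstile> inst B a \<doteq> inst B a' \<Colon> Univ v"
proof -
  have "inst (Univ v) x = Univ v" for x :: "'a tm" by (simp add: inst_def)
  then show ?thesis
    using eq_beta[OF A B a] eq_beta[OF A B a'] eq_app[OF eq_refl[OF ty_lam[OF A B]] e]
    by (metis eq_sym eq_trans)
qed

section \<open>A type checker\<close>

text \<open>First-order counterpart of \<open>wk\<close>: the cutoff \<open>c\<close> counts the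
  binders passed, in place of a renaming lifted at each of them.\<close>

primrec shift :: "nat \<Rightarrow> nat \<Rightarrow> 'l tm \<Rightarrow> 'l tm" where
  "shift n c (Var i) = Var (if i < c then i else i + n)"
| "shift n c (Univ u) = Univ u"
| "shift n c (Pi A B) = Pi (shift n c A) (shift n (Suc c) B)"
| "shift n c (Lam A b) = Lam (shift n c A) (shift n (Suc c) b)"
| "shift n c (f \<cdot> a) = shift n c f \<cdot> shift n c a"
| "shift n c (Const k) = Const k"

text \<open>First-order counterpart of \<open>sub\<close>, where \<open>k\<close> counts the binders
  passed; \<open>env\<close> below is the substitution that it computes.\<close>

primrec psub :: "nat \<Rightarrow> 'l tm list \<Rightarrow> 'l tm \<Rightarrow> 'l tm" where
  "psub k e (Var i) = (if i < k then Var i else if i - k < length e then shift k 0 (e ! (i - k)) else Var (i - length e))"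
| "psub k e (Univ u) = Univ u"
| "psub k e (Pi A B) = Pi (psub k e A) (psub (Suc k) e B)"
| "psub k e (Lam A b) = Lam (psub k e A) (psub (Suc k) e b)"
| "psub k e (f \<cdot> a) = psub k e f \<cdot> psub k e a"
| "psub k e (Const c) = Const c"

definition close :: "'l tm list \<Rightarrow> 'l tm \<Rightarrow> 'l tm" where
  "close e T = (case e of [] \<Rightarrow> T | _ \<Rightarrow> psub 0 e T)"

text \<open>Only eliminations of a pair and of reflexivity are contracted; the other clauses of
  \<open>iota\<close> are not tried.\<close>

definition iota_redex :: "'l tm \<Rightarrow> 'l tm \<Rightarrow> 'l tm option" where
  "iota_redex f p = (case p of
      Const (SigPair u' v') \<cdot> A' \<cdot> B' \<cdot> a \<cdot> b \<Rightarrow> (case f of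
         Const (SigInd u v w) \<cdot> A \<cdot> B \<cdot> C \<cdot> g \<Rightarrow>
            if u = u' \<and> v = v' \<and> A = A' \<and> B = B' then Some (g \<cdot> a \<cdot> b) else None
       | _ \<Rightarrow> None)
    | Const (IdRefl u') \<cdot> A' \<cdot> a' \<Rightarrow> (case f of
         Const (IdInd u w) \<cdot> A \<cdot> C \<cdot> d \<cdot> a \<cdot> b \<Rightarrow>
            if u = u' \<and> A = A' \<and> a = a' \<and> b = a' then Some (d \<cdot> a) else None
       | _ \<Rightarrow> None)
    | _ \<Rightarrow> None)"

primrec is_elim :: "'l const \<Rightarrow> bool" where
  "is_elim (EmptyT u) = False" | "is_elim (EmptyInd u v) = False" | "is_elim (UnitT u) = False"
| "is_elim (UnitPt u) = False" | "is_elim (UnitInd u v) = False"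
| "is_elim (NatT u) = False" | "is_elim (NatZero u) = False" | "is_elim (NatSuc u) = False"
| "is_elim (NatInd u v) = False"
| "is_elim (SumT u v) = False" | "is_elim (SumInl u v) = False" | "is_elim (SumInr u v) = False"
| "is_elim (SumInd u v w) = False"
| "is_elim (SigT u v) = False" | "is_elim (SigPair u v) = False" | "is_elim (SigInd u v w) = True"
| "is_elim (IdT u) = False" | "is_elim (IdRefl u) = False" | "is_elim (IdInd u v) = True"
| "is_elim (Trunc u) = False" | "is_elim (TruncIn u) = False" | "is_elim (TruncProp u) = False"
| "is_elim (TruncRec u v) = False" | "is_elim (Univalence u) = False"

primrec elim_head :: "'l tm \<Rightarrow> bool" where
  "elim_head (Var i) = False" | "elim_head (Univ u) = False" | "elim_head (Pi A B) = False"
| "elim_head (Lam A b) = False" | "elim_head (f \<cdot> a) = elim_head f" | "elim_head (Const c) = is_elim c"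

definition red_iota :: "'l tm \<Rightarrow> 'l tm \<Rightarrow> 'l tm option" where
  "red_iota f p = (if elim_head f then iota_redex f p else None)"

primrec is_lam :: "'l tm \<Rightarrow> bool" where
  "is_lam (Var i) = False" | "is_lam (Univ u) = False" | "is_lam (Pi A B) = False"
| "is_lam (Lam A b) = True" | "is_lam (f \<cdot> a) = False" | "is_lam (Const c) = False"

text \<open>Irreducibility for the contractions that the checker performs. The nested conditionals
  are evaluated lazily under rewriting, unlike conjunctions.\<close>

primrec irred :: "'l tm \<Rightarrow> bool" where
  "irred (Var i) = True"
| "irred (Univ u) = True"
| "irred (Pi A B) = (if irred A then irred B else False)"
| "irred (Lam A b) = (if irred A then irred b else False)"
| "irred (f \<cdot> a) = (if is_lam f then False else if irred f then if irred a then
     (case red_iota f a of None \<Rightarrow> True | Some _ \<Rightarrow> False) else False else False)"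
| "irred (Const c) = True"

text \<open>The type of a constant mentions only constants of smaller rank.\<close>

primrec rank :: "'l const \<Rightarrow> nat" where
  "rank (EmptyT u) = 0" | "rank (EmptyInd u v) = 1" | "rank (UnitT u) = 0"
| "rank (UnitPt u) = 1" | "rank (UnitInd u v) = 2"
| "rank (NatT u) = 0" | "rank (NatZero u) = 1" | "rank (NatSuc u) = 1" | "rank (NatInd u v) = 2"
| "rank (SumT u v) = 0" | "rank (SumInl u v) = 1" | "rank (SumInr u v) = 1" | "rank (SumInd u v w) = 2"
| "rank (SigT u v) = 0" | "rank (SigPair u v) = 1" | "rank (SigInd u v w) = 2"
| "rank (IdT u) = 0" | "rank (IdRefl u) = 1" | "rank (IdInd u v) = 2"
| "rank (Trunc u) = 0" | "rank (TruncIn u) = 1" | "rank (TruncProp u) = 1" | "rank (TruncRec u v) = 1"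
| "rank (Univalence u) = 3"

text \<open>
  \<open>Some (t', T, e)\<close> means that \<open>t\<close> has the type \<open>close e T\<close> and is judgementally equal to \<open>t'\<close>; the
  substitution \<open>e\<close> is delayed so that the codomain of a curried function is not normalised after each
  argument.  The flag requests a normal form.  Injectivity of \<open>Pi\<close> is not available, and with it
  neither subject reduction nor uniqueness of types; therefore each reduct is checked again, and
  \<open>correct\<close> below records the type of the body of an abstraction.
\<close>

type_synonym judg = "(nat tm \<times> nat tm \<times> nat tm list) option"
type_synonym infer_fun = "bool \<Rightarrow> nat tm list \<Rightarrow> nat tm \<Rightarrow> judg"

fun univ_val :: "judg \<Rightarrow> nat tm option" where
  "univ_val (Some (T, Univ u, e)) = Some T"
| "univ_val _ = None"

text \<open>\<open>ty_conv\<close> asks for an equality of types inside some universe; hence the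
  type of the computed \<open>Univ u\<close> has to be a universe as well.\<close>

fun if_univ :: "nat tm \<Rightarrow> judg \<Rightarrow> (nat tm \<times> nat) option" where
  "if_univ T (Some (Univ u, Univ v, e)) = Some (T, u)"
| "if_univ T _ = None"

fun level_of :: "infer_fun \<Rightarrow> nat tm list \<Rightarrow> judg \<Rightarrow> (nat tm \<times> nat) option" where
  "level_of M \<Gamma> (Some (T, Univ u, e)) = Some (T, u)"
| "level_of M \<Gamma> (Some (T, S, e)) = if_univ T (M True \<Gamma> (close e S))"
| "level_of M \<Gamma> None = None"

definition norm :: "infer_fun \<Rightarrow> nat tm list \<Rightarrow> nat tm \<Rightarrow> nat tm option" where
  "norm M \<Gamma> T = (if irred T then Some T else map_option fst (level_of M \<Gamma> (M True \<Gamma> T)))"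

fun with_ty :: "nat tm \<Rightarrow> nat tm option \<Rightarrow> (nat tm \<times> nat tm) option" where
  "with_ty t (Some T) = Some (t, T)"
| "with_ty t None = None"

text \<open>An abstraction keeps its inferred type: converting its \<open>Pi\<close> type to a
  normal form would leave no typing of the body at the new codomain, as \<open>Pi\<close> is not
  known to be injective.\<close>

fun force :: "infer_fun \<Rightarrow> nat tm list \<Rightarrow> judg \<Rightarrow> (nat tm \<times> nat tm) option" where
  "force M \<Gamma> (Some (t, T, e)) = (if is_lam t then Some (t, T) else with_ty t (norm M \<Gamma> (close e T)))"
| "force M \<Gamma> None = None"

fun at_ty :: "nat tm \<Rightarrow> (nat tm \<times> nat tm) option \<Rightarrow> nat tm option" where
  "at_ty T (Some (t, T')) = (if T = T' then Some t else None)"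
| "at_ty T None = None"

definition synth :: "infer_fun \<Rightarrow> bool \<Rightarrow> nat tm list \<Rightarrow> nat tm \<Rightarrow> nat tm \<Rightarrow> nat tm option" where
  "synth M m \<Gamma> t T = at_ty T (force M \<Gamma> (M m \<Gamma> t))"

text \<open>If the domain of an abstraction agrees with that of the expected \<open>Pi\<close>, only
  the body is checked; the domain is typed by inversion of the expected type. Otherwise the inferred
  type is compared syntactically.\<close>

primrec against :: "infer_fun \<Rightarrow> bool \<Rightarrow> nat tm \<Rightarrow> nat tm list \<Rightarrow> nat tm \<Rightarrow> nat tm option" where
  "against M m (Var i) \<Gamma> T = synth M m \<Gamma> (Var i) T"
| "against M m (Univ u) \<Gamma> T = synth M m \<Gamma> (Univ u) T"
| "against M m (Pi A B) \<Gamma> T = synth M m \<Gamma> (Pi A B) T"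
| "against M m (Lam A b) \<Gamma> T = (case T of
     Pi A' B \<Rightarrow> (if A = A' then map_option (Lam A) (against M m b (A # \<Gamma>) B) else synth M m \<Gamma> (Lam A b) T)
   | _ \<Rightarrow> synth M m \<Gamma> (Lam A b) T)"
| "against M m (f \<cdot> a) \<Gamma> T = synth M m \<Gamma> (f \<cdot> a) T"
| "against M m (Const c) \<Gamma> T = synth M m \<Gamma> (Const c) T"

fun mk_pi :: "nat tm \<Rightarrow> nat \<Rightarrow> (nat tm \<times> nat) option \<Rightarrow> judg" where
  "mk_pi A u (Some (B, v)) = Some (Pi A B, Univ (sup u v), [])"
| "mk_pi A u None = None"

fun infer_pi :: "infer_fun \<Rightarrow> bool \<Rightarrow> nat tm list \<Rightarrow> nat tm \<Rightarrow> (nat tm \<times> nat) option \<Rightarrow> judg" where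
  "infer_pi M m \<Gamma> B (Some (A, u)) = mk_pi A u (level_of M (A # \<Gamma>) (M m (A # \<Gamma>) B))"
| "infer_pi M m \<Gamma> B None = None"

fun mk_lam :: "nat tm \<Rightarrow> (nat tm \<times> nat tm) option \<Rightarrow> judg" where
  "mk_lam A (Some (b, B)) = Some (Lam A b, Pi A B, [])"
| "mk_lam A None = None"

fun infer_lam :: "infer_fun \<Rightarrow> bool \<Rightarrow> nat tm list \<Rightarrow> nat tm \<Rightarrow> (nat tm \<times> nat) option \<Rightarrow> judg" where
  "infer_lam M m \<Gamma> b (Some (A, u)) = mk_lam A (force M (A # \<Gamma>) (M m (A # \<Gamma>) b))"
| "infer_lam M m \<Gamma> b None = None"

fun contract :: "nat tm \<Rightarrow> nat tm \<Rightarrow> nat tm option" where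
  "contract (Lam A b) a = Some (psub 0 [a] b)"
| "contract f a = red_iota f a"

fun with_nil :: "nat tm \<Rightarrow> nat tm option \<Rightarrow> judg" where
  "with_nil T (Some t) = Some (t, T, [])"
| "with_nil T None = None"

fun infer_reduct :: "infer_fun \<Rightarrow> nat tm list \<Rightarrow> nat tm \<Rightarrow> nat tm option \<Rightarrow> judg" where
  "infer_reduct M \<Gamma> r (Some T) = with_nil T (against M True r \<Gamma> T)"
| "infer_reduct M \<Gamma> r None = None"

fun reduce :: "infer_fun \<Rightarrow> nat tm list \<Rightarrow> nat tm \<Rightarrow> nat tm \<Rightarrow> nat tm \<Rightarrow> nat tm list \<Rightarrow> nat tm option \<Rightarrow> judg" where
  "reduce M \<Gamma> f a B e None = Some (f \<cdot> a, B, a # e)"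
| "reduce M \<Gamma> f a B e (Some r) = infer_reduct M \<Gamma> r (norm M \<Gamma> (close (a # e) B))"

fun mk_app :: "infer_fun \<Rightarrow> bool \<Rightarrow> nat tm list \<Rightarrow> nat tm \<Rightarrow> nat tm \<Rightarrow> nat tm list \<Rightarrow> nat tm option \<Rightarrow> judg" where
  "mk_app M m \<Gamma> f B e (Some a) =
     (if m then reduce M \<Gamma> f a B e (contract f a) else Some (f \<cdot> a, B, a # e))"
| "mk_app M m \<Gamma> f B e None = None"

fun app_dom :: "infer_fun \<Rightarrow> bool \<Rightarrow> nat tm list \<Rightarrow> nat tm \<Rightarrow> nat tm \<Rightarrow> nat tm list \<Rightarrow> nat tm \<Rightarrow> nat tm option \<Rightarrow> judg" where
  "app_dom M m \<Gamma> f B e a (Some A) = mk_app M m \<Gamma> f B e (against M m a \<Gamma> A)"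
| "app_dom M m \<Gamma> f B e a None = None"

fun app_nf :: "infer_fun \<Rightarrow> bool \<Rightarrow> nat tm list \<Rightarrow> nat tm \<Rightarrow> nat tm \<Rightarrow> nat tm option \<Rightarrow> judg" where
  "app_nf M m \<Gamma> f a (Some (Pi A B)) = mk_app M m \<Gamma> f B [] (against M m a \<Gamma> A)"
| "app_nf M m \<Gamma> f a _ = None"

fun infer_app :: "infer_fun \<Rightarrow> bool \<Rightarrow> nat tm list \<Rightarrow> nat tm \<Rightarrow> judg \<Rightarrow> judg" where
  "infer_app M m \<Gamma> a (Some (f, Pi A B, e)) = app_dom M m \<Gamma> f B e a (norm M \<Gamma> (close e A))"
| "infer_app M m \<Gamma> a (Some (f, T, e)) = app_nf M m \<Gamma> f a (norm M \<Gamma> (close e T))"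
| "infer_app M m \<Gamma> a None = None"

text \<open>One layer of the checker, with recursive calls to \<open>M\<close>. The bound
  \<open>r\<close> restricts constants by rank, so that soundness at \<open>r\<close> rests on the
  types of constants of smaller rank.\<close>

primrec step :: "nat \<Rightarrow> infer_fun \<Rightarrow> bool \<Rightarrow> nat tm list \<Rightarrow> nat tm \<Rightarrow> judg" where
  "step r M m \<Gamma> (Var i) = (if i < length \<Gamma> then Some (Var i, shift (Suc i) 0 (\<Gamma> ! i), []) else None)"
| "step r M m \<Gamma> (Univ u) = Some (Univ u, Univ (usuc u), [])"
| "step r M m \<Gamma> (Const c) = (if rank c < r then Some (Const c, const_type c, []) else None)"
| "step r M m \<Gamma> (Pi A B) = infer_pi M m \<Gamma> B (level_of M \<Gamma> (M True \<Gamma> A))"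
| "step r M m \<Gamma> (Lam A b) = infer_lam M m \<Gamma> b (level_of M \<Gamma> (M True \<Gamma> A))"
| "step r M m \<Gamma> (f \<cdot> a) = infer_app M m \<Gamma> a (M m \<Gamma> f)"

text \<open>The second argument is fuel. The request for a normal form is dropped when the term is
  irreducible already.\<close>

primrec infer :: "nat \<Rightarrow> nat \<Rightarrow> infer_fun" where
  "infer r 0 m \<Gamma> t = None"
| "infer r (Suc k) m \<Gamma> t = step r (infer r k) (if m then \<not> irred t else False) \<Gamma> t"

section \<open>Soundness of the checker\<close>

lemma shift_eq_ren: "shift n c t = ren (\<lambda>i. if i < c then i else i + n) t"
proof (induction t arbitrary: c)
  have *: "lift_ren (\<lambda>i. if i < c then i else i + n) = (\<lambda>i. if i < Suc c then i else i + n)" for c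
    by (auto simp: fun_eq_iff split: nat.split)
  {
    case (Pi A B)
    then show ?case by (simp add: *)
  next
    case (Lam A b)
    then show ?case by (simp add: *)
  }
qed auto

lemma wk_eq_shift [code]: "wk n t = shift n 0 t"
  by (simp add: shift_eq_ren wk_def)

definition env :: "nat \<Rightarrow> 'l tm list \<Rightarrow> nat \<Rightarrow> 'l tm" where
  "env k e i = (if i < k then Var i else if i - k < length e then wk k (e ! (i - k)) else Var (i - length e))"

lemma wk_Var [simp]: "wk n (Var i) = Var (i + n)"
  by (simp add: wk_def)

lemma wk_Univ [simp]: "wk n (Univ u) = Univ u"
  by (simp add: wk_def)

lemma lift_env: "lift_sub (env k e) = env (Suc k) e"
  by (auto simp: fun_eq_iff env_def wk_wk Suc_diff_le not_less split: nat.split)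

lemma psub_eq_sub: "psub k e t = sub (env k e) t"
  by (induction t arbitrary: k) (auto simp: lift_env, auto simp: env_def wk_eq_shift)

lemma env_Nil: "env 0 [] = Var"
  by (auto simp: env_def)

lemma env_Cons: "env 0 (a # e) = case_nat a (env 0 e)"
  by (auto simp: fun_eq_iff env_def split: nat.split)

lemma close_eq_sub: "close e T = sub (env 0 e) T"
  by (cases e) (simp_all add: close_def psub_eq_sub env_Nil)

lemma psub_singleton: "psub 0 [a] t = inst t a"
  by (simp add: psub_eq_sub env_Cons env_Nil inst_def)

lemma iota_redex: "iota_redex f p = Some r \<Longrightarrow> iota (f \<cdot> p) r"
  unfolding iota_redex_def by (auto split: tm.splits const.splits if_splits intro: iota.intros)

text \<open>The last conjunct makes \<open>typed_Pi_inv\<close> and \<open>norm_typed\<close>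
  applicable to \<open>T\<close>.\<close>

definition same :: "'l::universe_level tm list \<Rightarrow> 'l tm \<Rightarrow> 'l tm \<Rightarrow> 'l tm \<Rightarrow> bool" where
  "same \<Gamma> t t' T \<longleftrightarrow> \<Gamma> \<turnstile> t \<Colon> T \<and> \<Gamma> \<turnstile> t' \<Colon> T \<and> \<Gamma> \<turnstile> t' \<doteq> t \<Colon> T \<and> (\<exists>u. \<Gamma> \<turnstile> T \<Colon> Univ u)"

definition correct :: "'l::universe_level tm list \<Rightarrow> 'l tm \<Rightarrow> 'l tm \<Rightarrow> 'l tm \<Rightarrow> bool" where
  "correct \<Gamma> t t' T \<longleftrightarrow> same \<Gamma> t t' T \<and> (\<forall>A b. t' = Lam A b \<longrightarrow> (\<exists>B. T = Pi A B \<and> A # \<Gamma> \<turnstile> b \<Colon> B))"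

text \<open>The environment of an abstraction must be empty, so that the \<open>Pi\<close> type
  recorded by \<open>correct\<close> is literally the returned one.\<close>

definition sound :: "infer_fun \<Rightarrow> bool" where
  "sound M \<longleftrightarrow> (\<forall>m \<Gamma> t t' T e. wf_ctx \<Gamma> \<longrightarrow> M m \<Gamma> t = Some (t', T, e) \<longrightarrow>
     correct \<Gamma> t t' (close e T) \<and> (is_lam t' \<longrightarrow> e = []))"

lemma is_lam_iff: "is_lam t \<longleftrightarrow> (\<exists>A b. t = Lam A b)"
  by (cases t) auto

lemma same_conv:
  assumes "same \<Gamma> t t' T" "\<Gamma> \<turnstile> T \<doteq> T' \<Colon> Univ u" "\<Gamma> \<turnstile> T' \<Colon> Univ v"
  shows "same \<Gamma> t t' T'"
  using assms unfolding same_def by (blast intro: ty_conv eq_conv)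

lemma correct_conv:
  assumes "correct \<Gamma> t t' T" "\<Gamma> \<turnstile> T \<doteq> T' \<Colon> Univ u" "\<Gamma> \<turnstile> T' \<Colon> Univ v" "\<not> is_lam t'"
  shows "correct \<Gamma> t t' T'"
  using assms same_conv unfolding correct_def is_lam_iff by blast

lemma close_Univ [simp]: "close e (Univ u) = Univ u"
  by (simp add: close_eq_sub)

lemma close_Nil [simp]: "close [] T = T"
  by (simp add: close_def)

lemma univ_val_Some: "univ_val j = Some T \<longleftrightarrow> (\<exists>u e. j = Some (T, Univ u, e))"
  by (cases j rule: univ_val.cases) auto

lemma with_ty_Some [simp]: "with_ty t n = Some (t', T) \<longleftrightarrow> t = t' \<and> n = Some T"
  by (cases n) auto

lemma with_nil_Some [simp]: "with_nil T n = Some (t, T', e) \<longleftrightarrow> n = Some t \<and> T = T' \<and> e = []"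
  by (cases n) auto

lemma level_of_sound:
  assumes M: "sound M" and wf: "wf_ctx \<Gamma>" and T': "level_of M \<Gamma> (M m \<Gamma> T) = Some (T', u)"
  shows "\<Gamma> \<turnstile> T' \<doteq> T \<Colon> Univ u" "\<Gamma> \<turnstile> T' \<Colon> Univ u" "\<Gamma> \<turnstile> T \<Colon> Univ u"
proof -
  obtain T0 S e where j: "M m \<Gamma> T = Some (T0, S, e)" using T' by (cases "M m \<Gamma> T") auto
  have c: "same \<Gamma> T T0 (close e S)" using M wf j by (auto simp: sound_def correct_def)
  have "same \<Gamma> T T' (Univ u)"
  proof (cases "\<exists>u. S = Univ u")
    case True
    then show ?thesis using T' j c by auto
  next
    case False
    then have i: "if_univ T0 (M True \<Gamma> (close e S)) = Some (T', u)" using T' j by (cases S) auto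
    then obtain v e' where "M True \<Gamma> (close e S) = Some (Univ u, Univ v, e')" and T0: "T0 = T'"
      by (auto elim: if_univ.elims)
    then have "same \<Gamma> (close e S) (Univ u) (Univ v)"
      using M wf by (fastforce simp: sound_def correct_def)
    then show ?thesis using same_conv[OF c eq_sym] T0 unfolding same_def by blast
  qed
  then show "\<Gamma> \<turnstile> T' \<doteq> T \<Colon> Univ u" "\<Gamma> \<turnstile> T' \<Colon> Univ u" "\<Gamma> \<turnstile> T \<Colon> Univ u"
    by (auto simp: same_def)
qed

text \<open>The first alternative arises because an irreducible type is returned without being
  checked.\<close>

lemma norm_sound:
  assumes "sound M" "wf_ctx \<Gamma>" "norm M \<Gamma> T = Some T'"
  shows "T = T' \<or> (\<exists>u. \<Gamma> \<turnstile> T' \<doteq> T \<Colon> Univ u \<and> \<Gamma> \<turnstile> T' \<Colon> Univ u \<and> \<Gamma> \<turnstile> T \<Colon> Univ u)"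
  using assms(3) level_of_sound[OF assms(1,2)] by (auto simp: norm_def split: if_splits) blast

lemma norm_typed:
  assumes "sound M" "\<Gamma> \<turnstile> T \<Colon> Univ u" "norm M \<Gamma> T = Some T'"
  obtains v where "\<Gamma> \<turnstile> T' \<doteq> T \<Colon> Univ v" "\<Gamma> \<turnstile> T' \<Colon> Univ v" "\<Gamma> \<turnstile> T \<Colon> Univ v"
  using norm_sound[OF assms(1) typed_wf[OF assms(2)] assms(3)] assms(2) by (blast intro: eq_refl)

lemma force_sound:
  assumes M: "sound M" and wf: "wf_ctx \<Gamma>" and j: "j = M m \<Gamma> t" and f: "force M \<Gamma> j = Some (t', T)"
  shows "correct \<Gamma> t t' T"
proof -
  obtain T0 e where j': "M m \<Gamma> t = Some (t', T0, e)"
    using j f by (cases "M m \<Gamma> t") (auto split: if_splits)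
  have c: "correct \<Gamma> t t' (close e T0)" "is_lam t' \<longrightarrow> e = []"
    using M wf j' by (auto simp: sound_def)
  show ?thesis
  proof (cases "is_lam t'")
    case True
    then show ?thesis using c f j j' by simp
  next
    case False
    then have n: "norm M \<Gamma> (close e T0) = Some T" using f j j' by auto
    obtain u where "\<Gamma> \<turnstile> close e T0 \<Colon> Univ u" using c(1) by (auto simp: correct_def same_def)
    from norm_typed[OF M this n] show ?thesis using correct_conv[OF c(1) eq_sym] False by blast
  qed
qed

lemma synth_sound:
  assumes "sound M" "wf_ctx \<Gamma>" "synth M m \<Gamma> t T = Some t'"
  shows "correct \<Gamma> t t' T"
  using assms(3) force_sound[OF assms(1,2) refl]
  by (auto simp: synth_def split: if_splits elim!: at_ty.elims)

text \<open>The body is known over the normalised domain \<open>A'\<close>. It is moved to the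
  context with \<open>A\<close>, and the resulting \<open>Pi A B\<close> is converted to
  \<open>Pi A' B\<close> by \<open>eq_pi\<close>.\<close>

lemma correct_Lam:
  assumes A: "\<Gamma> \<turnstile> A' \<Colon> Univ u" "\<Gamma> \<turnstile> A \<Colon> Univ u" "\<Gamma> \<turnstile> A' \<doteq> A \<Colon> Univ u"
    and b: "A' # \<Gamma> \<turnstile> b \<Colon> B" "A' # \<Gamma> \<turnstile> b' \<Colon> B" "A' # \<Gamma> \<turnstile> b' \<doteq> b \<Colon> B" and B: "A' # \<Gamma> \<turnstile> B \<Colon> Univ v"
  shows "correct \<Gamma> (Lam A b) (Lam A' b') (Pi A' B)"
proof -
  have "A # \<Gamma> \<turnstile> b \<Colon> B" "A # \<Gamma> \<turnstile> B \<Colon> Univ v"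
    using typed_ctx_conv[OF b(1) eq_sym[OF A(3)] A(2)] typed_ctx_conv[OF B eq_sym[OF A(3)] A(2)] .
  then have "\<Gamma> \<turnstile> Lam A b \<Colon> Pi A B" "\<Gamma> \<turnstile> Pi A' B \<doteq> Pi A B \<Colon> Univ (sup u v)"
    using ty_lam[OF A(2)] eq_pi[OF A(1) A(3) eq_refl[OF B]] by auto
  then have "\<Gamma> \<turnstile> Lam A b \<Colon> Pi A' B" by (blast intro: ty_conv eq_sym)
  then show ?thesis
    unfolding correct_def same_def using ty_lam[OF A(1) b(2)] eq_lam[OF A(1) A(3) b(3)] ty_pi[OF A(1) B] b(2) by auto
qed

lemma against_sound:
  assumes M: "sound M"
  shows "\<Gamma> \<turnstile> T \<Colon> Univ u \<Longrightarrow> against M m t \<Gamma> T = Some t' \<Longrightarrow> correct \<Gamma> t t' T"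
proof (induction t arbitrary: \<Gamma> T t' u)
  case (Lam A b)
  note wf = typed_wf[OF Lam.prems(1)]
  show ?case
  proof (cases "\<exists>B. T = Pi A B")
    case True
    then obtain B where T: "T = Pi A B" by blast
    then obtain b' where b': "t' = Lam A b'" "against M m b (A # \<Gamma>) B = Some b'"
      using Lam.prems(2) by auto
    obtain v w where v: "\<Gamma> \<turnstile> A \<Colon> Univ v" "A # \<Gamma> \<turnstile> B \<Colon> Univ w"
      using typed_Pi_inv Lam.prems(1) T by blast
    then show ?thesis
      using correct_Lam[OF v(1) v(1) eq_refl[OF v(1)]] Lam.IH(2)[OF v(2) b'(2)] T b'(1)
      by (auto simp: correct_def same_def)
  next
    case False
    then have "synth M m \<Gamma> (Lam A b) T = Some t'"
      using Lam.prems(2) by (auto split: tm.splits if_splits)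
    then show ?thesis using synth_sound M wf by blast
  qed
qed (use synth_sound[OF M typed_wf] in auto)

lemma sound_apply:
  assumes "sound M" "wf_ctx \<Gamma>" "M m \<Gamma> t = Some (t', T, e)"
  shows "correct \<Gamma> t t' (close e T)" "is_lam t' \<Longrightarrow> e = []"
  using assms by (auto simp: sound_def)

lemma infer_pi_sound:
  assumes M: "sound M" and wf: "wf_ctx \<Gamma>" and r: "infer_pi M m \<Gamma> B (level_of M \<Gamma> (M True \<Gamma> A)) = Some (t', T, e)"
  shows "correct \<Gamma> (Pi A B) t' (close e T) \<and> (is_lam t' \<longrightarrow> e = [])"
proof -
  obtain A' u B' v where A': "level_of M \<Gamma> (M True \<Gamma> A) = Some (A', u)"
    and B': "level_of M (A' # \<Gamma>) (M m (A' # \<Gamma>) B) = Some (B', v)"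
    and t': "t' = Pi A' B'" "T = Univ (sup u v)" "e = []"
    using r by (auto elim!: infer_pi.elims mk_pi.elims[OF sym])
  note A = level_of_sound(3,2,1)[OF M wf A']
  note B = level_of_sound(3,2,1)[OF M ctx_cons[OF wf A(2)] B']
  show ?thesis
    using ty_pi[OF A(1) typed_ctx_conv[OF B(1) eq_sym[OF A(3)] A(1)]] ty_pi[OF A(2) B(2)]
      eq_pi[OF A(2,3) B(3)] ty_univ[OF wf] t' by (auto simp: correct_def same_def)
qed

lemma infer_lam_sound:
  assumes M: "sound M" and wf: "wf_ctx \<Gamma>" and r: "infer_lam M m \<Gamma> b (level_of M \<Gamma> (M True \<Gamma> A)) = Some (t', T, e)"
  shows "correct \<Gamma> (Lam A b) t' (close e T) \<and> (is_lam t' \<longrightarrow> e = [])"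
proof -
  obtain A' u b' B where A': "level_of M \<Gamma> (M True \<Gamma> A) = Some (A', u)"
    and B: "force M (A' # \<Gamma>) (M m (A' # \<Gamma>) b) = Some (b', B)"
    and t': "t' = Lam A' b'" "T = Pi A' B" "e = []"
    using r by (auto elim!: infer_lam.elims mk_lam.elims[OF sym])
  note A = level_of_sound(2,3,1)[OF M wf A']
  show ?thesis
    using correct_Lam[OF A] force_sound[OF M ctx_cons[OF wf A(1)] refl B] t' by (auto simp: correct_def same_def)
qed

text \<open>The common type is instantiated at the normalised argument; \<open>equal_inst\<close>
  carries the original application there.\<close>

lemma same_app:
  assumes f: "same \<Gamma> f f' (Pi A B)" and a: "same \<Gamma> a a' A"
  shows "same \<Gamma> (f \<cdot> a) (f' \<cdot> a') (inst B a')"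
proof -
  obtain w where "\<Gamma> \<turnstile> Pi A B \<Colon> Univ w" using f by (auto simp: same_def)
  then obtain u v where A: "\<Gamma> \<turnstile> A \<Colon> Univ u" and B: "A # \<Gamma> \<turnstile> B \<Colon> Univ v"
    using typed_Pi_inv by blast
  have a: "\<Gamma> \<turnstile> a \<Colon> A" "\<Gamma> \<turnstile> a' \<Colon> A" "\<Gamma> \<turnstile> a' \<doteq> a \<Colon> A" using a by (auto simp: same_def)
  have e: "\<Gamma> \<turnstile> inst B a' \<doteq> inst B a \<Colon> Univ v" by (rule equal_inst[OF A B a(2,1,3)])
  have "\<Gamma> \<turnstile> inst B a' \<Colon> Univ v"
    using typed_inst[OF B a(2)] by (simp add: inst_def)
  then show ?thesis
    using f a ty_conv[OF ty_app[OF _ a(1)] eq_sym[OF e]] unfolding same_def by (blast intro: ty_app eq_app)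
qed

text \<open>A contraction needs typings that subject reduction would otherwise supply. For
  \<open>eq_beta\<close> the body is typed at the right codomain by \<open>correct\<close>; for
  \<open>eq_iota\<close> the reduct is typed by the renewed check through
  \<open>against\<close>.\<close>

lemma mk_app_sound:
  assumes M: "sound M" and wf: "wf_ctx \<Gamma>"
    and f: "correct \<Gamma> f f' (close e (Pi A B))" "is_lam f' \<Longrightarrow> e = []"
    and a: "\<And>a'. a1 = Some a' \<Longrightarrow> same \<Gamma> a a' (close e A)"
    and r: "mk_app M m \<Gamma> f' B e a1 = Some (t', T, e')"
  shows "correct \<Gamma> (f \<cdot> a) t' (close e' T) \<and> (is_lam t' \<longrightarrow> e' = [])"
proof -
  obtain a' where a': "a1 = Some a'" using r by (cases a1) auto
  have "same \<Gamma> f f' (Pi (close e A) (sub (lift_sub (env 0 e)) B))"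
    using f(1) by (simp add: close_eq_sub correct_def)
  \<comment> \<open>By \<open>inst_sub_lift\<close>, instantiating the lifted environment at
    \<open>a'\<close> gives exactly the environment \<open>a' # e\<close>.\<close>
  from same_app[OF this a[OF a']] have c: "correct \<Gamma> (f \<cdot> a) (f' \<cdot> a') (close (a' # e) B)"
    using inst_sub_lift[of "env 0 e" B a'] by (simp add: close_eq_sub env_Cons correct_def)
  show ?thesis
  proof (cases "m \<and> contract f' a' \<noteq> None")
    case False
    then have "t' = f' \<cdot> a'" "T = B" "e' = a' # e" using r a' by (auto split: if_splits)
    then show ?thesis using c by simp
  next
    case True
    then obtain s where s: "contract f' a' = Some s" by blast
    then have "infer_reduct M \<Gamma> s (norm M \<Gamma> (close (a' # e) B)) = Some (t', T, e')"
      using r a' True by simp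
    then have n: "norm M \<Gamma> (close (a' # e) B) = Some T" and t: "against M True s \<Gamma> T = Some t'" and e': "e' = []"
      by (cases "norm M \<Gamma> (close (a' # e) B)"; simp)+
    obtain u where "\<Gamma> \<turnstile> close (a' # e) B \<Colon> Univ u" using c by (auto simp: correct_def same_def)
    from norm_typed[OF M this n] obtain v where T: "\<Gamma> \<turnstile> T \<doteq> close (a' # e) B \<Colon> Univ v" "\<Gamma> \<turnstile> T \<Colon> Univ v"
      by blast
    have ct: "correct \<Gamma> s t' T" using against_sound[OF M T(2) t] .
    have cT: "\<Gamma> \<turnstile> f \<cdot> a \<Colon> T" "\<Gamma> \<turnstile> f' \<cdot> a' \<Colon> T" "\<Gamma> \<turnstile> f' \<cdot> a' \<doteq> f \<cdot> a \<Colon> T"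
      using c T(1) by (auto simp: correct_def same_def intro: ty_conv eq_conv eq_sym)
    have "\<Gamma> \<turnstile> f' \<cdot> a' \<doteq> s \<Colon> T"
    proof (cases "is_lam f'")
      case True
      then obtain A0 b where f': "f' = Lam A0 b" and e: "e = []" using f(2) by (auto simp: is_lam_iff)
      then have A0: "A0 = A" and b: "A # \<Gamma> \<turnstile> b \<Colon> B" and "\<exists>u. \<Gamma> \<turnstile> Pi A B \<Colon> Univ u"
        using f(1) by (auto simp: correct_def same_def)
      then obtain w where "\<Gamma> \<turnstile> A \<Colon> Univ w" using typed_Pi_inv by blast
      then have "\<Gamma> \<turnstile> f' \<cdot> a' \<doteq> inst b a' \<Colon> inst B a'"
        using eq_beta b a[OF a'] unfolding f' A0 e by (auto simp: correct_def same_def)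
      moreover have "s = inst b a'" "close (a' # e) B = inst B a'"
        using s by (simp_all add: f' e close_def psub_singleton)
      ultimately show ?thesis using T(1) by (auto intro: eq_conv eq_sym)
    next
      case False
      then have "red_iota f' a' = Some s" using s by (cases f') auto
      then have "iota (f' \<cdot> a') s" by (auto simp: red_iota_def split: if_splits intro: iota_redex)
      then show ?thesis using eq_iota cT(2) ct by (auto simp: correct_def same_def)
    qed
    then show ?thesis
      using ct cT(1,3) e' unfolding correct_def same_def by (simp add: is_lam_iff) (blast intro: eq_trans eq_sym)
  qed
qed

lemma infer_app_sound:
  assumes M: "sound M" and wf: "wf_ctx \<Gamma>" and r: "infer_app M m \<Gamma> a (M m \<Gamma> f) = Some (t', T, e')"
  shows "correct \<Gamma> (f \<cdot> a) t' (close e' T) \<and> (is_lam t' \<longrightarrow> e' = [])"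
proof -
  obtain f' F e where f': "M m \<Gamma> f = Some (f', F, e)" using r by (cases "M m \<Gamma> f") auto
  note f = sound_apply[OF M wf f']
  then obtain u where F: "\<Gamma> \<turnstile> close e F \<Colon> Univ u" by (auto simp: correct_def same_def)
  show ?thesis
  proof (cases "\<exists>A B. F = Pi A B")
    case True
    then obtain A B where AB: "F = Pi A B" by blast
    then obtain A' where A': "norm M \<Gamma> (close e A) = Some A'"
      and r': "mk_app M m \<Gamma> f' B e (against M m a \<Gamma> A') = Some (t', T, e')"
      using r f' by (auto elim!: app_dom.elims)
    obtain w where "\<Gamma> \<turnstile> close e A \<Colon> Univ w"
      using F typed_Pi_inv unfolding AB by (fastforce simp: close_eq_sub)
    from norm_typed[OF M this A'] obtain v where
      v: "\<Gamma> \<turnstile> A' \<doteq> close e A \<Colon> Univ v" "\<Gamma> \<turnstile> A' \<Colon> Univ v" "\<Gamma> \<turnstile> close e A \<Colon> Univ v" by blast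
    show ?thesis
    proof (rule mk_app_sound[OF M wf f[unfolded AB] _ r'])
      fix a' assume "against M m a \<Gamma> A' = Some a'"
      from against_sound[OF M v(2) this] have "same \<Gamma> a a' A'" by (simp add: correct_def)
      then show "same \<Gamma> a a' (close e A)" using same_conv v(1,3) by blast
    qed
  next
    case False
    then have "app_nf M m \<Gamma> f' a (norm M \<Gamma> (close e F)) = Some (t', T, e')"
      using r f' by (cases F) auto
    then obtain A B where AB: "norm M \<Gamma> (close e F) = Some (Pi A B)"
      and r': "mk_app M m \<Gamma> f' B [] (against M m a \<Gamma> A) = Some (t', T, e')"
      by (auto elim!: app_nf.elims)
    from norm_typed[OF M F AB] obtain v where
      v: "\<Gamma> \<turnstile> Pi A B \<doteq> close e F \<Colon> Univ v" "\<Gamma> \<turnstile> Pi A B \<Colon> Univ v" by blast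
    \<comment> \<open>The type of an abstraction is a \<open>Pi\<close> by \<open>correct\<close>,
      contrary to the present case; so \<open>correct_conv\<close> may change the type of
      \<open>f'\<close>.\<close>
    have nl: "\<not> is_lam f'"
    proof
      assume "is_lam f'"
      then show False using f False by (auto simp: is_lam_iff correct_def same_def)
    qed
    obtain w where w: "\<Gamma> \<turnstile> A \<Colon> Univ w" using typed_Pi_inv[OF v(2)] by blast
    have "correct \<Gamma> f f' (close [] (Pi A B))"
      using correct_conv[OF f(1) eq_sym[OF v(1)] v(2) nl] by simp
    moreover have "same \<Gamma> a a' (close [] A)" if "against M m a \<Gamma> A = Some a'" for a'
      using against_sound[OF M w that] by (simp add: correct_def)
    ultimately show ?thesis using mk_app_sound[OF M wf _ _ _ r'] by blast
  qed
qed


section \<open>Derivability\<close>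

lemma nth_ctx_typed: "wf_ctx \<Gamma> \<Longrightarrow> i < length \<Gamma> \<Longrightarrow> \<exists>u. \<Gamma> \<turnstile> wk (Suc i) (\<Gamma> ! i) \<Colon> Univ u"
proof (induction \<Gamma> arbitrary: i rule: list.induct)
  case (Cons A \<Gamma>)
  then obtain u where A: "wf_ctx \<Gamma>" "\<Gamma> \<turnstile> A \<Colon> Univ u" by (auto elim: wf_ctx.cases)
  show ?case
  proof (cases i)
    case 0
    then show ?thesis using typed_wk[OF A(2) Cons.prems(1)] by auto
  next
    case (Suc k)
    then obtain v where "\<Gamma> \<turnstile> wk (Suc k) (\<Gamma> ! k) \<Colon> Univ v" using Cons.IH[OF A(1)] Cons.prems by auto
    from typed_wk[OF this Cons.prems(1)] show ?thesis using Suc by (auto simp: wk_wk)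
  qed
qed simp

lemma step_sound:
  assumes M: "sound M" and c: "\<And>c :: nat const. rank c < r \<Longrightarrow> \<exists>u. [] \<turnstile> const_type c \<Colon> Univ u"
    and wf: "wf_ctx \<Gamma>" and r: "step r M m \<Gamma> t = Some (t', T, e)"
  shows "correct \<Gamma> t t' (close e T) \<and> (is_lam t' \<longrightarrow> e = [])"
proof (cases t)
  case (Var i)
  then have i: "i < length \<Gamma>" and t': "t' = Var i" "T = wk (Suc i) (\<Gamma> ! i)" "e = []"
    using r by (auto simp: wk_eq_shift split: if_splits)
  have "\<exists>u. \<Gamma> \<turnstile> wk (Suc i) (\<Gamma> ! i) \<Colon> Univ u" using nth_ctx_typed[OF wf i] .
  then show ?thesis using t' Var ty_var[OF wf i] by (auto simp: correct_def same_def intro: eq_refl)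
next
  case (Univ u)
  then show ?thesis using r ty_univ[OF wf] by (auto simp: correct_def same_def intro: eq_refl)
next
  case (Const k)
  then have k: "rank k < r" and t': "t' = Const k" "T = const_type k" "e = []"
    using r by (auto split: if_splits)
  obtain u where "[] \<turnstile> const_type k \<Colon> Univ u" using c[OF k] by blast
  \<comment> \<open>The identity is a renaming from the empty context, and
    \<open>const_type k\<close> is closed.\<close>
  from typed_ren[OF this, of \<Gamma> "\<lambda>i. i"] have "\<Gamma> \<turnstile> const_type k \<Colon> Univ u" using wf by (simp add: is_ren_def)
  then show ?thesis using t' Const ty_const[OF wf] by (auto simp: correct_def same_def intro: eq_refl)
next
  case (Pi A B)
  then show ?thesis using infer_pi_sound[OF M wf] r by simp
next
  case (Lam A b)
  then show ?thesis using infer_lam_sound[OF M wf] r by simp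
next
  case (App f a)
  then show ?thesis using infer_app_sound[OF M wf] r by simp
qed

lemma infer_sound:
  assumes "\<And>c :: nat const. rank c < r \<Longrightarrow> \<exists>u. [] \<turnstile> const_type c \<Colon> Univ u"
  shows "sound (infer r k)"
proof (induction k)
  case 0
  then show ?case by (simp add: sound_def)
next
  case (Suc k)
  then show ?case using step_sound[OF Suc assms] by (auto simp: sound_def split del: if_split)
qed

text \<open>Well-formed types below rank \<open>r\<close> make \<open>infer r\<close> sound, and its
  answer on \<open>const_type c\<close> can then be trusted.\<close>

lemma const_typed:
  assumes "\<And>c :: nat const. rank c < r \<Longrightarrow> \<exists>u. [] \<turnstile> const_type c \<Colon> Univ u"
    and "univ_val (infer r k False [] (const_type c)) \<noteq> None"
  shows "\<exists>u. [] \<turnstile> const_type c \<Colon> Univ u"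
proof -
  obtain T u e where "infer r k False [] (const_type c) = Some (T, Univ u, e)"
    using assms(2) by (auto simp: univ_val_Some)
  from sound_apply(1)[OF infer_sound[OF assms(1)] ctx_nil this] show ?thesis
    by (auto simp: correct_def same_def)
qed

text \<open>Three rounds, one for each rank: the checker validates the types of one rank using only
  constants of the earlier ranks. \<open>Univalence\<close> has rank 3 and is treated
  separately.\<close>

lemma const_typed_rank:
  fixes c :: "nat const"
  assumes "rank c < 3"
  shows "\<exists>u. [] \<turnstile> const_type c \<Colon> Univ u"
proof -
  have 0: "rank c < 1 \<longrightarrow> univ_val (infer 0 20 False [] (const_type c)) \<noteq> None" for c :: "nat const"
    by (induct c; code_simp)
  have 1: "rank c < 2 \<longrightarrow> univ_val (infer 1 20 False [] (const_type c)) \<noteq> None" for c :: "nat const"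
    by (induct c; code_simp)
  have 2: "rank c < 3 \<longrightarrow> univ_val (infer 2 20 False [] (const_type c)) \<noteq> None" for c :: "nat const"
    by (induct c; code_simp)
  have t0: "\<exists>u. [] \<turnstile> const_type c \<Colon> Univ u" if "rank c < 1" for c :: "nat const"
    by (rule const_typed[of 0]) (use 0 that in auto)
  have t1: "\<exists>u. [] \<turnstile> const_type c \<Colon> Univ u" if "rank c < 2" for c :: "nat const"
    by (rule const_typed[of 1, OF t0]) (use 1 that in auto)
  show ?thesis
    by (rule const_typed[of 2, OF t1]) (use 2 assms in auto)
qed

text \<open>Closedness of \<open>T\<close> lets it survive the substitution of closed terms for the
  variables in \<open>derivable_cut\<close>.\<close>

definition check :: "nat tm list \<Rightarrow> nat tm \<Rightarrow> nat tm \<Rightarrow> bool" where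
  "check \<Gamma> t T = (case force (infer 3 100) \<Gamma> (infer 3 100 False \<Gamma> t) of
     None \<Rightarrow> False
   | Some (_, T') \<Rightarrow> scoped 0 T \<and> norm (infer 3 100) \<Gamma> T = Some T')"

lemma check_sound:
  assumes "wf_ctx \<Gamma>" "check \<Gamma> t T"
  shows "\<Gamma> \<turnstile> t \<Colon> T" "\<exists>u. \<Gamma> \<turnstile> T \<Colon> Univ u" "scoped 0 T"
proof -
  have s: "sound (infer 3 100)" using infer_sound[of 3 100] const_typed_rank by blast
  obtain t' T' where "force (infer 3 100) \<Gamma> (infer 3 100 False \<Gamma> t) = Some (t', T')"
    and T: "scoped 0 T" "norm (infer 3 100) \<Gamma> T = Some T'"
    using assms(2) by (auto simp: check_def split: option.splits)
  then have "\<Gamma> \<turnstile> t \<Colon> T'" "\<exists>u. \<Gamma> \<turnstile> T' \<Colon> Univ u"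
    using force_sound[OF s assms(1) refl] by (auto simp: correct_def same_def)
  then show "\<Gamma> \<turnstile> t \<Colon> T" "\<exists>u. \<Gamma> \<turnstile> T \<Colon> Univ u"
    using norm_sound[OF s assms(1) T(2)] by (blast intro: ty_conv)+
  show "scoped 0 T" by (rule T(1))
qed

definition derivable :: "nat tm \<Rightarrow> bool" where
  "derivable T \<longleftrightarrow> (\<exists>t. [] \<turnstile> t \<Colon> T) \<and> (\<exists>u. [] \<turnstile> T \<Colon> Univ u)"

lemma derivable_scoped: "derivable T \<Longrightarrow> scoped 0 T"
  unfolding derivable_def using typed_scoped by fastforce

lemma derivable_ctx:
  assumes "list_all derivable \<Gamma>"
  shows "wf_ctx \<Gamma>"
  using assms
proof (induction \<Gamma>)
  case (Cons A \<Gamma>)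
  then have wf: "wf_ctx \<Gamma>" and "derivable A" by simp_all
  then obtain u where A: "[] \<turnstile> A \<Colon> Univ u" "scoped 0 A"
    using derivable_scoped by (auto simp: derivable_def)
  then have "\<Gamma> \<turnstile> A \<Colon> Univ u"
    using typed_ren[OF A(1), of \<Gamma> "\<lambda>i. i"] wf by (simp add: is_ren_def ren_closed)
  then show ?case using wf ctx_cons by blast
qed (simp add: ctx_nil)

text \<open>Earlier results enter a proof term as variables of the context and are discharged by
  substituting closed inhabitants. Hence checking a later term never unfolds earlier ones.\<close>

lemma derivable_cut:
  assumes \<Gamma>: "list_all derivable \<Gamma>" and t: "check \<Gamma> t T"
  shows "derivable T"
proof -
  note wf = derivable_ctx[OF \<Gamma>]
  define \<sigma> where "\<sigma> i = (SOME s. [] \<turnstile> s \<Colon> \<Gamma> ! i)" for i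
  have "is_sub [] \<sigma> \<Gamma>"
    unfolding is_sub_def
  proof (intro conjI allI impI)
    fix i assume "i < length \<Gamma>"
    then have i: "derivable (\<Gamma> ! i)" using \<Gamma> by (simp add: list_all_length)
    then have "[] \<turnstile> \<sigma> i \<Colon> \<Gamma> ! i" unfolding \<sigma>_def derivable_def by (metis someI_ex)
    then show "[] \<turnstile> \<sigma> i \<Colon> sub \<sigma> (wk (Suc i) (\<Gamma> ! i))"
      using derivable_scoped[OF i] by (simp add: wk_def ren_closed sub_closed)
  qed (rule ctx_nil)
  moreover obtain u where "\<Gamma> \<turnstile> T \<Colon> Univ u" using check_sound(2)[OF wf t] by blast
  ultimately show ?thesis
    unfolding derivable_def
    using typed_sub check_sound(1,3)[OF wf t] by (metis sub_closed sub.simps(2))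
qed

lemma typed_Eq:
  assumes F: "\<Gamma> \<turnstile> F \<Colon> Univ w"
  shows "\<Gamma> \<turnstile> Const (IdT w) \<cdot> F \<Colon> Pi F (Pi (wk 1 F) (Univ w))"
proof -
  have inst: "inst (Var 0 \<rightarrow>\<^sub>t Var 0 \<rightarrow>\<^sub>t Univ w) F = Pi F (Pi (wk 1 F) (Univ w))"
    by (simp add: inst_def arr_def wk_def)
  have "\<Gamma> \<turnstile> Const (IdT w) \<Colon> Pi (Univ w) (Var 0 \<rightarrow>\<^sub>t Var 0 \<rightarrow>\<^sub>t Univ w)"
    using ty_const[OF typed_wf[OF F], of "IdT w"] by simp
  from ty_app[OF this F] show ?thesis unfolding inst .
qed

text \<open>By \<open>eq_eta\<close> both sides are judgementally equal, so reflexivity at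
  \<open>f\<close> has the desired type after conversion along the congruence of
  \<open>IdT\<close>.\<close>

lemma typed_Eq_eta:
  fixes f :: "'l::universe_level tm"
  assumes F: "\<Gamma> \<turnstile> Pi A B \<Colon> Univ w" and f: "\<Gamma> \<turnstile> f \<Colon> Pi A B"
  shows "\<Gamma> \<turnstile> Refl w (Pi A B) f \<Colon> Eq w (Pi A B) (Lam A (wk 1 f \<cdot> Var 0)) f"
    and "\<Gamma> \<turnstile> Eq w (Pi A B) (Lam A (wk 1 f \<cdot> Var 0)) f \<Colon> Univ w"
proof -
  let ?F = "Pi A B" and ?e = "Lam A (wk 1 f \<cdot> Var 0)"
  have inst: "inst (Pi (wk 1 ?F) (Univ w)) a = Pi ?F (Univ w)" "inst (Univ w) a = Univ w" for a
    using inst_wk[of 0 ?F a] by (simp_all add: inst_def)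
  obtain u v where A: "\<Gamma> \<turnstile> A \<Colon> Univ u" and B: "A # \<Gamma> \<turnstile> B \<Colon> Univ v"
    using typed_Pi_inv[OF F] by blast
  have wf: "wf_ctx (A # \<Gamma>)" using ctx_cons[OF typed_wf[OF A] A] .
  \<comment> \<open>Weakening \<open>B\<close> under its binder and instantiating at the new
    variable gives \<open>B\<close> back.\<close>
  have "(\<lambda>i. case_nat (Var 0) Var (lift_ren Suc i)) = (Var :: nat \<Rightarrow> 'l tm)"
    by (auto simp: fun_eq_iff split: nat.split)
  then have "inst (ren (lift_ren Suc) B) (Var 0) = B"
    by (simp add: inst_def sub_ren)
  then have "A # \<Gamma> \<turnstile> wk 1 f \<cdot> Var 0 \<Colon> B"
    using ty_app[of "A # \<Gamma>" "wk 1 f" "wk 1 A" "ren (lift_ren Suc) B" "Var 0"]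
      typed_wk[OF f wf] ty_var[OF wf, of 0] by (simp add: wk_def)
  from ty_lam[OF A this] have e: "\<Gamma> \<turnstile> ?e \<Colon> ?F" .
  have 1: "\<Gamma> \<turnstile> Const (IdT w) \<cdot> ?F \<cdot> ?e \<Colon> Pi ?F (Univ w)"
    using ty_app[OF typed_Eq[OF F] e] unfolding inst .
  from ty_app[OF this f] show "\<Gamma> \<turnstile> Eq w ?F ?e f \<Colon> Univ w" unfolding inst Eq_def .
  have "\<Gamma> \<turnstile> Const (IdT w) \<cdot> ?F \<cdot> f \<doteq> Const (IdT w) \<cdot> ?F \<cdot> ?e \<Colon> Pi ?F (Univ w)"
    using eq_app[OF eq_refl[OF typed_Eq[OF F]] eq_eta[OF f]] unfolding inst .
  from eq_app[OF this eq_refl[OF f]] have eq: "\<Gamma> \<turnstile> Eq w ?F f f \<doteq> Eq w ?F ?e f \<Colon> Univ w"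
    unfolding inst Eq_def .
  have "inst (Eq w (wk 1 ?F) (Var 0) (Var 0)) f = Eq w (inst (wk 1 ?F) f) f f"
    by (simp only: inst_def Eq_def sub.simps nat.case)
  then have inst': "inst (Eq w (wk 1 ?F) (Var 0) (Var 0)) f = Eq w ?F f f" by simp
  have inst'': "inst (Pi (Var 0) (Eq w (Var 1) (Var 0) (Var 0))) ?F = Pi ?F (Eq w (wk 1 ?F) (Var 0) (Var 0))"
    by (simp add: inst_def Eq_def wk_def)
  have "\<Gamma> \<turnstile> Const (IdRefl w) \<Colon> Pi (Univ w) (Pi (Var 0) (Eq w (Var 1) (Var 0) (Var 0)))"
    using ty_const[OF typed_wf[OF F], of "IdRefl w"] by simp
  from ty_app[OF ty_app[OF this F, unfolded inst''] f] have "\<Gamma> \<turnstile> Refl w ?F f \<Colon> Eq w ?F f f"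
    unfolding inst' Refl_def .
  then show "\<Gamma> \<turnstile> Refl w ?F f \<Colon> Eq w ?F ?e f" using ty_conv eq by blast
qed

section \<open>Change of universe levels\<close>

lemma map_ren: "map_tm \<phi> (ren \<rho> t) = ren \<rho> (map_tm \<phi> t)"
  by (induction t arbitrary: \<rho>) auto

lemma map_wk: "map_tm \<phi> (wk n t) = wk n (map_tm \<phi> t)"
  by (simp add: wk_def map_ren)

lemma map_sub: "map_tm \<phi> (sub \<sigma> t) = sub (\<lambda>i. map_tm \<phi> (\<sigma> i)) (map_tm \<phi> t)"
proof (induction t arbitrary: \<sigma>)
  have *: "(\<lambda>i. map_tm \<phi> (lift_sub \<sigma> i)) = lift_sub (\<lambda>i. map_tm \<phi> (\<sigma> i))" for \<sigma>
    by (auto simp: fun_eq_iff map_wk split: nat.split)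
  {
    case (Pi A B)
    then show ?case using * by simp
  next
    case (Lam A b)
    then show ?case using * by simp
  }
qed auto

lemma map_inst: "map_tm \<phi> (inst B a) = inst (map_tm \<phi> B) (map_tm \<phi> a)"
proof -
  have "(\<lambda>i. map_tm \<phi> (case_nat a Var i)) = case_nat (map_tm \<phi> a) Var"
    by (auto simp: fun_eq_iff split: nat.split)
  then show ?thesis by (simp add: inst_def map_sub)
qed

lemma map_iota: "iota a b \<Longrightarrow> iota (map_tm \<phi> a) (map_tm \<phi> b)"
  by (induction rule: iota.induct) (auto intro: iota.intros)

lemmas tm_defs = arr_def Eq_def Refl_def Sg_def Pr_def Fst_def Prod_def is_prop_def is_equiv_def
  Equiv_def id_equiv_def id_to_equiv_def Let_def

context
  fixes \<phi> :: "'k::universe_level \<Rightarrow> 'l::universe_level"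
  assumes usuc: "\<phi> (usuc u) = usuc (\<phi> u)" and sup: "\<phi> (sup u v) = sup (\<phi> u) (\<phi> v)"
begin

lemma map_const_type: "map_tm \<phi> (const_type c) = const_type (map_const \<phi> c)"
  by (cases c) (simp_all add: tm_defs map_wk usuc sup)

text \<open>The rules combine levels by \<open>usuc\<close> and \<open>sup\<close> alone, and both
  commute with \<open>\<phi>\<close>.\<close>

lemma wf_ctx_map: "wf_ctx \<Gamma> \<Longrightarrow> wf_ctx (map (map_tm \<phi>) \<Gamma>)"
  and typed_map: "\<Gamma> \<turnstile> t \<Colon> T \<Longrightarrow> map (map_tm \<phi>) \<Gamma> \<turnstile> map_tm \<phi> t \<Colon> map_tm \<phi> T"
  and equal_map: "\<Gamma> \<turnstile> t \<doteq> s \<Colon> T \<Longrightarrow> map (map_tm \<phi>) \<Gamma> \<turnstile> map_tm \<phi> t \<doteq> map_tm \<phi> s \<Colon> map_tm \<phi> T"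
proof (induction rule: wf_ctx_typed_equal.inducts)
  case (ty_var \<Gamma> i)
  then show ?case using wf_ctx_typed_equal.ty_var[of "map (map_tm \<phi>) \<Gamma>" i] by (simp add: map_wk)
next
  case (ty_app \<Gamma> f A B a)
  then show ?case by (simp add: map_inst) (blast intro: wf_ctx_typed_equal.ty_app)
next
  case (eq_app \<Gamma> f f' A B a a')
  then show ?case by (simp add: map_inst) (blast intro: wf_ctx_typed_equal.eq_app)
next
  case (eq_beta \<Gamma> A u b B a)
  then show ?case by (simp add: map_inst) (blast intro: wf_ctx_typed_equal.eq_beta)
next
  case (eq_eta \<Gamma> f A B)
  then show ?case using wf_ctx_typed_equal.eq_eta by (fastforce simp: map_wk)
next
  case (eq_iota a b \<Gamma> A)
  then show ?case by (blast intro: wf_ctx_typed_equal.eq_iota map_iota)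
next
  case (ty_conv \<Gamma> a A B u)
  then show ?case by simp (blast intro: wf_ctx_typed_equal.ty_conv)
next
  case (eq_trans \<Gamma> a b A c)
  then show ?case by (blast intro: wf_ctx_typed_equal.eq_trans)
next
  case (eq_conv \<Gamma> a b A B u)
  then show ?case by simp (blast intro: wf_ctx_typed_equal.eq_conv)
qed (auto simp: map_const_type usuc sup intro: wf_ctx_typed_equal.intros)

end

text \<open>The iterates of \<open>usuc\<close> at \<open>u\<close> form a chain by
  \<open>less_usuc\<close>, so a join of two of them is the one with the larger exponent.\<close>

lemma usuc_pow_sup:
  "((usuc :: 'l::universe_level \<Rightarrow> 'l) ^^ sup m n) u = sup ((usuc ^^ m) u) ((usuc ^^ n) u)"
proof -
  have le: "(usuc ^^ k) u \<le> (usuc ^^ l) u" if "k \<le> l" for k l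
    using that
  proof (induction rule: dec_induct)
    case (step n)
    then show ?case using less_usuc[of "(usuc ^^ n) u"] by (simp add: order.trans less_imp_le)
  qed simp
  show ?thesis
  proof (cases "m \<le> n")
    case True
    then show ?thesis using le[OF True] by (simp add: sup_absorb2)
  next
    case False
    then show ?thesis using le[of n m] by (simp add: sup_absorb1)
  qed
qed

lemma derivable_at_level:
  assumes "derivable T"
  shows "\<exists>t. [] \<turnstile> t \<Colon> map_tm (\<lambda>n. (usuc ^^ n) u) T"
proof -
  obtain t where "[] \<turnstile> t \<Colon> T" using assms by (auto simp: derivable_def)
  then have "map (map_tm (\<lambda>n. (usuc ^^ n) u)) [] \<turnstile> map_tm (\<lambda>n. (usuc ^^ n) u) t \<Colon> map_tm (\<lambda>n. (usuc ^^ n) u) T"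
    by (rule typed_map[rotated 2]) (simp_all add: usuc_nat_def usuc_pow_sup)
  then show ?thesis by auto
qed

section \<open>Higher-order abstract syntax\<close>

text \<open>
  An expression is a function of the number of enclosing binders, and \<open>hv m\<close> is the variable bound
  at depth \<open>m\<close>.
\<close>

type_synonym hoas = "nat \<Rightarrow> nat tm"

definition hv :: "nat \<Rightarrow> hoas" where
  "hv m n = Var (n - Suc m)"

definition hlam :: "hoas \<Rightarrow> (hoas \<Rightarrow> hoas) \<Rightarrow> hoas" where
  "hlam A f n = Lam (A n) (f (hv n) (Suc n))"

definition hpi :: "hoas \<Rightarrow> (hoas \<Rightarrow> hoas) \<Rightarrow> hoas" where
  "hpi A f n = Pi (A n) (f (hv n) (Suc n))"

definition hap :: "hoas \<Rightarrow> hoas \<Rightarrow> hoas" (infixl "\<bullet>" 90) where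
  "hap f a n = f n \<cdot> a n"

text \<open>Evaluating \<open>B\<close> one level deeper has the effect of weakening it.\<close>

definition harr :: "hoas \<Rightarrow> hoas \<Rightarrow> hoas" (infixr "\<Rrightarrow>" 80) where
  "harr A B n = Pi (A n) (B (Suc n))"

definition hU :: "nat \<Rightarrow> hoas" where
  "hU u n = Univ u"

definition hc :: "nat const \<Rightarrow> hoas" where
  "hc c n = Const c"

definition hEq :: "nat \<Rightarrow> hoas \<Rightarrow> hoas \<Rightarrow> hoas \<Rightarrow> hoas" where
  "hEq u A a b n = Eq u (A n) (a n) (b n)"

definition hRefl :: "nat \<Rightarrow> hoas \<Rightarrow> hoas \<Rightarrow> hoas" where
  "hRefl u A a n = Refl u (A n) (a n)"

definition hSg :: "nat \<Rightarrow> nat \<Rightarrow> hoas \<Rightarrow> (hoas \<Rightarrow> hoas) \<Rightarrow> hoas" where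
  "hSg u v A B n = Const (SigT u v) \<cdot> A n \<cdot> hlam A B n"

definition hPr :: "nat \<Rightarrow> nat \<Rightarrow> hoas \<Rightarrow> (hoas \<Rightarrow> hoas) \<Rightarrow> hoas \<Rightarrow> hoas \<Rightarrow> hoas" where
  "hPr u v A B a b n = Const (SigPair u v) \<cdot> A n \<cdot> hlam A B n \<cdot> a n \<cdot> b n"

definition hSigInd :: "nat \<Rightarrow> nat \<Rightarrow> nat \<Rightarrow> hoas \<Rightarrow> (hoas \<Rightarrow> hoas) \<Rightarrow> (hoas \<Rightarrow> hoas) \<Rightarrow> (hoas \<Rightarrow> hoas \<Rightarrow> hoas) \<Rightarrow> hoas \<Rightarrow> hoas" where
  "hSigInd u v w A B C f p n = Const (SigInd u v w) \<cdot> A n \<cdot> hlam A B n \<cdot> hlam (hSg u v A B) C n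
     \<cdot> hlam A (\<lambda>x. hlam (B x) (f x)) n \<cdot> p n"

definition hFst :: "nat \<Rightarrow> nat \<Rightarrow> hoas \<Rightarrow> (hoas \<Rightarrow> hoas) \<Rightarrow> hoas \<Rightarrow> hoas" where
  "hFst u v A B p = hSigInd u v u A B (\<lambda>_. A) (\<lambda>x _. x) p"

definition hSnd :: "nat \<Rightarrow> nat \<Rightarrow> hoas \<Rightarrow> (hoas \<Rightarrow> hoas) \<Rightarrow> hoas \<Rightarrow> hoas" where
  "hSnd u v A B p = hSigInd u v v A B (\<lambda>p. B (hFst u v A B p)) (\<lambda>_ y. y) p"

definition hJ :: "nat \<Rightarrow> nat \<Rightarrow> hoas \<Rightarrow> (hoas \<Rightarrow> hoas \<Rightarrow> hoas \<Rightarrow> hoas) \<Rightarrow> (hoas \<Rightarrow> hoas) \<Rightarrow> hoas \<Rightarrow> hoas \<Rightarrow> hoas \<Rightarrow> hoas" where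
  "hJ u w A C d a b p n = Const (IdInd u w) \<cdot> A n
     \<cdot> hlam A (\<lambda>x. hlam A (\<lambda>y. hlam (hEq u A x y) (C x y))) n \<cdot> hlam A d n \<cdot> a n \<cdot> b n \<cdot> p n"

syntax "_hpi" :: "pttrn \<Rightarrow> hoas \<Rightarrow> hoas \<Rightarrow> hoas" ("(3\<^bold>\<forall>_:_./ _)" [0,0,10] 10)
syntax "_hlam" :: "pttrn \<Rightarrow> hoas \<Rightarrow> hoas \<Rightarrow> hoas" ("(3\<^bold>\<lambda>_:_./ _)" [0,0,10] 10)
translations "_hpi x A B" == "CONST hpi A (\<lambda>x. B)"
translations "_hlam x A B" == "CONST hlam A (\<lambda>x. B)"

definition "hIsProp u A = hpi A (\<lambda>x. hpi A (\<lambda>y. hEq u A x y))"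

definition "hIsSet u A = hpi A (\<lambda>x. hpi A (\<lambda>y. hIsProp u (hEq u A x y)))"

definition holds :: "hoas \<Rightarrow> bool" where
  "holds T \<longleftrightarrow> derivable (T 0)"

text \<open>The term is read at depth \<open>length Ss\<close>, so \<open>hv i\<close> denotes the
  \<open>i\<close>-th lemma of \<open>Ss\<close>; the context is reversed because its head is
  variable 0.\<close>

lemma holdsI:
  assumes "list_all holds Ss" "check (map (\<lambda>S. S 0) (rev Ss)) (t (length Ss)) (T 0)"
  shows "holds T"
proof -
  have "list_all derivable (map (\<lambda>S. S 0) (rev Ss))"
    using assms(1) by (simp add: list_all_iff holds_def)
  then show ?thesis using derivable_cut assms(2) unfolding holds_def by blast
qed

text \<open>The checker does not decide \<open>\<eta>\<close>, so it is made available as an inhabited identity type.\<close>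

definition "eta_ty u v = (\<^bold>\<forall>A:hU u. \<^bold>\<forall>B:hU v. \<^bold>\<forall>f:A \<Rrightarrow> B. hEq (max u v) (A \<Rrightarrow> B) (\<^bold>\<lambda>x:A. f\<bullet>x) f)"

lemma eta: "holds (eta_ty u v)"
proof -
  let ?F = "\<lambda>i. Pi (Var i) (Var i)"
  let ?G1 = "[Univ u]" and ?G2 = "[Univ v, Univ u]" and ?G3 = "[?F 1, Univ v, Univ u]"
  have wf1: "wf_ctx ?G1" using ctx_cons[OF ctx_nil ty_univ[OF ctx_nil]] .
  have wf2: "wf_ctx ?G2" using ctx_cons[OF wf1 ty_univ[OF wf1]] .
  have A2: "?G2 \<turnstile> Var 1 \<Colon> Univ u" using ty_var[OF wf2, of 1] by simp
  have "wf_ctx (Var 1 # ?G2)" using ctx_cons[OF wf2 A2] .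
  from ty_var[OF this, of 1] have B2: "Var 1 # ?G2 \<turnstile> Var 1 \<Colon> Univ v" by simp
  have F2: "?G2 \<turnstile> ?F 1 \<Colon> Univ (sup u v)" using ty_pi[OF A2 B2] .
  have wf3: "wf_ctx ?G3" using ctx_cons[OF wf2 F2] .
  have A3: "?G3 \<turnstile> Var 2 \<Colon> Univ u" using ty_var[OF wf3, of 2] by simp
  have "wf_ctx (Var 2 # ?G3)" using ctx_cons[OF wf3 A3] .
  from ty_var[OF this, of 2] have B3: "Var 2 # ?G3 \<turnstile> Var 2 \<Colon> Univ v" by simp
  have F3: "?G3 \<turnstile> ?F 2 \<Colon> Univ (sup u v)" using ty_pi[OF A3 B3] .
  have f: "?G3 \<turnstile> Var 0 \<Colon> ?F 2" using ty_var[OF wf3, of 0] by (simp add: wk_def numeral_2_eq_2)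
  note e = typed_Eq_eta[OF F3 f]
  let ?T = "Pi (Univ u) (Pi (Univ v) (Pi (?F 1)
    (Eq (sup u v) (?F 2) (Lam (Var 2) (wk 1 (Var 0) \<cdot> Var 0)) (Var 0))))"
  have "eta_ty u v 0 = ?T"
    by (simp add: eta_ty_def hpi_def harr_def hU_def hEq_def hlam_def hap_def hv_def sup_nat_def
        eval_nat_numeral)
  moreover have "[] \<turnstile> Lam (Univ u) (Lam (Univ v) (Lam (?F 1) (Refl (sup u v) (?F 2) (Var 0)))) \<Colon> ?T"
    using ty_lam[OF ty_univ[OF ctx_nil] ty_lam[OF ty_univ[OF wf1] ty_lam[OF F2 e(1)]]] .
  moreover have "\<exists>w. [] \<turnstile> ?T \<Colon> Univ w"
    using ty_pi[OF ty_univ[OF ctx_nil] ty_pi[OF ty_univ[OF wf1] ty_pi[OF F2 e(2)]]] by blast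
  ultimately show ?thesis unfolding holds_def derivable_def by auto
qed

definition "hProd u v A B = hSg u v A (\<lambda>_. B)"

definition "sec_fam u v A B f s = (\<^bold>\<forall>b:B. hEq v B (f\<bullet>(s\<bullet>b)) b)"

definition "ret_fam u v A B f r = (\<^bold>\<forall>a:A. hEq u A (r\<bullet>(f\<bullet>a)) a)"

definition "hIsEquiv u v A B f = hProd (max u v) (max u v) (hSg (max u v) v (B \<Rrightarrow> A)
    (sec_fam u v A B f)) (hSg (max u v) u (B \<Rrightarrow> A) (ret_fam u v A B f))"

definition "hEquiv u v A B = hSg (max u v) (max u v) (A \<Rrightarrow> B) (hIsEquiv u v A B)"

text \<open>This is \<open>id_to_equiv\<close> in normal form. For the identity map the families of
  sections and of retractions both reduce to \<open>S\<close>.\<close>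

definition "hI2E u = hc (IdInd (Suc u) u)\<bullet>hU u\<bullet>(\<^bold>\<lambda>X:hU u. \<^bold>\<lambda>Y:hU u. \<^bold>\<lambda>_:hEq (Suc u) (hU u) X Y.
    hEquiv u u X Y)
   \<bullet>(\<^bold>\<lambda>A:hU u. (\<lambda>S. hPr u u (A \<Rrightarrow> A) (hIsEquiv u u A A) (\<^bold>\<lambda>x:A. x)
     (hPr u u (hSg u u (A \<Rrightarrow> A) S) (\<lambda>_. hSg u u (A \<Rrightarrow> A) S)
       (hPr u u (A \<Rrightarrow> A) S (\<^bold>\<lambda>x:A. x) (\<^bold>\<lambda>x:A. hRefl u A x)) (hPr u u (A \<Rrightarrow> A) S (\<^bold>\<lambda>x:A. x) (\<^bold>\<lambda>x:A.
           hRefl u A x)))) (\<lambda>s. \<^bold>\<forall>a:A. hEq u A (s\<bullet>a) a))"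

definition "ua_ty u = (\<^bold>\<forall>X:hU u. \<^bold>\<forall>Y:hU u. hIsEquiv (Suc u) u (hEq (Suc u) (hU u) X Y)
    (hEquiv u u X Y) (hI2E u\<bullet>X\<bullet>Y))"

text \<open>The rank bound 3 excludes the constant \<open>Univalence\<close> from checked terms. Its
  type is normalised instead, and \<open>ty_conv\<close> gives the constant that normal form as its
  type.\<close>

lemma univalence:
  assumes "univ_val (infer 3 100 True [] (const_type (Univalence u))) = Some (ua_ty u 0)"
  shows "holds (ua_ty u)"
proof -
  have s: "sound (infer 3 100)" using infer_sound[of 3 100] const_typed_rank by blast
  obtain w e where "infer 3 100 True [] (const_type (Univalence u)) = Some (ua_ty u 0, Univ w, e)"
    using assms by (auto simp: univ_val_Some)
  from sound_apply(1)[OF s ctx_nil this]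
  have "[] \<turnstile> ua_ty u 0 \<Colon> Univ w" "[] \<turnstile> const_type (Univalence u) \<doteq> ua_ty u 0 \<Colon> Univ w"
    by (auto simp: correct_def same_def intro: eq_sym)
  then show ?thesis
    unfolding holds_def derivable_def using ty_conv[OF ty_const[OF ctx_nil]] by blast
qed

lemma univalence_0: "holds (ua_ty 0)"
  by (rule univalence, code_simp)

lemma univalence_1: "holds (ua_ty 1)"
  by (rule univalence, code_simp)

section \<open>Identity types and propositions\<close>

definition "sym_ty u = (\<^bold>\<forall>A:hU u. \<^bold>\<forall>x:A. \<^bold>\<forall>y:A. hEq u A x y \<Rrightarrow> hEq u A y x)"

definition "sym_tm u = (\<^bold>\<lambda>A:hU u. \<^bold>\<lambda>x:A. \<^bold>\<lambda>y:A. \<^bold>\<lambda>p:hEq u A x y. hJ u u A (\<lambda>x y p. hEq u A y x)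
    (hRefl u A) x y p)"

lemma sym_0: "holds (sym_ty 0)"
  by (rule holdsI[where Ss = "[]" and t = "sym_tm 0"],
      simp only: list.pred_inject simp_thms, code_simp)

definition "trans_ty u = (\<^bold>\<forall>A:hU u. \<^bold>\<forall>x:A. \<^bold>\<forall>y:A. \<^bold>\<forall>z:A. hEq u A x y \<Rrightarrow> hEq u A y z \<Rrightarrow> hEq u A x z)"

definition "trans_tm u = (\<^bold>\<lambda>A:hU u. \<^bold>\<lambda>x:A. \<^bold>\<lambda>y:A. \<^bold>\<lambda>z:A. \<^bold>\<lambda>p:hEq u A x y.
   hJ u u A (\<lambda>x y p. hEq u A y z \<Rrightarrow> hEq u A x z) (\<lambda>x. \<^bold>\<lambda>q:hEq u A x z. q) x y p)"

lemma trans_0: "holds (trans_ty 0)"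
  by (rule holdsI[where Ss = "[]" and t = "trans_tm 0"],
      simp only: list.pred_inject simp_thms, code_simp)

lemma sym_1: "holds (sym_ty 1)"
  by (rule holdsI[where Ss = "[]" and t = "sym_tm 1"],
      simp only: list.pred_inject simp_thms, code_simp)

lemma trans_1: "holds (trans_ty 1)"
  by (rule holdsI[where Ss = "[]" and t = "trans_tm 1"],
      simp only: list.pred_inject simp_thms, code_simp)

definition "tr_ty u w = (\<^bold>\<forall>A:hU u. \<^bold>\<forall>P:A \<Rrightarrow> hU w. \<^bold>\<forall>x:A. \<^bold>\<forall>y:A. hEq u A x y \<Rrightarrow> P\<bullet>x \<Rrightarrow> P\<bullet>y)"

definition "tr_tm u w = (\<^bold>\<lambda>A:hU u. \<^bold>\<lambda>P:A \<Rrightarrow> hU w. \<^bold>\<lambda>x:A. \<^bold>\<lambda>y:A. \<^bold>\<lambda>p:hEq u A x y.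
   hJ u w A (\<lambda>x y p. P\<bullet>x \<Rrightarrow> P\<bullet>y) (\<lambda>x. \<^bold>\<lambda>q:P\<bullet>x. q) x y p)"

lemma tr_00: "holds (tr_ty 0 0)"
  by (rule holdsI[where Ss = "[]" and t = "tr_tm 0 0"],
      simp only: list.pred_inject simp_thms, code_simp)

lemma tr_10: "holds (tr_ty 1 0)"
  by (rule holdsI[where Ss = "[]" and t = "tr_tm 1 0"],
      simp only: list.pred_inject simp_thms, code_simp)

lemma tr_11: "holds (tr_ty 1 1)"
  by (rule holdsI[where Ss = "[]" and t = "tr_tm 1 1"],
      simp only: list.pred_inject simp_thms, code_simp)

definition "ap_ty u v = (\<^bold>\<forall>A:hU u. \<^bold>\<forall>B:hU v. \<^bold>\<forall>f:A \<Rrightarrow> B. \<^bold>\<forall>x:A. \<^bold>\<forall>y:A. hEq u A x y \<Rrightarrow> hEq v B (f\<bullet>x) (f\<bullet>y))"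

definition "ap_tm u v = (\<^bold>\<lambda>A:hU u. \<^bold>\<lambda>B:hU v. \<^bold>\<lambda>f:A \<Rrightarrow> B. \<^bold>\<lambda>x:A. \<^bold>\<lambda>y:A. \<^bold>\<lambda>p:hEq u A x y.
   hJ u v A (\<lambda>x y p. hEq v B (f\<bullet>x) (f\<bullet>y)) (\<lambda>x. hRefl v B (f\<bullet>x)) x y p)"

lemma ap_00: "holds (ap_ty 0 0)"
  by (rule holdsI[where Ss = "[]" and t = "ap_tm 0 0"],
      simp only: list.pred_inject simp_thms, code_simp)

lemma ap_01: "holds (ap_ty 0 1)"
  by (rule holdsI[where Ss = "[]" and t = "ap_tm 0 1"],
      simp only: list.pred_inject simp_thms, code_simp)

lemma ap_10: "holds (ap_ty 1 0)"
  by (rule holdsI[where Ss = "[]" and t = "ap_tm 1 0"],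
      simp only: list.pred_inject simp_thms, code_simp)

lemma ap_11: "holds (ap_ty 1 1)"
  by (rule holdsI[where Ss = "[]" and t = "ap_tm 1 1"],
      simp only: list.pred_inject simp_thms, code_simp)

text \<open>The inverse of \<open>p\<close> followed by \<open>q\<close>, by a single path
  induction.\<close>

definition "hcancel u A x x' y p q = hJ u u A (\<lambda>x x' p. hEq u A x y \<Rrightarrow> hEq u A x' y) (\<lambda>x.
    \<^bold>\<lambda>q:hEq u A x y. q) x x' p \<bullet> q"

definition "cancel_ty u = (\<^bold>\<forall>A:hU u. \<^bold>\<forall>x:A. \<^bold>\<forall>y:A. \<^bold>\<forall>p:hEq u A x y. hEq u (hEq u A y y)
    (hcancel u A x y y p p) (hRefl u A y))"

definition "cancel_tm u = (\<^bold>\<lambda>A:hU u. \<^bold>\<lambda>x:A. \<^bold>\<lambda>y:A. \<^bold>\<lambda>p:hEq u A x y.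
   hJ u u A (\<lambda>x y p. hEq u (hEq u A y y) (hcancel u A x y y p p) (hRefl u A y)) (\<lambda>x. hRefl u
       (hEq u A x x) (hRefl u A x)) x y p)"

lemma cancel_refl: "holds (cancel_ty 0)"
  by (rule holdsI[where Ss = "[]" and t = "cancel_tm 0"],
      simp only: list.pred_inject simp_thms, code_simp)

definition "hedberg_ty = (\<^bold>\<forall>D:hU 0. \<^bold>\<forall>R:D \<Rrightarrow> D \<Rrightarrow> hU 0. (\<^bold>\<forall>x:D. \<^bold>\<forall>y:D. hIsProp 0 (R\<bullet>x\<bullet>y))
  \<Rrightarrow> (\<^bold>\<forall>x:D. R\<bullet>x\<bullet>x) \<Rrightarrow> (\<^bold>\<forall>x:D. \<^bold>\<forall>y:D. R\<bullet>x\<bullet>y \<Rrightarrow> hEq 0 D x y) \<Rrightarrow> hIsSet 0 D)"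

definition "hedberg_tm sy tn tr cqlaw = (\<^bold>\<lambda>D:hU 0. \<^bold>\<lambda>R:D \<Rrightarrow> D \<Rrightarrow> hU 0. \<^bold>\<lambda>hR:\<^bold>\<forall>x:D. \<^bold>\<forall>y:D. hIsProp 0
    (R\<bullet>x\<bullet>y).
  \<^bold>\<lambda>i:\<^bold>\<forall>x:D. R\<bullet>x\<bullet>x. \<^bold>\<lambda>e:\<^bold>\<forall>x:D. \<^bold>\<forall>y:D. R\<bullet>x\<bullet>y \<Rrightarrow> hEq 0 D x y.
  (\<^bold>\<lambda>K:\<^bold>\<forall>x:D. \<^bold>\<forall>y:D. \<^bold>\<forall>p:hEq 0 D x y. \<^bold>\<forall>r:R\<bullet>x\<bullet>y. hEq 0 (hEq 0 D x y) (hcancel 0 D x x y (e\<bullet>x\<bullet>x\<bullet>(i\<bullet>x))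
      (e\<bullet>x\<bullet>y\<bullet>r)) p.
    (\<^bold>\<lambda>x:D. \<^bold>\<lambda>y:D. \<^bold>\<lambda>p:hEq 0 D x y. \<^bold>\<lambda>q:hEq 0 D x y.
      (\<^bold>\<lambda>r:R\<bullet>x\<bullet>y. tn\<bullet>hEq 0 D x y\<bullet>p\<bullet>hcancel 0 D x x y (e\<bullet>x\<bullet>x\<bullet>(i\<bullet>x))
          (e\<bullet>x\<bullet>y\<bullet>r)\<bullet>q\<bullet>(sy\<bullet>hEq 0 D x y\<bullet>hcancel 0 D x x y (e\<bullet>x\<bullet>x\<bullet>(i\<bullet>x))
          (e\<bullet>x\<bullet>y\<bullet>r)\<bullet>p\<bullet>(K\<bullet>x\<bullet>y\<bullet>p\<bullet>r))\<bullet>(K\<bullet>x\<bullet>y\<bullet>q\<bullet>r))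
       \<bullet> (tr\<bullet>D\<bullet>(R\<bullet>x)\<bullet>x\<bullet>y\<bullet>p\<bullet>(i\<bullet>x))))
  \<bullet> (\<^bold>\<lambda>x:D. \<^bold>\<lambda>y:D. \<^bold>\<lambda>p:hEq 0 D x y. hJ 0 0 D
       (\<lambda>x y p. \<^bold>\<forall>r:R\<bullet>x\<bullet>y. hEq 0 (hEq 0 D x y) (hcancel 0 D x x y (e\<bullet>x\<bullet>x\<bullet>(i\<bullet>x)) (e\<bullet>x\<bullet>y\<bullet>r)) p)
       (\<lambda>x. \<^bold>\<lambda>r:R\<bullet>x\<bullet>x. tr\<bullet>(R\<bullet>x\<bullet>x)\<bullet>(\<^bold>\<lambda>r:R\<bullet>x\<bullet>x. hEq 0 (hEq 0 D x x) (hcancel 0 D x x x (e\<bullet>x\<bullet>x\<bullet>(i\<bullet>x))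
           (e\<bullet>x\<bullet>x\<bullet>r)) (hRefl 0 D x))
         \<bullet>(i\<bullet>x)\<bullet>r\<bullet>(hR\<bullet>x\<bullet>x\<bullet>(i\<bullet>x)\<bullet>r)\<bullet>(cqlaw\<bullet>D\<bullet>x\<bullet>x\<bullet>(e\<bullet>x\<bullet>x\<bullet>(i\<bullet>x)))) x y p))"

text \<open>For every \<open>r\<close> in \<open>R x y\<close>, each path \<open>p\<close> from
  \<open>x\<close> to \<open>y\<close> equals the inverse of \<open>e x x (i x)\<close> followed by
  \<open>e x y r\<close>. Path induction reduces this to reflexivity, where \<open>r\<close> may be
  replaced by \<open>i x\<close> and the composite cancels. The formula does not mention
  \<open>p\<close>, so any two paths agree; a suitable \<open>r\<close> is obtained by transporting
  \<open>i x\<close>.\<close>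

lemma hedberg: "holds hedberg_ty"
  by (rule holdsI[where Ss = "[sym_ty 0, trans_ty 0, tr_ty 0 0, cancel_ty 0]"
      and t = "hedberg_tm (hv 0) (hv 1) (hv 2) (hv 3)"],
      simp only: list.pred_inject simp_thms sym_0 trans_0 tr_00 cancel_refl, code_simp)

section \<open>The unit type, and propositions among pairs\<close>

definition "hUnit = hc (UnitT 0)"

definition "hstar = hc (UnitPt 0)"

definition hUnitInd :: "nat \<Rightarrow> (hoas \<Rightarrow> hoas) \<Rightarrow> hoas \<Rightarrow> hoas \<Rightarrow> hoas" where
  "hUnitInd w C c x = hc (UnitInd 0 w)\<bullet>hlam hUnit C\<bullet>c\<bullet>x"

definition "unit_prop_ty = hIsProp 0 hUnit"

definition "unit_prop_tm = (\<^bold>\<lambda>x:hUnit. \<^bold>\<lambda>y:hUnit. hUnitInd 0 (\<lambda>x. hEq 0 hUnit x y) (hUnitInd 0 (\<lambda>y.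
    hEq 0 hUnit hstar y) (hRefl 0 hUnit hstar) y) x)"

lemma unit_prop: "holds unit_prop_ty"
  by (rule holdsI[where Ss = "[]" and t = "unit_prop_tm"],
      simp only: list.pred_inject simp_thms, code_simp)

definition "prop_set_ty = (\<^bold>\<forall>A:hU 0. hIsProp 0 A \<Rrightarrow> hIsSet 0 A)"

definition "prop_set_tm hedb up = (\<^bold>\<lambda>A:hU 0. \<^bold>\<lambda>f:hIsProp 0 A. hedb\<bullet>A\<bullet>(\<^bold>\<lambda>x:A. \<^bold>\<lambda>y:A. hUnit)\<bullet>(\<^bold>\<lambda>x:A.
    \<^bold>\<lambda>y:A. up)
   \<bullet>(\<^bold>\<lambda>x:A. hstar)\<bullet>(\<^bold>\<lambda>x:A. \<^bold>\<lambda>y:A. \<^bold>\<lambda>_:hUnit. f\<bullet>x\<bullet>y))"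

text \<open>Hedberg's argument for the constant relation \<open>hUnit\<close>.\<close>

lemma prop_set: "holds prop_set_ty"
  by (rule holdsI[where Ss = "[hedberg_ty, unit_prop_ty]" and t = "prop_set_tm (hv 0) (hv 1)"],
      simp only: list.pred_inject simp_thms hedberg unit_prop, code_simp)

definition "pair_path_ty u v = (\<^bold>\<forall>A:hU u. \<^bold>\<forall>B:A \<Rrightarrow> hU v. (\<^bold>\<forall>x:A. hIsProp v (B\<bullet>x)) \<Rrightarrow> (\<^bold>\<forall>x:A. \<^bold>\<forall>x':A.
    hEq u A x x' \<Rrightarrow>
   (\<^bold>\<forall>y:B\<bullet>x. \<^bold>\<forall>y':B\<bullet>x'. hEq (max u v) (hSg u v A (\<lambda>x. B\<bullet>x)) (hPr u v A (\<lambda>x. B\<bullet>x) x y) (hPr u v A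
       (\<lambda>x. B\<bullet>x) x' y'))))"

definition "pair_path_tm u v ap = (\<^bold>\<lambda>A:hU u. \<^bold>\<lambda>B:A \<Rrightarrow> hU v. \<^bold>\<lambda>hB:\<^bold>\<forall>x:A. hIsProp v (B\<bullet>x). \<^bold>\<lambda>x:A. \<^bold>\<lambda>x':A.
    \<^bold>\<lambda>p:hEq u A x x'.
   hJ u (max u v) A (\<lambda>x x' p. \<^bold>\<forall>y:B\<bullet>x. \<^bold>\<forall>y':B\<bullet>x'. hEq (max u v) (hSg u v A (\<lambda>x. B\<bullet>x)) (hPr u v A
       (\<lambda>x. B\<bullet>x) x y) (hPr u v A (\<lambda>x. B\<bullet>x) x' y'))
    (\<lambda>x. \<^bold>\<lambda>y:B\<bullet>x. \<^bold>\<lambda>y':B\<bullet>x. ap\<bullet>(B\<bullet>x)\<bullet>hSg u v A (\<lambda>x. B\<bullet>x)\<bullet>(\<^bold>\<lambda>y:B\<bullet>x. hPr u v A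
        (\<lambda>x. B\<bullet>x) x y)\<bullet>y\<bullet>y'\<bullet>(hB\<bullet>x\<bullet>y\<bullet>y')) x x' p)"

text \<open>After path induction on the first components, the second components lie in one
  proposition-valued fibre.\<close>

lemma pair_path_10: "holds (pair_path_ty 1 0)"
  by (rule holdsI[where Ss = "[ap_ty 0 1]" and t = "pair_path_tm 1 0 (hv 0)"],
      simp only: list.pred_inject simp_thms ap_01, code_simp)

lemma pair_path_00: "holds (pair_path_ty 0 0)"
  by (rule holdsI[where Ss = "[ap_ty 0 0]" and t = "pair_path_tm 0 0 (hv 0)"],
      simp only: list.pred_inject simp_thms ap_00, code_simp)

definition "sig_prop_ty u v = (\<^bold>\<forall>A:hU u. \<^bold>\<forall>B:A \<Rrightarrow> hU v. hIsProp u A \<Rrightarrow> (\<^bold>\<forall>x:A. hIsProp v (B\<bullet>x)) \<Rrightarrow> hIsProp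
    (max u v) (hSg u v A (\<lambda>x. B\<bullet>x)))"

definition "sig_prop_tm u v pp = (\<^bold>\<lambda>A:hU u. \<^bold>\<lambda>B:A \<Rrightarrow> hU v. \<^bold>\<lambda>hA:hIsProp u A. \<^bold>\<lambda>hB:\<^bold>\<forall>x:A. hIsProp v (B\<bullet>x).
   \<^bold>\<lambda>p:hSg u v A (\<lambda>x. B\<bullet>x). \<^bold>\<lambda>q:hSg u v A (\<lambda>x. B\<bullet>x).
     hSigInd u v (max u v) A (\<lambda>x. B\<bullet>x) (\<lambda>p. hEq (max u v) (hSg u v A (\<lambda>x. B\<bullet>x)) p q) (\<lambda>x y.
       hSigInd u v (max u v) A (\<lambda>x. B\<bullet>x) (\<lambda>q. hEq (max u v) (hSg u v A (\<lambda>x. B\<bullet>x)) (hPr u v A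
           (\<lambda>x. B\<bullet>x) x y) q) (\<lambda>x' y'.
          pp\<bullet>A\<bullet>B\<bullet>hB\<bullet>x\<bullet>x'\<bullet>(hA\<bullet>x\<bullet>x')\<bullet>y\<bullet>y') q) p)"

lemma sig_prop: "holds (sig_prop_ty 0 0)"
  by (rule holdsI[where Ss = "[pair_path_ty 0 0]" and t = "sig_prop_tm 0 0 (hv 0)"],
      simp only: list.pred_inject simp_thms pair_path_00, code_simp)

section \<open>Injective sets are retracts of powersets\<close>

text \<open>The truncation makes the uniqueness clause a proposition outright, before function
  extensionality is available.\<close>

definition "hSingle_fam D E x = hProd 0 0 (hc (Trunc 0) \<bullet> (\<^bold>\<forall>y:D. E\<bullet>y \<Rrightarrow> hEq 0 D x y)) (E\<bullet>x)"

definition "hSingle D E = hSg 0 0 D (hSingle_fam D E)"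

definition "single_prop_ty = (\<^bold>\<forall>D:hU 0. hIsSet 0 D \<Rrightarrow> (\<^bold>\<forall>E:D \<Rrightarrow> hU 0. (\<^bold>\<forall>x:D. hIsProp 0 (E\<bullet>x)) \<Rrightarrow>
    hIsProp 0 (hSingle D E)))"

definition "single_prop_tm pp sp = (\<^bold>\<lambda>D:hU 0. \<^bold>\<lambda>hD:hIsSet 0 D. \<^bold>\<lambda>E:D \<Rrightarrow> hU 0. \<^bold>\<lambda>pE:\<^bold>\<forall>x:D. hIsProp 0 (E\<bullet>x).
    \<^bold>\<lambda>p:hSingle D E. \<^bold>\<lambda>q:hSingle D E.
    hSigInd 0 0 0 D (hSingle_fam D E) (\<lambda>p. hEq 0 (hSingle D E) p q) (\<lambda>x w.
      hSigInd 0 0 0 D (hSingle_fam D E) (\<lambda>q. hEq 0 (hSingle D E) (hPr 0 0 D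
          (hSingle_fam D E) x w) q) (\<lambda>x' w'.
        pp\<bullet>D\<bullet>hlam D (hSingle_fam D E)\<bullet>(\<^bold>\<lambda>x:D. (\<lambda>T. sp\<bullet>T\<bullet>(\<^bold>\<lambda>_:T. E\<bullet>x)\<bullet>(hc (TruncProp 0)\<bullet>(\<^bold>\<forall>y:D. E\<bullet>y \<Rrightarrow>
            hEq 0 D x y))\<bullet>(\<^bold>\<lambda>_:T. pE\<bullet>x))
               (hc (Trunc 0) \<bullet> (\<^bold>\<forall>y:D. E\<bullet>y \<Rrightarrow> hEq 0 D x y)))
         \<bullet>x\<bullet>x'\<bullet>
         (\<lambda>T. hc (TruncRec 0 0)\<bullet>T\<bullet>hEq 0 D x x'\<bullet>(hD\<bullet>x\<bullet>x')\<bullet>(\<^bold>\<lambda>c:T. c\<bullet>x'\<bullet>hSnd 0 0 (hc (Trunc 0) \<bullet>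
             (\<^bold>\<forall>y:D. E\<bullet>y \<Rrightarrow> hEq 0 D x' y)) (\<lambda>_. E\<bullet>x') w')
               \<bullet>hFst 0 0 (hc (Trunc 0) \<bullet> T) (\<lambda>_. E\<bullet>x) w)
          (\<^bold>\<forall>y:D. E\<bullet>y \<Rrightarrow> hEq 0 D x y)
         \<bullet>w\<bullet>w') q) p)"

text \<open>Equality of the first components is a proposition because \<open>D\<close> is a set, so
  the truncated uniqueness clause of one may be applied to the other. The remaining components are
  propositions.\<close>

lemma single_prop: "holds single_prop_ty"
  by (rule holdsI[where Ss = "[pair_path_ty 0 0, sig_prop_ty 0 0]"
      and t = "single_prop_tm (hv 0) (hv 1)"],
      simp only: list.pred_inject simp_thms pair_path_00 sig_prop, code_simp)

definition "const_emb_ty = (\<^bold>\<forall>P:hU 0. hIsProp 0 P \<Rrightarrow> (\<^bold>\<forall>y:hUnit. hIsProp 0 (hSg 0 0 P (\<lambda>_. hEq 0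
    hUnit hstar y))))"

definition "const_emb_tm sp ps up = (\<^bold>\<lambda>P:hU 0. \<^bold>\<lambda>hP:hIsProp 0 P. \<^bold>\<lambda>y:hUnit. sp\<bullet>P\<bullet>(\<^bold>\<lambda>_:P. hEq 0
    hUnit hstar y)\<bullet>hP\<bullet>(\<^bold>\<lambda>_:P. ps\<bullet>hUnit\<bullet>up\<bullet>hstar\<bullet>y))"

text \<open>A fibre of the map from \<open>P\<close> to \<open>hUnit\<close> is a product of
  \<open>P\<close> with an identity type of a set.\<close>

lemma const_emb: "holds const_emb_ty"
  by (rule holdsI[where Ss = "[sig_prop_ty 0 0, prop_set_ty, unit_prop_ty]"
      and t = "const_emb_tm (hv 0) (hv 1) (hv 2)"],
      simp only: list.pred_inject simp_thms sig_prop prop_set unit_prop, code_simp)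

definition "hIsEmb X Y j = (\<^bold>\<forall>y:Y. hIsProp 0 (hSg 0 0 X (\<lambda>x. hEq 0 Y (j\<bullet>x) y)))"

definition "hEmb X Y = hSg 0 0 (X \<Rrightarrow> Y) (hIsEmb X Y)"

definition "hEmbMap X Y j = hFst 0 0 (X \<Rrightarrow> Y) (hIsEmb X Y) j"

definition "hAlgInj D = (\<^bold>\<forall>X:hU 0. \<^bold>\<forall>Y:hU 0. \<^bold>\<forall>j:hEmb X Y. \<^bold>\<forall>f:X \<Rrightarrow> D. hSg 0 0 (Y \<Rrightarrow> D) (\<lambda>g. \<^bold>\<forall>x:X. hEq 0 D
    (g\<bullet>(hEmbMap X Y j\<bullet>x)) (f\<bullet>x)))"

definition "flabby_ty = (\<^bold>\<forall>D:hU 0. hAlgInj D \<Rrightarrow> (\<^bold>\<forall>P:hU 0. hIsProp 0 P \<Rrightarrow> (\<^bold>\<forall>f:P \<Rrightarrow> D. hSg 0 0 D (\<lambda>d.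
    \<^bold>\<forall>z:P. hEq 0 D d (f\<bullet>z)))))"

definition "flabby_tm ce = (\<^bold>\<lambda>D:hU 0. \<^bold>\<lambda>i:hAlgInj D. \<^bold>\<lambda>P:hU 0. \<^bold>\<lambda>hP:hIsProp 0 P. \<^bold>\<lambda>f:P \<Rrightarrow> D.
   hSigInd 0 0 0 (hUnit \<Rrightarrow> D) (\<lambda>g. \<^bold>\<forall>x:P. hEq 0 D (g\<bullet>hstar) (f\<bullet>x)) (\<lambda>_. hSg 0 0 D (\<lambda>d. \<^bold>\<forall>z:P. hEq 0 D d
       (f\<bullet>z)))
     (\<lambda>g k. hPr 0 0 D (\<lambda>d. \<^bold>\<forall>z:P. hEq 0 D d (f\<bullet>z)) (g\<bullet>hstar) k)
     (i\<bullet>P\<bullet>hUnit\<bullet>hPr 0 0 (P \<Rrightarrow> hUnit) (hIsEmb P hUnit) (\<^bold>\<lambda>_:P. hstar) (ce\<bullet>P\<bullet>hP)\<bullet>f))"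

text \<open>The given map is extended along the embedding of \<open>P\<close> into
  \<open>hUnit\<close> and evaluated at \<open>hstar\<close>. This property is known as
  flabbiness.\<close>

lemma flabby: "holds flabby_ty"
  by (rule holdsI[where Ss = "[const_emb_ty]" and t = "flabby_tm (hv 0)"],
      simp only: list.pred_inject simp_thms const_emb, code_simp)

definition "desc_fam D E x = (\<^bold>\<forall>d:D. E\<bullet>d \<Rrightarrow> (\<^bold>\<forall>y:D. E\<bullet>y \<Rrightarrow> hEq 0 D d y) \<Rrightarrow> hEq 0 D x d)"

definition "description_ty = (\<^bold>\<forall>D:hU 0. hIsSet 0 D \<Rrightarrow> hAlgInj D \<Rrightarrow> (\<^bold>\<forall>E:D \<Rrightarrow> hU 0. (\<^bold>\<forall>x:D. hIsProp 0
    (E\<bullet>x)) \<Rrightarrow> hSg 0 0 D (desc_fam D E)))"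

definition "description_tm fl sg = (\<^bold>\<lambda>D:hU 0. \<^bold>\<lambda>hD:hIsSet 0 D. \<^bold>\<lambda>i:hAlgInj D. \<^bold>\<lambda>E:D \<Rrightarrow> hU 0. \<^bold>\<lambda>pE:\<^bold>\<forall>x:D.
    hIsProp 0 (E\<bullet>x).
   hSigInd 0 0 0 D (\<lambda>x. \<^bold>\<forall>z:hSingle D E. hEq 0 D x (hFst 0 0 D (hSingle_fam D E) z)) (\<lambda>_. hSg 0 0 D
       (desc_fam D E))
     (\<lambda>x k. hPr 0 0 D (desc_fam D E) x (\<^bold>\<lambda>d:D. \<^bold>\<lambda>e:E\<bullet>d. \<^bold>\<lambda>c:\<^bold>\<forall>y:D. E\<bullet>y \<Rrightarrow> hEq 0 D d y.
        k\<bullet>hPr 0 0 D (hSingle_fam D E) d (hPr 0 0 (hc (Trunc 0) \<bullet> (\<^bold>\<forall>y:D. E\<bullet>y \<Rrightarrow> hEq 0 D d y))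
            (\<lambda>_. E\<bullet>d) (hc (TruncIn 0)\<bullet>(\<^bold>\<forall>y:D. E\<bullet>y \<Rrightarrow> hEq 0 D d y)\<bullet>c) e)))
   (fl\<bullet>D\<bullet>i\<bullet>hSingle D E\<bullet>(sg\<bullet>D\<bullet>hD\<bullet>E\<bullet>pE)\<bullet>(\<^bold>\<lambda>z:hSingle D E. hFst 0 0 D (hSingle_fam D E) z)))"

text \<open>Flabbiness is applied to the first projection of \<open>hSingle D E\<close>. An element
  \<open>d\<close> of \<open>E\<close> to which all others are equal yields a point of
  \<open>hSingle D E\<close>, so the extension takes the value \<open>d\<close>.\<close>

lemma description: "holds description_ty"
  by (rule holdsI[where Ss = "[flabby_ty, single_prop_ty]"
      and t = "description_tm (hv 0) (hv 1)"],
      simp only: list.pred_inject simp_thms flabby single_prop, code_simp)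

definition "choice_fam A R f = (\<^bold>\<forall>a:A. R\<bullet>a\<bullet>(f\<bullet>a))"

definition "choice_ty = (\<^bold>\<forall>A:hU 1. \<^bold>\<forall>B:hU 0. \<^bold>\<forall>R:A \<Rrightarrow> B \<Rrightarrow> hU 0. (\<^bold>\<forall>a:A. hSg 0 0 B (\<lambda>b. R\<bullet>a\<bullet>b)) \<Rrightarrow> hSg 1 1
    (A \<Rrightarrow> B) (choice_fam A R))"

definition "choice_tm = (\<^bold>\<lambda>A:hU 1. \<^bold>\<lambda>B:hU 0. \<^bold>\<lambda>R:A \<Rrightarrow> B \<Rrightarrow> hU 0. \<^bold>\<lambda>h:\<^bold>\<forall>a:A. hSg 0 0 B (\<lambda>b. R\<bullet>a\<bullet>b). hPr 1 1
    (A \<Rrightarrow> B) (choice_fam A R)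
   (\<^bold>\<lambda>a:A. hFst 0 0 B (\<lambda>b. R\<bullet>a\<bullet>b) (h\<bullet>a)) (\<^bold>\<lambda>a:A. hSnd 0 0 B (\<lambda>b. R\<bullet>a\<bullet>b) (h\<bullet>a)))"

text \<open>Type-theoretic choice by the two projections. It collects the descriptions for all
  subsets into one map together with its law.\<close>

lemma sigma_choice: "holds choice_ty"
  by (rule holdsI[where Ss = "[]" and t = "choice_tm"],
      simp only: list.pred_inject simp_thms, code_simp)

definition "hRetract D W = hSg 1 1 (D \<Rrightarrow> W) (\<lambda>s. hSg 1 0 (W \<Rrightarrow> D) (\<lambda>r. \<^bold>\<forall>d:D. hEq 0 D (r\<bullet>(s\<bullet>d)) d))"

text \<open>
  From here on \<open>\<Omega>\<close> is a variable, used only through the following operations: this keeps the terms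
  to be checked small.
\<close>

definition "elp_of \<Omega> El = (\<^bold>\<forall>A:\<Omega>. hIsProp 0 (El\<bullet>A))"

definition "mk_of \<Omega> = (\<^bold>\<forall>P:hU 0. hIsProp 0 P \<Rrightarrow> \<Omega>)"

definition "in_of El mk = (\<^bold>\<forall>P:hU 0. \<^bold>\<forall>i:hIsProp 0 P. P \<Rrightarrow> El\<bullet>(mk\<bullet>P\<bullet>i))"

definition "out_of El mk = (\<^bold>\<forall>P:hU 0. \<^bold>\<forall>i:hIsProp 0 P. El\<bullet>(mk\<bullet>P\<bullet>i) \<Rrightarrow> P)"

definition "to_retract_ty = (\<^bold>\<forall>\<Omega>:hU 1. \<^bold>\<forall>El:\<Omega> \<Rrightarrow> hU 0. elp_of \<Omega> El \<Rrightarrow>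
    (\<^bold>\<forall>mk:mk_of \<Omega>. in_of El mk \<Rrightarrow> out_of El mk \<Rrightarrow>
   (\<^bold>\<forall>D:hU 0. hIsSet 0 D \<Rrightarrow> hAlgInj D \<Rrightarrow> hRetract D (D \<Rrightarrow> \<Omega>))))"

definition "to_retract_tm de ac = (\<^bold>\<lambda>\<Omega>:hU 1. \<^bold>\<lambda>El:\<Omega> \<Rrightarrow> hU 0. \<^bold>\<lambda>elp:elp_of \<Omega> El. \<^bold>\<lambda>mk:mk_of \<Omega>.
    \<^bold>\<lambda>inn:in_of El mk. \<^bold>\<lambda>out:out_of El mk.
   \<^bold>\<lambda>D:hU 0. \<^bold>\<lambda>hD:hIsSet 0 D. \<^bold>\<lambda>i:hAlgInj D.
   (\<lambda>s R. hSigInd 1 1 1 ((D \<Rrightarrow> \<Omega>) \<Rrightarrow> D) (\<lambda>f. \<^bold>\<forall>A:D \<Rrightarrow> \<Omega>. R A (f\<bullet>A)) (\<lambda>_. hRetract D (D \<Rrightarrow> \<Omega>))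
      (\<lambda>r h. hPr 1 1 (D \<Rrightarrow> D \<Rrightarrow> \<Omega>) (\<lambda>s. hSg 1 0 ((D \<Rrightarrow> \<Omega>) \<Rrightarrow> D) (\<lambda>r. \<^bold>\<forall>d:D. hEq 0 D (r\<bullet>(s\<bullet>d)) d)) s
         (hPr 1 0 ((D \<Rrightarrow> \<Omega>) \<Rrightarrow> D) (\<lambda>r. \<^bold>\<forall>d:D. hEq 0 D (r\<bullet>(s\<bullet>d)) d) r
           (\<^bold>\<lambda>d:D. h\<bullet>(\<^bold>\<lambda>x:D. mk\<bullet>hEq 0 D d x\<bullet>(hD\<bullet>d\<bullet>x))\<bullet>d\<bullet>(inn\<bullet>hEq 0 D d d\<bullet>(hD\<bullet>d\<bullet>d)\<bullet>hRefl 0 D d)\<bullet>(\<^bold>\<lambda>y:D.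
               out\<bullet>hEq 0 D d y\<bullet>(hD\<bullet>d\<bullet>y)))))
      (ac\<bullet>(D \<Rrightarrow> \<Omega>)\<bullet>D\<bullet>(\<^bold>\<lambda>A:D \<Rrightarrow> \<Omega>. \<^bold>\<lambda>x:D. R A x)\<bullet>(\<^bold>\<lambda>A:D \<Rrightarrow> \<Omega>. de\<bullet>D\<bullet>hD\<bullet>i\<bullet>(\<^bold>\<lambda>x:D. El\<bullet>(A\<bullet>x))\<bullet>(\<^bold>\<lambda>x:D.
          elp\<bullet>(A\<bullet>x)))))
    (\<^bold>\<lambda>d:D. \<^bold>\<lambda>y:D. mk\<bullet>hEq 0 D d y\<bullet>(hD\<bullet>d\<bullet>y))
    (\<lambda>A. desc_fam D (\<^bold>\<lambda>x:D. El\<bullet>(A\<bullet>x))))"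

text \<open>The subset \<open>s d\<close> contains \<open>d\<close> by reflexivity, and each of its
  members equals \<open>d\<close> by definition; so its description is \<open>d\<close>.\<close>

lemma to_retract: "holds to_retract_ty"
  by (rule holdsI[where Ss = "[description_ty, choice_ty]"
      and t = "to_retract_tm (hv 0) (hv 1)"],
      simp only: list.pred_inject simp_thms description sigma_choice, code_simp)

section \<open>Extensionality from univalence\<close>

definition "equiv_sec_ty u v = (\<^bold>\<forall>A:hU u. \<^bold>\<forall>B:hU v. \<^bold>\<forall>f:A \<Rrightarrow> B. hIsEquiv u v A B f \<Rrightarrow> hSg (max u v) v
    (B \<Rrightarrow> A) (sec_fam u v A B f))"

definition "equiv_sec_tm u v = (\<^bold>\<lambda>A:hU u. \<^bold>\<lambda>B:hU v. \<^bold>\<lambda>f:A \<Rrightarrow> B. \<^bold>\<lambda>e:hIsEquiv u v A B f. hFst (max u v)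
    (max u v) (hSg (max u v) v (B \<Rrightarrow> A) (sec_fam u v A B f)) (\<lambda>_. hSg (max u v) u (B \<Rrightarrow> A)
    (ret_fam u v A B f)) e)"

lemma equiv_sec_0: "holds (equiv_sec_ty 1 0)"
  by (rule holdsI[where Ss = "[]" and t = "equiv_sec_tm 1 0"],
      simp only: list.pred_inject simp_thms, code_simp)

definition "hEquivMap u X Y p = hFst u u (X \<Rrightarrow> Y) (hIsEquiv u u X Y) p"

definition "hcoe u X Y p = hJ (Suc u) u (hU u) (\<lambda>X Y p. X \<Rrightarrow> Y) (\<lambda>X. \<^bold>\<lambda>x:X. x) X Y p"

definition "coe_equiv_ty u = (\<^bold>\<forall>X:hU u. \<^bold>\<forall>Y:hU u. \<^bold>\<forall>p:hEq (Suc u) (hU u) X Y. hEq u (X \<Rrightarrow> Y)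
    (hcoe u X Y p) (hEquivMap u X Y (hI2E u\<bullet>X\<bullet>Y\<bullet>p)))"

definition "coe_equiv_tm u = (\<^bold>\<lambda>X:hU u. \<^bold>\<lambda>Y:hU u. \<^bold>\<lambda>p:hEq (Suc u) (hU u) X Y. hJ (Suc u) u (hU u)
    (\<lambda>X Y p. hEq u (X \<Rrightarrow> Y) (hcoe u X Y p) (hEquivMap u X Y (hI2E u\<bullet>X\<bullet>Y\<bullet>p)))
    (\<lambda>X. hRefl u (X \<Rrightarrow> X) (\<^bold>\<lambda>x:X. x)) X Y p)"

text \<open>On reflexivity both maps compute to the identity.\<close>

lemma coe_equiv_0: "holds (coe_equiv_ty 0)"
  by (rule holdsI[where Ss = "[]" and t = "coe_equiv_tm 0"],
      simp only: list.pred_inject simp_thms, code_simp)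

definition "coe_fam u X Y f p = hEq u (X \<Rrightarrow> Y) (hcoe u X Y p) f"

text \<open>
  Here \<open>E X Y\<close> stands for the type of equivalences, whose definition would make the terms to be
  checked large.
\<close>

definition "hev_ty u E = (\<^bold>\<forall>X:hU u. \<^bold>\<forall>Y:hU u. E\<bullet>X\<bullet>Y \<Rrightarrow> X \<Rrightarrow> Y)"

definition "hi2e_ty u E = (\<^bold>\<forall>X:hU u. \<^bold>\<forall>Y:hU u. hEq (Suc u) (hU u) X Y \<Rrightarrow> E\<bullet>X\<bullet>Y)"

definition "hcoee_ty u ev ie = (\<^bold>\<forall>X:hU u. \<^bold>\<forall>Y:hU u. \<^bold>\<forall>p:hEq (Suc u) (hU u) X Y. hEq u (X \<Rrightarrow> Y)
    (hcoe u X Y p) (ev\<bullet>X\<bullet>Y\<bullet>(ie\<bullet>X\<bullet>Y\<bullet>p)))"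

definition "hsec_ty u E ie = (\<^bold>\<forall>X:hU u. \<^bold>\<forall>Y:hU u. hSg (Suc u) u (E\<bullet>X\<bullet>Y \<Rrightarrow> hEq (Suc u) (hU u) X Y)
    (sec_fam (Suc u) u (hEq (Suc u) (hU u) X Y) (E\<bullet>X\<bullet>Y) (ie\<bullet>X\<bullet>Y)))"

definition "coe_lift_ty u = (\<^bold>\<forall>E:hU u \<Rrightarrow> hU u \<Rrightarrow> hU u. \<^bold>\<forall>ev:hev_ty u E.
    \<^bold>\<forall>ie:hi2e_ty u E. hcoee_ty u ev ie \<Rrightarrow> hsec_ty u E ie \<Rrightarrow>
   (\<^bold>\<forall>X:hU u. \<^bold>\<forall>Y:hU u. \<^bold>\<forall>e:E\<bullet>X\<bullet>Y. hSg (Suc u) u (hEq (Suc u) (hU u) X Y) (coe_fam u X Y (ev\<bullet>X\<bullet>Y\<bullet>e))))"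

definition "coe_lift_tm u tn ap = (\<^bold>\<lambda>E:hU u \<Rrightarrow> hU u \<Rrightarrow> hU u. \<^bold>\<lambda>ev:hev_ty u E. \<^bold>\<lambda>ie:hi2e_ty u E.
    \<^bold>\<lambda>ce:hcoee_ty u ev ie. \<^bold>\<lambda>sc:hsec_ty u E ie. \<^bold>\<lambda>X:hU u. \<^bold>\<lambda>Y:hU u. \<^bold>\<lambda>e:E\<bullet>X\<bullet>Y.
   hSigInd (Suc u) u (Suc u) (E\<bullet>X\<bullet>Y \<Rrightarrow> hEq (Suc u) (hU u) X Y) (sec_fam (Suc u) u (hEq (Suc u)
       (hU u) X Y) (E\<bullet>X\<bullet>Y) (ie\<bullet>X\<bullet>Y))
     (\<lambda>_. hSg (Suc u) u (hEq (Suc u) (hU u) X Y) (coe_fam u X Y (ev\<bullet>X\<bullet>Y\<bullet>e)))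
     (\<lambda>s h. hPr (Suc u) u (hEq (Suc u) (hU u) X Y) (coe_fam u X Y (ev\<bullet>X\<bullet>Y\<bullet>e)) (s\<bullet>e)
        (tn\<bullet>(X \<Rrightarrow> Y)\<bullet>hcoe u X Y (s\<bullet>e)\<bullet>(ev\<bullet>X\<bullet>Y\<bullet>(ie\<bullet>X\<bullet>Y\<bullet>(s\<bullet>e)))\<bullet>(ev\<bullet>X\<bullet>Y\<bullet>e)\<bullet>(ce\<bullet>X\<bullet>Y\<bullet>(s\<bullet>e))
          \<bullet>(ap\<bullet>(E\<bullet>X\<bullet>Y)\<bullet>(X \<Rrightarrow> Y)\<bullet>(ev\<bullet>X\<bullet>Y)\<bullet>(ie\<bullet>X\<bullet>Y\<bullet>(s\<bullet>e))\<bullet>e\<bullet>(h\<bullet>e))))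
   (sc\<bullet>X\<bullet>Y))"

text \<open>The path is \<open>s e\<close> for a section \<open>s\<close> of \<open>ie\<close>.
  Coercion along it is the map underlying \<open>ie (s e)\<close>, and that equivalence equals
  \<open>e\<close>.\<close>

lemma coe_lift_0: "holds (coe_lift_ty 0)"
  by (rule holdsI[where Ss = "[trans_ty 0, ap_ty 0 0]" and t = "coe_lift_tm 0 (hv 0) (hv 1)"],
      simp only: list.pred_inject simp_thms trans_0 ap_00, code_simp)

definition "univalence_sec_ty u = (\<^bold>\<forall>X:hU u. \<^bold>\<forall>Y:hU u. hSg (Suc u) u (hEquiv u u X Y \<Rrightarrow> hEq (Suc u)
    (hU u) X Y) (sec_fam (Suc u) u (hEq (Suc u) (hU u) X Y) (hEquiv u u X Y) (hI2E u\<bullet>X\<bullet>Y)))"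

definition "univalence_sec_tm u ua es = (\<^bold>\<lambda>X:hU u. \<^bold>\<lambda>Y:hU u. es\<bullet>hEq (Suc u)
    (hU u) X Y\<bullet>hEquiv u u X Y\<bullet>(hI2E u\<bullet>X\<bullet>Y)\<bullet>(ua\<bullet>X\<bullet>Y))"

lemma univalence_sec_0: "holds (univalence_sec_ty 0)"
  by (rule holdsI[where Ss = "[ua_ty 0, equiv_sec_ty 1 0]"
      and t = "univalence_sec_tm 0 (hv 0) (hv 1)"],
      simp only: list.pred_inject simp_thms univalence_0 equiv_sec_0, code_simp)

definition "coe_path_ty u = (\<^bold>\<forall>X:hU u. \<^bold>\<forall>Y:hU u. \<^bold>\<forall>e:hEquiv u u X Y. hSg (Suc u) u (hEq (Suc u)
    (hU u) X Y) (coe_fam u X Y (hEquivMap u X Y e)))"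

definition "coe_path_tm u g ce sc = (g\<bullet>(\<^bold>\<lambda>X:hU u. \<^bold>\<lambda>Y:hU u. hEquiv u u X Y)\<bullet>(\<^bold>\<lambda>X:hU u. \<^bold>\<lambda>Y:hU u.
    \<^bold>\<lambda>e:hEquiv u u X Y. hEquivMap u X Y e)\<bullet>hI2E u\<bullet>ce\<bullet>sc)"

lemma coe_path_0: "holds (coe_path_ty 0)"
  by (rule holdsI[where Ss = "[coe_lift_ty 0, coe_equiv_ty 0, univalence_sec_ty 0]"
      and t = "coe_path_tm 0 (hv 0) (hv 1) (hv 2)"],
      simp only: list.pred_inject simp_thms coe_lift_0 coe_equiv_0 univalence_sec_0, code_simp)

definition "hMkEquiv u v A B f s hs r hr = hPr (max u v) (max u v) (A \<Rrightarrow> B) (hIsEquiv u v A B) f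
   (hPr (max u v) (max u v) (hSg (max u v) v (B \<Rrightarrow> A) (sec_fam u v A B f)) (\<lambda>_. hSg (max u v) u
       (B \<Rrightarrow> A) (ret_fam u v A B f))
      (hPr (max u v) v (B \<Rrightarrow> A) (sec_fam u v A B f) s hs) (hPr (max u v) u (B \<Rrightarrow> A)
          (ret_fam u v A B f) r hr))"

definition "coe_qinv_ty u = (\<^bold>\<forall>X:hU u. \<^bold>\<forall>Y:hU u. \<^bold>\<forall>f:X \<Rrightarrow> Y. \<^bold>\<forall>g:Y \<Rrightarrow> X. (\<^bold>\<forall>y:Y. hEq u Y (f\<bullet>(g\<bullet>y)) y) \<Rrightarrow>
    (\<^bold>\<forall>x:X. hEq u X (g\<bullet>(f\<bullet>x)) x) \<Rrightarrow> hSg (Suc u) u (hEq (Suc u) (hU u) X Y) (coe_fam u X Y f))"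

definition "coe_qinv_tm u uac = (\<^bold>\<lambda>X:hU u. \<^bold>\<lambda>Y:hU u. \<^bold>\<lambda>f:X \<Rrightarrow> Y. \<^bold>\<lambda>g:Y \<Rrightarrow> X. \<^bold>\<lambda>hs:\<^bold>\<forall>y:Y. hEq u Y
    (f\<bullet>(g\<bullet>y)) y. \<^bold>\<lambda>hr:\<^bold>\<forall>x:X. hEq u X (g\<bullet>(f\<bullet>x)) x.
   uac\<bullet>X\<bullet>Y\<bullet>hMkEquiv u u X Y f g hs g hr)"

text \<open>A quasi-inverse serves as section and as retraction, so no coherence between the two
  homotopies has to be supplied.\<close>

lemma coe_qinv_0: "holds (coe_qinv_ty 0)"
  by (rule holdsI[where Ss = "[coe_path_ty 0]" and t = "coe_qinv_tm 0 (hv 0)"],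
      simp only: list.pred_inject simp_thms coe_path_0, code_simp)

section \<open>Precomposition with an equivalence\<close>

definition "hpre u X Y f B k l = (hEq u (X \<Rrightarrow> B) (\<^bold>\<lambda>x:X. k\<bullet>(f\<bullet>x)) (\<^bold>\<lambda>x:X. l\<bullet>(f\<bullet>x)) \<Rrightarrow> hEq u
    (Y \<Rrightarrow> B) k l)"

definition "precomp_path_ty u = (\<^bold>\<forall>B:hU u. \<^bold>\<forall>X:hU u. \<^bold>\<forall>Y:hU u. \<^bold>\<forall>p:hEq (Suc u) (hU u) X Y. \<^bold>\<forall>k:Y \<Rrightarrow> B.
    \<^bold>\<forall>l:Y \<Rrightarrow> B. hpre u X Y (hcoe u X Y p) B k l)"

definition "precomp_path_tm u sy tn eta = (\<^bold>\<lambda>B:hU u. \<^bold>\<lambda>X:hU u. \<^bold>\<lambda>Y:hU u. \<^bold>\<lambda>p:hEq (Suc u) (hU u) X Y.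
   hJ (Suc u) u (hU u) (\<lambda>X Y p. \<^bold>\<forall>k:Y \<Rrightarrow> B. \<^bold>\<forall>l:Y \<Rrightarrow> B. hpre u X Y (hcoe u X Y p) B k l)
     (\<lambda>X. \<^bold>\<lambda>k:X \<Rrightarrow> B. \<^bold>\<lambda>l:X \<Rrightarrow> B. \<^bold>\<lambda>q:hEq u (X \<Rrightarrow> B) (\<^bold>\<lambda>x:X. k\<bullet>x) (\<^bold>\<lambda>x:X. l\<bullet>x).
       tn\<bullet>(X \<Rrightarrow> B)\<bullet>k\<bullet>(\<^bold>\<lambda>x:X. k\<bullet>x)\<bullet>l\<bullet>(sy\<bullet>(X \<Rrightarrow> B)\<bullet>(\<^bold>\<lambda>x:X. k\<bullet>x)\<bullet>k\<bullet>(eta\<bullet>X\<bullet>B\<bullet>k))\<bullet>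
        (tn\<bullet>(X \<Rrightarrow> B)\<bullet>(\<^bold>\<lambda>x:X. k\<bullet>x)\<bullet>(\<^bold>\<lambda>x:X. l\<bullet>x)\<bullet>l\<bullet>q\<bullet>(eta\<bullet>X\<bullet>B\<bullet>l))) X Y p)"

text \<open>Path induction turns the coercion into the identity. What is left relates
  \<open>k\<close> and \<open>l\<close> to their expansions, which is where \<open>eta\<close>
  enters.\<close>

lemma precomp_path_0: "holds (precomp_path_ty 0)"
  by (rule holdsI[where Ss = "[sym_ty 0, trans_ty 0, eta_ty 0 0]"
      and t = "precomp_path_tm 0 (hv 0) (hv 1) (hv 2)"],
      simp only: list.pred_inject simp_thms sym_0 trans_0 eta[of 0 0], code_simp)

definition "precomp_ty u = (\<^bold>\<forall>B:hU u. \<^bold>\<forall>X:hU u. \<^bold>\<forall>Y:hU u. \<^bold>\<forall>f:X \<Rrightarrow> Y. hSg (Suc u) u (hEq (Suc u)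
    (hU u) X Y) (coe_fam u X Y f) \<Rrightarrow> (\<^bold>\<forall>k:Y \<Rrightarrow> B. \<^bold>\<forall>l:Y \<Rrightarrow> B. hpre u X Y f B k l))"

definition "precomp_tm u tr p1 = (\<^bold>\<lambda>B:hU u. \<^bold>\<lambda>X:hU u. \<^bold>\<lambda>Y:hU u. \<^bold>\<lambda>f:X \<Rrightarrow> Y. \<^bold>\<lambda>w:hSg (Suc u) u (hEq (Suc u)
    (hU u) X Y) (coe_fam u X Y f). \<^bold>\<lambda>k:Y \<Rrightarrow> B. \<^bold>\<lambda>l:Y \<Rrightarrow> B.
   hSigInd (Suc u) u u (hEq (Suc u) (hU u) X Y) (coe_fam u X Y f) (\<lambda>_. hpre u X Y f B k l)
     (\<lambda>p q. tr\<bullet>(X \<Rrightarrow> Y)\<bullet>(\<^bold>\<lambda>f:X \<Rrightarrow> Y. hpre u X Y f B k l)\<bullet>hcoe u X Y p\<bullet>f\<bullet>q\<bullet>(p1\<bullet>B\<bullet>X\<bullet>Y\<bullet>p\<bullet>k\<bullet>l)) w)"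

lemma precomp_0: "holds (precomp_ty 0)"
  by (rule holdsI[where Ss = "[tr_ty 0 0, precomp_path_ty 0]"
      and t = "precomp_tm 0 (hv 0) (hv 1)"],
      simp only: list.pred_inject simp_thms tr_00 precomp_path_0, code_simp)

section \<open>The diagonal of a type and its two projections\<close>

definition "diag_fam u B x = hSg u u B (\<lambda>y. hEq u B x y)"

definition "hDiag u B = hSg u u B (diag_fam u B)"

definition "hDiagPair u B x y p = hPr u u B (diag_fam u B) x (hPr u u B (\<lambda>y. hEq u B x y) y p)"

definition "hDiagFst u B = (\<^bold>\<lambda>d:hDiag u B. hFst u u B (diag_fam u B) d)"

definition "hDiagMap u B = (\<^bold>\<lambda>b:B. hDiagPair u B b b (hRefl u B b))"

definition "diag_sec_ty u = (\<^bold>\<forall>B:hU u. \<^bold>\<forall>d:hDiag u B. hEq u (hDiag u B)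
    (hDiagMap u B\<bullet>(hDiagFst u B\<bullet>d)) d)"

definition "diag_sec_tm u = (\<^bold>\<lambda>B:hU u. \<^bold>\<lambda>d:hDiag u B. hSigInd u u u B (diag_fam u B) (\<lambda>d. hEq u
    (hDiag u B) (hDiagMap u B\<bullet>hFst u u B (diag_fam u B) d) d)
        (\<lambda>x w. hSigInd u u u B (\<lambda>y. hEq u B x y) (\<lambda>w. hEq u (hDiag u B) (hDiagPair u B x x
            (hRefl u B x)) (hPr u u B (diag_fam u B) x w))
            (\<lambda>y p. hJ u u B (\<lambda>x y p. hEq u (hDiag u B) (hDiagPair u B x x (hRefl u B x))
                (hDiagPair u B x y p)) (\<lambda>x. hRefl u (hDiag u B) (hDiagPair u B x x
                (hRefl u B x))) x y p) w) d)"

text \<open>Contractibility of singletons: path induction contracts the second point and its path to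
  the first point and reflexivity.\<close>

lemma diag_sec_0: "holds (diag_sec_ty 0)"
  by (rule holdsI[where Ss = "[]" and t = "diag_sec_tm 0"],
      simp only: list.pred_inject simp_thms, code_simp)

definition "hDiagSnd u B = (\<^bold>\<lambda>d:hDiag u B. hFst u u B (\<lambda>y. hEq u B (hFst u u B (diag_fam u B) d) y)
    (hSnd u u B (diag_fam u B) d))"

definition "diag_proj_ty u = (\<^bold>\<forall>B:hU u. hEq u (hDiag u B \<Rrightarrow> B) (hDiagFst u B) (hDiagSnd u B))"

definition "diag_proj_tm u p2 mke dgs = (\<^bold>\<lambda>B:hU u. p2\<bullet>B\<bullet>B\<bullet>hDiag u B\<bullet>hDiagMap u B\<bullet>(mke\<bullet>B\<bullet>hDiag u
    B\<bullet>hDiagMap u B\<bullet>hDiagFst u B\<bullet>(dgs\<bullet>B)\<bullet>(\<^bold>\<lambda>b:B. hRefl u B b))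
    \<bullet>hDiagFst u B\<bullet>hDiagSnd u B\<bullet>hRefl u (B \<Rrightarrow> B) (\<^bold>\<lambda>b:B. b))"

text \<open>Both projections become the identity of \<open>B\<close> after precomposition with the
  diagonal map. That map has a quasi-inverse, so precomposition with it is injective.\<close>

lemma diag_proj_0: "holds (diag_proj_ty 0)"
  by (rule holdsI[where Ss = "[precomp_ty 0, coe_qinv_ty 0, diag_sec_ty 0]"
      and t = "diag_proj_tm 0 (hv 0) (hv 1) (hv 2)"],
      simp only: list.pred_inject simp_thms precomp_0 coe_qinv_0 diag_sec_0, code_simp)

section \<open>The same one universe higher, for functions into \<open>hU 0\<close> and into the
  type of propositions\<close>

lemma equiv_sec_1: "holds (equiv_sec_ty 2 1)"
  by (rule holdsI[where Ss = "[]" and t = "equiv_sec_tm 2 1"],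
      simp only: list.pred_inject simp_thms, code_simp)

lemma coe_equiv_1: "holds (coe_equiv_ty 1)"
  by (rule holdsI[where Ss = "[]" and t = "coe_equiv_tm 1"],
      simp only: list.pred_inject simp_thms, code_simp)

lemma coe_lift_1: "holds (coe_lift_ty 1)"
  by (rule holdsI[where Ss = "[trans_ty 1, ap_ty 1 1]" and t = "coe_lift_tm 1 (hv 0) (hv 1)"],
      simp only: list.pred_inject simp_thms trans_1 ap_11, code_simp)

lemma univalence_sec_1: "holds (univalence_sec_ty 1)"
  by (rule holdsI[where Ss = "[ua_ty 1, equiv_sec_ty 2 1]"
      and t = "univalence_sec_tm 1 (hv 0) (hv 1)"],
      simp only: list.pred_inject simp_thms univalence_1 equiv_sec_1, code_simp)

lemma coe_path_1: "holds (coe_path_ty 1)"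
  by (rule holdsI[where Ss = "[coe_lift_ty 1, coe_equiv_ty 1, univalence_sec_ty 1]"
      and t = "coe_path_tm 1 (hv 0) (hv 1) (hv 2)"],
      simp only: list.pred_inject simp_thms coe_lift_1 coe_equiv_1 univalence_sec_1, code_simp)

lemma coe_qinv_1: "holds (coe_qinv_ty 1)"
  by (rule holdsI[where Ss = "[coe_path_ty 1]" and t = "coe_qinv_tm 1 (hv 0)"],
      simp only: list.pred_inject simp_thms coe_path_1, code_simp)

lemma precomp_path_1: "holds (precomp_path_ty 1)"
  by (rule holdsI[where Ss = "[sym_ty 1, trans_ty 1, eta_ty 1 1]"
      and t = "precomp_path_tm 1 (hv 0) (hv 1) (hv 2)"],
      simp only: list.pred_inject simp_thms sym_1 trans_1 eta[of 1 1], code_simp)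

lemma precomp_1: "holds (precomp_ty 1)"
  by (rule holdsI[where Ss = "[tr_ty 1 1, precomp_path_ty 1]"
      and t = "precomp_tm 1 (hv 0) (hv 1)"],
      simp only: list.pred_inject simp_thms tr_11 precomp_path_1, code_simp)

lemma diag_sec_1: "holds (diag_sec_ty 1)"
  by (rule holdsI[where Ss = "[]" and t = "diag_sec_tm 1"],
      simp only: list.pred_inject simp_thms, code_simp)

lemma diag_proj_1: "holds (diag_proj_ty 1)"
  by (rule holdsI[where Ss = "[precomp_ty 1, coe_qinv_ty 1, diag_sec_ty 1]"
      and t = "diag_proj_tm 1 (hv 0) (hv 1) (hv 2)"],
      simp only: list.pred_inject simp_thms precomp_1 coe_qinv_1 diag_sec_1, code_simp)

section \<open>Function and propositional extensionality\<close>

definition "funext_ty w v = (\<^bold>\<forall>Z:hU w. \<^bold>\<forall>B:hU v. \<^bold>\<forall>f:Z \<Rrightarrow> B. \<^bold>\<forall>g:Z \<Rrightarrow> B. (\<^bold>\<forall>z:Z. hEq v B (f\<bullet>z) (g\<bullet>z)) \<Rrightarrow> hEq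
    (max w v) (Z \<Rrightarrow> B) f g)"

definition "funext_tm w v sy tn eta ap dge = (\<^bold>\<lambda>Z:hU w. \<^bold>\<lambda>B:hU v. \<^bold>\<lambda>f:Z \<Rrightarrow> B. \<^bold>\<lambda>g:Z \<Rrightarrow> B. \<^bold>\<lambda>h:\<^bold>\<forall>z:Z. hEq v B
    (f\<bullet>z) (g\<bullet>z).
   (\<lambda>f' g'. tn\<bullet>(Z \<Rrightarrow> B)\<bullet>f\<bullet>f'\<bullet>g\<bullet>(sy\<bullet>(Z \<Rrightarrow> B)\<bullet>f'\<bullet>f\<bullet>(eta\<bullet>Z\<bullet>B\<bullet>f))\<bullet>
       (tn\<bullet>(Z \<Rrightarrow> B)\<bullet>f'\<bullet>g'\<bullet>g\<bullet>(ap\<bullet>(hDiag v B \<Rrightarrow> B)\<bullet>(Z \<Rrightarrow> B)\<bullet>(\<^bold>\<lambda>k:hDiag v B \<Rrightarrow> B. \<^bold>\<lambda>z:Z. k\<bullet>hDiagPair v B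
           (f\<bullet>z) (g\<bullet>z) (h\<bullet>z))\<bullet>hDiagFst v B\<bullet>hDiagSnd v B\<bullet>(dge\<bullet>B))
         \<bullet>(eta\<bullet>Z\<bullet>B\<bullet>g)))
   (\<^bold>\<lambda>z:Z. f\<bullet>z) (\<^bold>\<lambda>z:Z. g\<bullet>z))"

text \<open>The homotopy \<open>h\<close> is a map from \<open>Z\<close> into the diagonal of
  \<open>B\<close>. Composing it with the two equal projections gives \<open>f\<close> and
  \<open>g\<close> up to eta.\<close>

lemma funext_01: "holds (funext_ty 0 1)"
  by (rule holdsI[where Ss = "[sym_ty 1, trans_ty 1, eta_ty 0 1, ap_ty 1 1, diag_proj_ty 1]"
      and t = "funext_tm 0 1 (hv 0) (hv 1) (hv 2) (hv 3) (hv 4)"],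
      simp only: list.pred_inject simp_thms sym_1 trans_1 eta[of 0 1] ap_11 diag_proj_1,
        code_simp)

lemma funext_00: "holds (funext_ty 0 0)"
  by (rule holdsI[where Ss = "[sym_ty 0, trans_ty 0, eta_ty 0 0, ap_ty 0 0, diag_proj_ty 0]"
      and t = "funext_tm 0 0 (hv 0) (hv 1) (hv 2) (hv 3) (hv 4)"],
      simp only: list.pred_inject simp_thms sym_0 trans_0 eta[of 0 0] ap_00 diag_proj_0,
        code_simp)

definition "propext_ty = (\<^bold>\<forall>P:hU 0. \<^bold>\<forall>Q:hU 0. hIsProp 0 P \<Rrightarrow> hIsProp 0 Q \<Rrightarrow> (P \<Rrightarrow> Q) \<Rrightarrow> (Q \<Rrightarrow> P) \<Rrightarrow> hEq 1
    (hU 0) P Q)"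

definition "propext_tm mke = (\<^bold>\<lambda>P:hU 0. \<^bold>\<lambda>Q:hU 0. \<^bold>\<lambda>i:hIsProp 0 P. \<^bold>\<lambda>j:hIsProp 0 Q. \<^bold>\<lambda>f:P \<Rrightarrow> Q. \<^bold>\<lambda>g:Q \<Rrightarrow> P.
   hFst 1 0 (hEq 1 (hU 0) P Q) (coe_fam 0 P Q f)
    (mke\<bullet>P\<bullet>Q\<bullet>f\<bullet>g\<bullet>(\<^bold>\<lambda>q:Q. j\<bullet>(f\<bullet>(g\<bullet>q))\<bullet>q)\<bullet>(\<^bold>\<lambda>p:P. i\<bullet>(g\<bullet>(f\<bullet>p))\<bullet>p)))"

lemma propext: "holds propext_ty"
  by (rule holdsI[where Ss = "[coe_qinv_ty 0]" and t = "propext_tm (hv 0)"],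
      simp only: list.pred_inject simp_thms coe_qinv_0, code_simp)

definition "pi_prop_ty = (\<^bold>\<forall>X:hU 0. \<^bold>\<forall>C:X \<Rrightarrow> hU 0. (\<^bold>\<forall>x:X. hIsProp 0 (C\<bullet>x)) \<Rrightarrow> hIsProp 0 (\<^bold>\<forall>x:X. C\<bullet>x))"

definition "pi_prop_tm tr fe01 fe00 pe up = (\<^bold>\<lambda>X:hU 0. \<^bold>\<lambda>C:X \<Rrightarrow> hU 0. \<^bold>\<lambda>hC:\<^bold>\<forall>x:X. hIsProp 0 (C\<bullet>x).
    \<^bold>\<lambda>f:\<^bold>\<forall>x:X. C\<bullet>x. \<^bold>\<lambda>g:\<^bold>\<forall>x:X. C\<bullet>x.
   (\<lambda>K. tr\<bullet>(X \<Rrightarrow> hU 0)\<bullet>(\<^bold>\<lambda>C:X \<Rrightarrow> hU 0. hIsProp 0 (\<^bold>\<forall>x:X. C\<bullet>x))\<bullet>K\<bullet>C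
     \<bullet>(fe01\<bullet>X\<bullet>hU 0\<bullet>K\<bullet>C\<bullet>(\<^bold>\<lambda>x:X. pe\<bullet>hUnit\<bullet>(C\<bullet>x)\<bullet>up\<bullet>(hC\<bullet>x)\<bullet>(\<^bold>\<lambda>_:hUnit. f\<bullet>x)\<bullet>(\<^bold>\<lambda>_:C\<bullet>x. hstar)))
     \<bullet>(\<^bold>\<lambda>f:X \<Rrightarrow> hUnit. \<^bold>\<lambda>g:X \<Rrightarrow> hUnit. fe00\<bullet>X\<bullet>hUnit\<bullet>f\<bullet>g\<bullet>(\<^bold>\<lambda>x:X. up\<bullet>(f\<bullet>x)\<bullet>(g\<bullet>x)))\<bullet>f\<bullet>g)
   (\<^bold>\<lambda>_:X. hUnit))"

text \<open>Extensionality is at hand for non-dependent functions. A given \<open>f\<close> shows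
  every \<open>C x\<close> to be inhabited, hence equal to \<open>hUnit\<close>; so \<open>C\<close>
  equals a constant family, and the claim is transported from there.\<close>

lemma pi_prop: "holds pi_prop_ty"
  by (rule holdsI[where Ss = "[tr_ty 1 0, funext_ty 0 1, funext_ty 0 0, propext_ty, unit_prop_ty]"
      and t = "pi_prop_tm (hv 0) (hv 1) (hv 2) (hv 3) (hv 4)"],
      simp only: list.pred_inject simp_thms tr_10 funext_01 funext_00 propext unit_prop,
        code_simp)

definition "prop_prop_ty = (\<^bold>\<forall>P:hU 0. hIsProp 0 (hIsProp 0 P))"

definition "prop_prop_tm wfe ps = (\<^bold>\<lambda>P:hU 0. \<^bold>\<lambda>i:hIsProp 0 P. \<^bold>\<lambda>j:hIsProp 0 P.
   wfe\<bullet>P\<bullet>(\<^bold>\<lambda>x:P. \<^bold>\<forall>y:P. hEq 0 P x y)\<bullet>(\<^bold>\<lambda>x:P. wfe\<bullet>P\<bullet>(\<^bold>\<lambda>y:P. hEq 0 P x y)\<bullet>(\<^bold>\<lambda>y:P. ps\<bullet>P\<bullet>i\<bullet>x\<bullet>y))\<bullet>i\<bullet>j)"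

text \<open>One of the two compared witnesses already shows that \<open>P\<close> is a proposition,
  hence a set, so \<open>hIsProp 0 P\<close> is an iterated product of propositions.\<close>

lemma prop_prop: "holds prop_prop_ty"
  by (rule holdsI[where Ss = "[pi_prop_ty, prop_set_ty]" and t = "prop_prop_tm (hv 0) (hv 1)"],
      simp only: list.pred_inject simp_thms pi_prop prop_set, code_simp)

section \<open>The type of propositions and extensionality of subsets\<close>

definition "hOmega = hSg 1 0 (hU 0) (hIsProp 0)"

definition "hEl A = hFst 1 0 (hU 0) (hIsProp 0) A"

definition "hmk P i = hPr 1 0 (hU 0) (hIsProp 0) P i"

definition "omega_ext_ty = (\<^bold>\<forall>A:hOmega. \<^bold>\<forall>B:hOmega. (hEl A \<Rrightarrow> hEl B) \<Rrightarrow> (hEl B \<Rrightarrow> hEl A) \<Rrightarrow> hEq 1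
    hOmega A B)"

definition "omega_ext_tm pp prp pe = (\<^bold>\<lambda>A:hOmega. \<^bold>\<lambda>B:hOmega.
    hSigInd 1 0 1 (hU 0) (hIsProp 0) (\<lambda>A. (hEl A \<Rrightarrow> hEl B) \<Rrightarrow> (hEl B \<Rrightarrow> hEl A) \<Rrightarrow> hEq 1 hOmega A B)
        (\<lambda>P i.
      hSigInd 1 0 1 (hU 0) (hIsProp 0) (\<lambda>B. (P \<Rrightarrow> hEl B) \<Rrightarrow> (hEl B \<Rrightarrow> P) \<Rrightarrow> hEq 1 hOmega (hmk P i) B)
          (\<lambda>Q j.
       \<^bold>\<lambda>f:P \<Rrightarrow> Q. \<^bold>\<lambda>g:Q \<Rrightarrow> P. pp\<bullet>hU 0\<bullet>(\<^bold>\<lambda>P:hU 0. hIsProp 0 P)\<bullet>prp\<bullet>P\<bullet>Q\<bullet>(pe\<bullet>P\<bullet>Q\<bullet>i\<bullet>j\<bullet>f\<bullet>g)\<bullet>i\<bullet>j) B) A)"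

text \<open>The carriers agree by \<open>propext\<close>, and the second components lie in the
  proposition-valued family \<open>hIsProp 0\<close>.\<close>

lemma omega_ext: "holds omega_ext_ty"
  by (rule holdsI[where Ss = "[pair_path_ty 1 0, prop_prop_ty, propext_ty]"
      and t = "omega_ext_tm (hv 0) (hv 1) (hv 2)"],
      simp only: list.pred_inject simp_thms pair_path_10 prop_prop propext, code_simp)

definition "ext_of \<Omega> El = (\<^bold>\<forall>A:\<Omega>. \<^bold>\<forall>B:\<Omega>. (El\<bullet>A \<Rrightarrow> El\<bullet>B) \<Rrightarrow> (El\<bullet>B \<Rrightarrow> El\<bullet>A) \<Rrightarrow> hEq 1 \<Omega> A B)"

definition "hIncl El X A B = (\<^bold>\<forall>x:X. El\<bullet>(A\<bullet>x) \<Rrightarrow> El\<bullet>(B\<bullet>x))"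

definition "powerset_ext_ty = (\<^bold>\<forall>\<Omega>:hU 1. \<^bold>\<forall>El:\<Omega> \<Rrightarrow> hU 0. ext_of \<Omega> El \<Rrightarrow> (\<^bold>\<forall>X:hU 0. \<^bold>\<forall>A:X \<Rrightarrow> \<Omega>. \<^bold>\<forall>B:X \<Rrightarrow> \<Omega>.
    hIncl El X A B \<Rrightarrow> hIncl El X B A \<Rrightarrow> hEq 1 (X \<Rrightarrow> \<Omega>) A B))"

definition "powerset_ext_tm fe = (\<^bold>\<lambda>\<Omega>:hU 1. \<^bold>\<lambda>El:\<Omega> \<Rrightarrow> hU 0. \<^bold>\<lambda>e:ext_of \<Omega> El. \<^bold>\<lambda>X:hU 0. \<^bold>\<lambda>A:X \<Rrightarrow> \<Omega>.
    \<^bold>\<lambda>B:X \<Rrightarrow> \<Omega>. \<^bold>\<lambda>f:hIncl El X A B. \<^bold>\<lambda>g:hIncl El X B A.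
   fe\<bullet>X\<bullet>\<Omega>\<bullet>A\<bullet>B\<bullet>(\<^bold>\<lambda>x:X. e\<bullet>(A\<bullet>x)\<bullet>(B\<bullet>x)\<bullet>(f\<bullet>x)\<bullet>(g\<bullet>x)))"

lemma powerset_ext: "holds powerset_ext_ty"
  by (rule holdsI[where Ss = "[funext_ty 0 1]" and t = "powerset_ext_tm (hv 0)"],
      simp only: list.pred_inject simp_thms funext_01, code_simp)

definition "incl_prop_ty = (\<^bold>\<forall>\<Omega>:hU 1. \<^bold>\<forall>El:\<Omega> \<Rrightarrow> hU 0. elp_of \<Omega> El \<Rrightarrow> (\<^bold>\<forall>X:hU 0. \<^bold>\<forall>A:X \<Rrightarrow> \<Omega>. \<^bold>\<forall>B:X \<Rrightarrow> \<Omega>.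
    hIsProp 0 (hIncl El X A B)))"

definition "incl_prop_tm w = (\<^bold>\<lambda>\<Omega>:hU 1. \<^bold>\<lambda>El:\<Omega> \<Rrightarrow> hU 0. \<^bold>\<lambda>e:elp_of \<Omega> El. \<^bold>\<lambda>X:hU 0. \<^bold>\<lambda>A:X \<Rrightarrow> \<Omega>.
    \<^bold>\<lambda>B:X \<Rrightarrow> \<Omega>. w\<bullet>X\<bullet>(\<^bold>\<lambda>x:X. El\<bullet>(A\<bullet>x) \<Rrightarrow> El\<bullet>(B\<bullet>x))
    \<bullet>(\<^bold>\<lambda>x:X. w\<bullet>(El\<bullet>(A\<bullet>x))\<bullet>(\<^bold>\<lambda>_:El\<bullet>(A\<bullet>x). El\<bullet>(B\<bullet>x))\<bullet>(\<^bold>\<lambda>_:El\<bullet>(A\<bullet>x). e\<bullet>(B\<bullet>x))))"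

lemma incl_prop: "holds incl_prop_ty"
  by (rule holdsI[where Ss = "[pi_prop_ty]" and t = "incl_prop_tm (hv 0)"],
      simp only: list.pred_inject simp_thms pi_prop, code_simp)

section \<open>Retracts of powersets are injective sets\<close>

definition "ret_of D W s r = (\<^bold>\<forall>d:D. hEq 0 D (r\<bullet>(s\<bullet>d)) d)"

definition "retract_set_ty = (\<^bold>\<forall>W:hU 1. \<^bold>\<forall>I:W \<Rrightarrow> W \<Rrightarrow> hU 0. (\<^bold>\<forall>A:W. \<^bold>\<forall>B:W. hIsProp 0 (I\<bullet>A\<bullet>B)) \<Rrightarrow>
    (\<^bold>\<forall>A:W. I\<bullet>A\<bullet>A) \<Rrightarrow> (\<^bold>\<forall>A:W. \<^bold>\<forall>B:W. I\<bullet>A\<bullet>B \<Rrightarrow> I\<bullet>B\<bullet>A \<Rrightarrow> hEq 1 W A B) \<Rrightarrow>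
   (\<^bold>\<forall>D:hU 0. \<^bold>\<forall>s:D \<Rrightarrow> W. \<^bold>\<forall>r:W \<Rrightarrow> D. ret_of D W s r \<Rrightarrow> hIsSet 0 D))"

definition "retract_set_tm hdb sp sy tn ap = (\<^bold>\<lambda>W:hU 1. \<^bold>\<lambda>I:W \<Rrightarrow> W \<Rrightarrow> hU 0. \<^bold>\<lambda>ip:\<^bold>\<forall>A:W. \<^bold>\<forall>B:W. hIsProp 0
    (I\<bullet>A\<bullet>B). \<^bold>\<lambda>ir:\<^bold>\<forall>A:W. I\<bullet>A\<bullet>A. \<^bold>\<lambda>ia:\<^bold>\<forall>A:W. \<^bold>\<forall>B:W. I\<bullet>A\<bullet>B \<Rrightarrow> I\<bullet>B\<bullet>A \<Rrightarrow> hEq 1 W A B.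
    \<^bold>\<lambda>D:hU 0. \<^bold>\<lambda>s:D \<Rrightarrow> W. \<^bold>\<lambda>r:W \<Rrightarrow> D. \<^bold>\<lambda>h:ret_of D W s r.
  (\<lambda>J. hdb\<bullet>D\<bullet>(\<^bold>\<lambda>x:D. \<^bold>\<lambda>y:D. hProd 0 0 (J x y) (J y x))
    \<bullet>(\<^bold>\<lambda>x:D. \<^bold>\<lambda>y:D. sp\<bullet>J x y\<bullet>(\<^bold>\<lambda>_:J x y. J y x)\<bullet>(ip\<bullet>(s\<bullet>x)\<bullet>(s\<bullet>y))\<bullet>(\<^bold>\<lambda>_:J x y. ip\<bullet>(s\<bullet>y)\<bullet>(s\<bullet>x)))
    \<bullet>(\<^bold>\<lambda>x:D. hPr 0 0 (J x x) (\<lambda>_. J x x) (ir\<bullet>(s\<bullet>x)) (ir\<bullet>(s\<bullet>x)))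
    \<bullet>(\<^bold>\<lambda>x:D. \<^bold>\<lambda>y:D. \<^bold>\<lambda>w:hProd 0 0 (J x y) (J y x).
        tn\<bullet>D\<bullet>x\<bullet>(r\<bullet>(s\<bullet>x))\<bullet>y\<bullet>(sy\<bullet>D\<bullet>(r\<bullet>(s\<bullet>x))\<bullet>x\<bullet>(h\<bullet>x))
        \<bullet>(tn\<bullet>D\<bullet>(r\<bullet>(s\<bullet>x))\<bullet>(r\<bullet>(s\<bullet>y))\<bullet>y\<bullet>
           (ap\<bullet>W\<bullet>D\<bullet>r\<bullet>(s\<bullet>x)\<bullet>(s\<bullet>y)\<bullet>(ia\<bullet>(s\<bullet>x)\<bullet>(s\<bullet>y)\<bullet>hFst 0 0 (J x y) (\<lambda>_. J y x) w\<bullet>hSnd 0 0 (J x y)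
               (\<lambda>_. J y x) w))
          \<bullet>(h\<bullet>y))))
   (\<lambda>x y. I\<bullet>(s\<bullet>x)\<bullet>(s\<bullet>y)))"

text \<open>Hedberg's relation must take values in \<open>hU 0\<close>, whereas identity types of
  \<open>W\<close> live in \<open>hU 1\<close>. So mutual \<open>I\<close>-inclusion of
  \<open>s x\<close> and \<open>s y\<close> takes their place: it implies that these are equal, and
  applying \<open>r\<close> gives \<open>x = y\<close>.\<close>

lemma retract_set: "holds retract_set_ty"
  by (rule holdsI[where Ss = "[hedberg_ty, sig_prop_ty 0 0, sym_ty 0, trans_ty 0, ap_ty 1 0]"
      and t = "retract_set_tm (hv 0) (hv 1) (hv 2) (hv 3) (hv 4)"],
      simp only: list.pred_inject simp_thms hedberg sig_prop sym_0 trans_0 ap_10, code_simp)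

definition "kan_fam W X Y j F G = (\<^bold>\<forall>x:X. hEq 1 W (G\<bullet>(j\<bullet>x)) (F\<bullet>x))"

text \<open>Injectivity of the large type \<open>W\<close>, with the map and its embedding property
  as separate arguments instead of a pair.\<close>

definition "hKan W = (\<^bold>\<forall>X:hU 0. \<^bold>\<forall>Y:hU 0. \<^bold>\<forall>j:X \<Rrightarrow> Y. hIsEmb X Y j \<Rrightarrow> (\<^bold>\<forall>F:X \<Rrightarrow> W. hSg 1 1 (Y \<Rrightarrow> W)
    (kan_fam W X Y j F)))"

definition "extension_fam D X Y j f g = (\<^bold>\<forall>x:X. hEq 0 D (g\<bullet>(j\<bullet>x)) (f\<bullet>x))"

definition "retract_ext_ty = (\<^bold>\<forall>W:hU 1. hKan W \<Rrightarrow> (\<^bold>\<forall>D:hU 0. \<^bold>\<forall>s:D \<Rrightarrow> W. \<^bold>\<forall>r:W \<Rrightarrow> D. ret_of D W s r \<Rrightarrow>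
    (\<^bold>\<forall>X:hU 0. \<^bold>\<forall>Y:hU 0. \<^bold>\<forall>j:X \<Rrightarrow> Y. hIsEmb X Y j \<Rrightarrow> (\<^bold>\<forall>f:X \<Rrightarrow> D. hSg 0 0 (Y \<Rrightarrow> D)
    (extension_fam D X Y j f)))))"

definition "retract_ext_tm ap tn = (\<^bold>\<lambda>W:hU 1. \<^bold>\<lambda>k:hKan W. \<^bold>\<lambda>D:hU 0. \<^bold>\<lambda>s:D \<Rrightarrow> W. \<^bold>\<lambda>r:W \<Rrightarrow> D.
    \<^bold>\<lambda>h:ret_of D W s r. \<^bold>\<lambda>X:hU 0. \<^bold>\<lambda>Y:hU 0. \<^bold>\<lambda>j:X \<Rrightarrow> Y. \<^bold>\<lambda>e:hIsEmb X Y j. \<^bold>\<lambda>f:X \<Rrightarrow> D.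
   hSigInd 1 1 0 (Y \<Rrightarrow> W) (\<lambda>G. \<^bold>\<forall>x:X. hEq 1 W (G\<bullet>(j\<bullet>x)) (s\<bullet>(f\<bullet>x)))
     (\<lambda>_. hSg 0 0 (Y \<Rrightarrow> D) (extension_fam D X Y j f))
     (\<lambda>G H. hPr 0 0 (Y \<Rrightarrow> D) (extension_fam D X Y j f) (\<^bold>\<lambda>y:Y. r\<bullet>(G\<bullet>y))
       (\<^bold>\<lambda>x:X. tn\<bullet>D\<bullet>(r\<bullet>(G\<bullet>(j\<bullet>x)))\<bullet>(r\<bullet>(s\<bullet>(f\<bullet>x)))\<bullet>(f\<bullet>x)\<bullet>(ap\<bullet>W\<bullet>D\<bullet>r\<bullet>(G\<bullet>(j\<bullet>x))\<bullet>(s\<bullet>(f\<bullet>x))\<bullet>(H\<bullet>x))\<bullet>(h\<bullet>(f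
           \<bullet>x))))
     (k\<bullet>X\<bullet>Y\<bullet>j\<bullet>e\<bullet>(\<^bold>\<lambda>x:X. s\<bullet>(f\<bullet>x))))"

text \<open>An extension \<open>G\<close> of \<open>s\<close> after \<open>f\<close> is followed by
  \<open>r\<close>.\<close>

lemma retract_ext: "holds retract_ext_ty"
  by (rule holdsI[where Ss = "[ap_ty 1 0, trans_ty 0]" and t = "retract_ext_tm (hv 0) (hv 1)"],
      simp only: list.pred_inject simp_thms ap_10 trans_0, code_simp)

definition "emb_map_emb_ty = (\<^bold>\<forall>X:hU 0. \<^bold>\<forall>Y:hU 0. \<^bold>\<forall>j:hEmb X Y. hIsEmb X Y (hEmbMap X Y j))"

definition "emb_map_emb_tm = (\<^bold>\<lambda>X:hU 0. \<^bold>\<lambda>Y:hU 0. \<^bold>\<lambda>j:hEmb X Y. hSnd 0 0 (X \<Rrightarrow> Y) (hIsEmb X Y) j)"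

lemma emb_map_emb: "holds emb_map_emb_ty"
  by (rule holdsI[where Ss = "[]" and t = "emb_map_emb_tm"],
      simp only: list.pred_inject simp_thms, code_simp)

definition "retract_inj_ty = (\<^bold>\<forall>W:hU 1. hKan W \<Rrightarrow> (\<^bold>\<forall>D:hU 0. \<^bold>\<forall>s:D \<Rrightarrow> W. \<^bold>\<forall>r:W \<Rrightarrow> D. ret_of D W s r \<Rrightarrow>
    hAlgInj D))"

definition "retract_inj_tm gi es = (\<^bold>\<lambda>W:hU 1. \<^bold>\<lambda>k:hKan W. \<^bold>\<lambda>D:hU 0. \<^bold>\<lambda>s:D \<Rrightarrow> W. \<^bold>\<lambda>r:W \<Rrightarrow> D.
    \<^bold>\<lambda>h:ret_of D W s r. \<^bold>\<lambda>X:hU 0. \<^bold>\<lambda>Y:hU 0. \<^bold>\<lambda>j:hEmb X Y.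
   gi\<bullet>W\<bullet>k\<bullet>D\<bullet>s\<bullet>r\<bullet>h\<bullet>X\<bullet>Y\<bullet>hEmbMap X Y j\<bullet>(es\<bullet>X\<bullet>Y\<bullet>j))"

lemma retract_inj: "holds retract_inj_ty"
  by (rule holdsI[where Ss = "[retract_ext_ty, emb_map_emb_ty]"
      and t = "retract_inj_tm (hv 0) (hv 1)"],
      simp only: list.pred_inject simp_thms retract_ext emb_map_emb, code_simp)

section \<open>Direct images and extension of families of subsets along an embedding\<close>

definition "image_fam Y j C y x = hProd 0 0 (hEq 0 Y (j\<bullet>x) y) (C\<bullet>x)"

definition "hImage X Y j C y = hSg 0 0 X (image_fam Y j C y)"

definition "hImageT X Y j C y = hc (Trunc 0)\<bullet>hImage X Y j C y"

definition "image_in_ty = (\<^bold>\<forall>X:hU 0. \<^bold>\<forall>Y:hU 0. \<^bold>\<forall>j:X \<Rrightarrow> Y. \<^bold>\<forall>x:X. \<^bold>\<forall>C:X \<Rrightarrow> hU 0. C\<bullet>x \<Rrightarrow> hImageT X Y j C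
    (j\<bullet>x))"

definition "image_in_tm = (\<^bold>\<lambda>X:hU 0. \<^bold>\<lambda>Y:hU 0. \<^bold>\<lambda>j:X \<Rrightarrow> Y. \<^bold>\<lambda>x:X. \<^bold>\<lambda>C:X \<Rrightarrow> hU 0. \<^bold>\<lambda>c:C\<bullet>x. hc
    (TruncIn 0)\<bullet>hImage X Y j C (j\<bullet>x)\<bullet>hPr 0 0 X (image_fam Y j C (j\<bullet>x)) x (hPr 0 0 (hEq 0 Y (j\<bullet>x)
    (j\<bullet>x)) (\<lambda>_. C\<bullet>x) (hRefl 0 Y (j\<bullet>x)) c))"

lemma image_in: "holds image_in_ty"
  by (rule holdsI[where Ss = "[]" and t = "image_in_tm"],
      simp only: list.pred_inject simp_thms, code_simp)

definition "emb_inj_ty = (\<^bold>\<forall>X:hU 0. \<^bold>\<forall>Y:hU 0. \<^bold>\<forall>j:X \<Rrightarrow> Y. hIsEmb X Y j \<Rrightarrow> (\<^bold>\<forall>x:X. \<^bold>\<forall>x':X. hEq 0 Y (j\<bullet>x)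
    (j\<bullet>x') \<Rrightarrow> hEq 0 X x x'))"

definition "emb_inj_tm ap = (\<^bold>\<lambda>X:hU 0. \<^bold>\<lambda>Y:hU 0. \<^bold>\<lambda>j:X \<Rrightarrow> Y. \<^bold>\<lambda>e:hIsEmb X Y j. \<^bold>\<lambda>x:X. \<^bold>\<lambda>x':X. \<^bold>\<lambda>p:hEq 0 Y
    (j\<bullet>x) (j\<bullet>x').
   (\<lambda>B. (\<lambda>F t t'. ap\<bullet>F\<bullet>X\<bullet>(\<^bold>\<lambda>t:F. hFst 0 0 X B t)\<bullet>t\<bullet>t'\<bullet>(e\<bullet>(j\<bullet>x')\<bullet>t\<bullet>t')) (hSg 0 0 X B)
       (hPr 0 0 X B x p) (hPr 0 0 X B x' (hRefl 0 Y (j\<bullet>x')))) (\<lambda>x. hEq 0 Y (j\<bullet>x) (j\<bullet>x')))"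

text \<open>The fibre over \<open>j x'\<close> is a proposition containing both
  \<open>(x, p)\<close> and \<open>x'\<close> with reflexivity; the first projection is applied to
  their equality.\<close>

lemma emb_inj: "holds emb_inj_ty"
  by (rule holdsI[where Ss = "[ap_ty 0 0]" and t = "emb_inj_tm (hv 0)"],
      simp only: list.pred_inject simp_thms ap_00, code_simp)

definition "image_out_ty = (\<^bold>\<forall>X:hU 0. \<^bold>\<forall>Y:hU 0. \<^bold>\<forall>j:X \<Rrightarrow> Y. hIsEmb X Y j \<Rrightarrow> (\<^bold>\<forall>x:X. \<^bold>\<forall>C:X \<Rrightarrow> hU 0. (\<^bold>\<forall>x:X.
    hIsProp 0 (C\<bullet>x)) \<Rrightarrow> hImageT X Y j C (j\<bullet>x) \<Rrightarrow> C\<bullet>x))"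

definition "image_out_tm tr ei = (\<^bold>\<lambda>X:hU 0. \<^bold>\<lambda>Y:hU 0. \<^bold>\<lambda>j:X \<Rrightarrow> Y. \<^bold>\<lambda>e:hIsEmb X Y j. \<^bold>\<lambda>x:X. \<^bold>\<lambda>C:X \<Rrightarrow> hU 0.
    \<^bold>\<lambda>hC:\<^bold>\<forall>x:X. hIsProp 0 (C\<bullet>x).
    hc (TruncRec 0 0)\<bullet>hImage X Y j C (j\<bullet>x)\<bullet>(C\<bullet>x)\<bullet>(hC\<bullet>x)\<bullet>(\<^bold>\<lambda>w:hImage X Y j C (j\<bullet>x). hSigInd 0 0 0 X
        (image_fam Y j C (j\<bullet>x)) (\<lambda>_. C\<bullet>x)
      (\<lambda>x' w. hSigInd 0 0 0 (hEq 0 Y (j\<bullet>x') (j\<bullet>x)) (\<lambda>_. C\<bullet>x') (\<lambda>_. C\<bullet>x)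
          (\<lambda>p c. tr\<bullet>X\<bullet>C\<bullet>x'\<bullet>x\<bullet>(ei\<bullet>X\<bullet>Y\<bullet>j\<bullet>e\<bullet>x'\<bullet>x\<bullet>p)\<bullet>c) w) w))"

text \<open>\<open>C x\<close> is a proposition, so the truncation may be opened. The point
  \<open>x'\<close> found there satisfies \<open>j x' = j x\<close>, hence equals \<open>x\<close>,
  and its membership in \<open>C\<close> is transported.\<close>

lemma image_out: "holds image_out_ty"
  by (rule holdsI[where Ss = "[tr_ty 0 0, emb_inj_ty]" and t = "image_out_tm (hv 0) (hv 1)"],
      simp only: list.pred_inject simp_thms tr_00 emb_inj, code_simp)

definition "hImgOp X Y = ((X \<Rrightarrow> hU 0) \<Rrightarrow> Y \<Rrightarrow> hU 0)"

definition "kan_abs_ty = (\<^bold>\<forall>\<Omega>:hU 1. \<^bold>\<forall>El:\<Omega> \<Rrightarrow> hU 0. elp_of \<Omega> El \<Rrightarrow>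
    (\<^bold>\<forall>mk:mk_of \<Omega>. in_of El mk \<Rrightarrow> out_of El mk \<Rrightarrow> ext_of \<Omega> El \<Rrightarrow> (\<^bold>\<forall>V:hU 0.
   \<^bold>\<forall>X:hU 0. \<^bold>\<forall>Y:hU 0. \<^bold>\<forall>j:X \<Rrightarrow> Y. \<^bold>\<forall>S:hImgOp X Y. (\<^bold>\<forall>C:X \<Rrightarrow> hU 0. \<^bold>\<forall>y:Y. hIsProp 0 (S\<bullet>C\<bullet>y)) \<Rrightarrow>
    (\<^bold>\<forall>x:X. \<^bold>\<forall>C:X \<Rrightarrow> hU 0. C\<bullet>x \<Rrightarrow> S\<bullet>C\<bullet>(j\<bullet>x)) \<Rrightarrow> (\<^bold>\<forall>x:X. \<^bold>\<forall>C:X \<Rrightarrow> hU 0. (\<^bold>\<forall>x:X. hIsProp 0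
        (C\<bullet>x)) \<Rrightarrow> S\<bullet>C\<bullet>(j\<bullet>x) \<Rrightarrow> C\<bullet>x) \<Rrightarrow> (\<^bold>\<forall>F:X \<Rrightarrow> V \<Rrightarrow> \<Omega>. hSg 1 1 (Y \<Rrightarrow> V \<Rrightarrow> \<Omega>) (kan_fam
        (V \<Rrightarrow> \<Omega>) X Y j F)))))"

definition "kan_abs_tm ps = (\<^bold>\<lambda>\<Omega>:hU 1. \<^bold>\<lambda>El:\<Omega> \<Rrightarrow> hU 0. \<^bold>\<lambda>elp:elp_of \<Omega> El. \<^bold>\<lambda>mk:mk_of \<Omega>. \<^bold>\<lambda>inn:in_of El mk.
    \<^bold>\<lambda>out:out_of El mk. \<^bold>\<lambda>ex:ext_of \<Omega> El. \<^bold>\<lambda>V:hU 0.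
   \<^bold>\<lambda>X:hU 0. \<^bold>\<lambda>Y:hU 0. \<^bold>\<lambda>j:X \<Rrightarrow> Y. \<^bold>\<lambda>S:hImgOp X Y. \<^bold>\<lambda>Sp:\<^bold>\<forall>C:X \<Rrightarrow> hU 0. \<^bold>\<forall>y:Y. hIsProp 0 (S\<bullet>C\<bullet>y).
   \<^bold>\<lambda>Si:\<^bold>\<forall>x:X. \<^bold>\<forall>C:X \<Rrightarrow> hU 0. C\<bullet>x \<Rrightarrow> S\<bullet>C\<bullet>(j\<bullet>x). \<^bold>\<lambda>So:\<^bold>\<forall>x:X. \<^bold>\<forall>C:X \<Rrightarrow> hU 0. (\<^bold>\<forall>x:X. hIsProp 0
       (C\<bullet>x)) \<Rrightarrow> S\<bullet>C\<bullet>(j\<bullet>x) \<Rrightarrow> C\<bullet>x. \<^bold>\<lambda>F:X \<Rrightarrow> V \<Rrightarrow> \<Omega>.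
   (\<lambda>C. (\<lambda>Q. (\<lambda>G. hPr 1 1 (Y \<Rrightarrow> V \<Rrightarrow> \<Omega>) (kan_fam (V \<Rrightarrow> \<Omega>) X Y j F) (\<^bold>\<lambda>y:Y. G y)
     (\<^bold>\<lambda>x:X. ps\<bullet>\<Omega>\<bullet>El\<bullet>ex\<bullet>V\<bullet>G (j\<bullet>x)\<bullet>(F\<bullet>x)
        \<bullet>(\<^bold>\<lambda>v:V. \<^bold>\<lambda>p:El\<bullet>(mk\<bullet>(S\<bullet>C v\<bullet>(j\<bullet>x))\<bullet>Q v (j\<bullet>x)). So\<bullet>x\<bullet>C v\<bullet>(\<^bold>\<lambda>x:X. elp\<bullet>(F\<bullet>x\<bullet>v))\<bullet>(out\<bullet>(S\<bullet>C
            v\<bullet>(j\<bullet>x))\<bullet>Q v (j\<bullet>x)\<bullet>p))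
        \<bullet>(\<^bold>\<lambda>v:V. \<^bold>\<lambda>p:El\<bullet>(F\<bullet>x\<bullet>v). inn\<bullet>(S\<bullet>C v\<bullet>(j\<bullet>x))\<bullet>Q v (j\<bullet>x)\<bullet>(Si\<bullet>x\<bullet>C v\<bullet>p))))
      (\<lambda>y. \<^bold>\<lambda>v:V. mk\<bullet>(S\<bullet>C v\<bullet>y)\<bullet>Q v y))
     (\<lambda>v y. Sp\<bullet>C v\<bullet>y))
    (\<lambda>v. \<^bold>\<lambda>x:X. El\<bullet>(F\<bullet>x\<bullet>v)))"

text \<open>The extension at \<open>y\<close> and \<open>v\<close> is the \<open>S\<close>-image of
  the family \<open>C v\<close> of all \<open>x\<close> with \<open>v\<close> in \<open>F x\<close>.
  At \<open>y = j x\<close>, the laws \<open>Si\<close> and \<open>So\<close> give the two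
  inclusions with \<open>F x\<close>. Here \<open>S\<close> stands for the truncated direct image,
  which \<open>kan_extension\<close> substitutes.\<close>

lemma abstract_kan_extension: "holds kan_abs_ty"
  by (rule holdsI[where Ss = "[powerset_ext_ty]" and t = "kan_abs_tm (hv 0)"],
      simp only: list.pred_inject simp_thms powerset_ext, code_simp)

definition "kan_ty = (\<^bold>\<forall>\<Omega>:hU 1. \<^bold>\<forall>El:\<Omega> \<Rrightarrow> hU 0. elp_of \<Omega> El \<Rrightarrow> (\<^bold>\<forall>mk:mk_of \<Omega>. in_of El mk \<Rrightarrow> out_of El mk
    \<Rrightarrow> ext_of \<Omega> El \<Rrightarrow> (\<^bold>\<forall>V:hU 0. hKan (V \<Rrightarrow> \<Omega>))))"

definition "kan_tm ka im gm = (\<^bold>\<lambda>\<Omega>:hU 1. \<^bold>\<lambda>El:\<Omega> \<Rrightarrow> hU 0. \<^bold>\<lambda>elp:elp_of \<Omega> El. \<^bold>\<lambda>mk:mk_of \<Omega>.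
    \<^bold>\<lambda>inn:in_of El mk. \<^bold>\<lambda>out:out_of El mk. \<^bold>\<lambda>ex:ext_of \<Omega> El. \<^bold>\<lambda>V:hU 0.
   \<^bold>\<lambda>X:hU 0. \<^bold>\<lambda>Y:hU 0. \<^bold>\<lambda>j:X \<Rrightarrow> Y. \<^bold>\<lambda>e:hIsEmb X Y j. ka\<bullet>\<Omega>\<bullet>El\<bullet>elp\<bullet>mk\<bullet>inn\<bullet>out\<bullet>ex\<bullet>V\<bullet>X\<bullet>Y\<bullet>j\<bullet>(\<^bold>\<lambda>C:X \<Rrightarrow> hU 0.
       \<^bold>\<lambda>y:Y. hImageT X Y j C y)\<bullet>(\<^bold>\<lambda>C:X \<Rrightarrow> hU 0. \<^bold>\<lambda>y:Y. hc (TruncProp 0)\<bullet>hImage X Y j C y)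
    \<bullet>(im\<bullet>X\<bullet>Y\<bullet>j)\<bullet>(gm\<bullet>X\<bullet>Y\<bullet>j\<bullet>e))"

lemma kan_extension: "holds kan_ty"
  by (rule holdsI[where Ss = "[kan_abs_ty, image_in_ty, image_out_ty]"
      and t = "kan_tm (hv 0) (hv 1) (hv 2)"],
      simp only: list.pred_inject simp_thms abstract_kan_extension image_in image_out, code_simp)

definition "of_retract_ty = (\<^bold>\<forall>\<Omega>:hU 1. \<^bold>\<forall>El:\<Omega> \<Rrightarrow> hU 0. elp_of \<Omega> El \<Rrightarrow>
    (\<^bold>\<forall>mk:mk_of \<Omega>. in_of El mk \<Rrightarrow> out_of El mk \<Rrightarrow> ext_of \<Omega> El \<Rrightarrow> (\<^bold>\<forall>D:hU 0. \<^bold>\<forall>X:hU 0.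
   hRetract D (X \<Rrightarrow> \<Omega>) \<Rrightarrow> hProd 0 1 (hIsSet 0 D) (hAlgInj D))))"

definition "of_retract_tm st kn ps ip nj = (\<^bold>\<lambda>\<Omega>:hU 1. \<^bold>\<lambda>El:\<Omega> \<Rrightarrow> hU 0. \<^bold>\<lambda>elp:elp_of \<Omega> El. \<^bold>\<lambda>mk:mk_of \<Omega>.
    \<^bold>\<lambda>inn:in_of El mk. \<^bold>\<lambda>out:out_of El mk. \<^bold>\<lambda>ex:ext_of \<Omega> El. \<^bold>\<lambda>D:hU 0. \<^bold>\<lambda>X:hU 0. \<^bold>\<lambda>w:hRetract D (X \<Rrightarrow> \<Omega>).
  (\<lambda>W. hSigInd 1 1 1 (D \<Rrightarrow> W) (\<lambda>s. hSg 1 0 (W \<Rrightarrow> D) (\<lambda>r. \<^bold>\<forall>d:D. hEq 0 D (r\<bullet>(s\<bullet>d)) d)) (\<lambda>_. hProd 0 1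
      (hIsSet 0 D) (hAlgInj D))
     (\<lambda>s w. hSigInd 1 0 1 (W \<Rrightarrow> D) (\<lambda>r. \<^bold>\<forall>d:D. hEq 0 D (r\<bullet>(s\<bullet>d)) d) (\<lambda>_. hProd 0 1 (hIsSet 0 D)
         (hAlgInj D))
       (\<lambda>r h. hPr 0 1 (hIsSet 0 D) (\<lambda>_. hAlgInj D)
          (st\<bullet>W\<bullet>(\<^bold>\<lambda>A:W. \<^bold>\<lambda>B:W. hIncl El X A B)\<bullet>(ip\<bullet>\<Omega>\<bullet>El\<bullet>elp\<bullet>X)\<bullet>(\<^bold>\<lambda>A:W. \<^bold>\<lambda>x:X.
              \<^bold>\<lambda>p:El\<bullet>(A\<bullet>x). p)\<bullet>(ps\<bullet>\<Omega>\<bullet>El\<bullet>ex\<bullet>X)\<bullet>D\<bullet>s\<bullet>r\<bullet>h)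
          (nj\<bullet>W\<bullet>(kn\<bullet>\<Omega>\<bullet>El\<bullet>elp\<bullet>mk\<bullet>inn\<bullet>out\<bullet>ex\<bullet>X)\<bullet>D\<bullet>s\<bullet>r\<bullet>h)) w) w)
   (X \<Rrightarrow> \<Omega>))"

lemma of_retract: "holds of_retract_ty"
  by (rule holdsI[where Ss = "[retract_set_ty, kan_ty, powerset_ext_ty, incl_prop_ty,
          retract_inj_ty]"
      and t = "of_retract_tm (hv 0) (hv 1) (hv 2) (hv 3) (hv 4)"],
      simp only: list.pred_inject simp_thms retract_set kan_extension powerset_ext incl_prop
        retract_inj, code_simp)

section \<open>Assembly of the equivalence and transfer to an arbitrary universe\<close>

definition "iff_sig_ty = (\<^bold>\<forall>S:hU 0. \<^bold>\<forall>I:hU 1. \<^bold>\<forall>R:hU 0 \<Rrightarrow> hU 1. \<^bold>\<forall>D:hU 0. (S \<Rrightarrow> I \<Rrightarrow> R\<bullet>D) \<Rrightarrow> (\<^bold>\<forall>X:hU 0. R\<bullet>X \<Rrightarrow>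
    hProd 0 1 S I) \<Rrightarrow>
   hProd 1 1 (hProd 0 1 S I \<Rrightarrow> hSg 1 1 (hU 0) (\<lambda>X. R\<bullet>X)) (hSg 1 1 (hU 0) (\<lambda>X. R\<bullet>X) \<Rrightarrow> hProd 0 1 S I))"

definition "iff_sig_tm = (\<^bold>\<lambda>S:hU 0. \<^bold>\<lambda>I:hU 1. \<^bold>\<lambda>R:hU 0 \<Rrightarrow> hU 1. \<^bold>\<lambda>D:hU 0. \<^bold>\<lambda>f:S \<Rrightarrow> I \<Rrightarrow> R\<bullet>D.
    \<^bold>\<lambda>g:\<^bold>\<forall>X:hU 0. R\<bullet>X \<Rrightarrow> hProd 0 1 S I.
  (\<lambda>L R'. hPr 1 1 (L \<Rrightarrow> R') (\<lambda>_. R' \<Rrightarrow> L)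
     (\<^bold>\<lambda>w:L. hSigInd 0 1 1 S (\<lambda>_. I) (\<lambda>_. R') (\<lambda>s i. hPr 1 1 (hU 0) (\<lambda>X. R\<bullet>X) D (f\<bullet>s\<bullet>i)) w)
     (\<^bold>\<lambda>w:R'. hSigInd 1 1 1 (hU 0) (\<lambda>X. R\<bullet>X) (\<lambda>_. L) (\<lambda>X r. g\<bullet>X\<bullet>r) w))
   (hProd 0 1 S I) (hSg 1 1 (hU 0) (\<lambda>X. R\<bullet>X)))"

text \<open>In the forward direction the designated type is \<open>D\<close> itself.\<close>

lemma iff_sig: "holds iff_sig_ty"
  by (rule holdsI[where Ss = "[]" and t = "iff_sig_tm"],
      simp only: list.pred_inject simp_thms, code_simp)

definition "main_iff \<Omega> D = (hProd 1 1 (hProd 0 1 (hIsSet 0 D) (hAlgInj D) \<Rrightarrow> hSg 1 1 (hU 0) (\<lambda>X.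
    hRetract D (X \<Rrightarrow> \<Omega>))) (hSg 1 1 (hU 0) (\<lambda>X. hRetract D (X \<Rrightarrow> \<Omega>)) \<Rrightarrow> hProd 0 1 (hIsSet 0 D)
    (hAlgInj D)))"

definition "abstract_main_ty = (\<^bold>\<forall>\<Omega>:hU 1. \<^bold>\<forall>El:\<Omega> \<Rrightarrow> hU 0. elp_of \<Omega> El \<Rrightarrow>
    (\<^bold>\<forall>mk:mk_of \<Omega>. in_of El mk \<Rrightarrow> out_of El mk \<Rrightarrow> ext_of \<Omega> El \<Rrightarrow> (\<^bold>\<forall>D:hU 0. main_iff \<Omega> D)))"

definition "abstract_main_tm fw bw lem = (\<^bold>\<lambda>\<Omega>:hU 1. \<^bold>\<lambda>El:\<Omega> \<Rrightarrow> hU 0. \<^bold>\<lambda>elp:elp_of \<Omega> El. \<^bold>\<lambda>mk:mk_of \<Omega>.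
    \<^bold>\<lambda>inn:in_of El mk. \<^bold>\<lambda>out:out_of El mk. \<^bold>\<lambda>ex:ext_of \<Omega> El. \<^bold>\<lambda>D:hU 0.
   lem\<bullet>hIsSet 0 D\<bullet>hAlgInj D\<bullet>(\<^bold>\<lambda>X:hU 0. hRetract D (X \<Rrightarrow>
       \<Omega>))\<bullet>D\<bullet>(fw\<bullet>\<Omega>\<bullet>El\<bullet>elp\<bullet>mk\<bullet>inn\<bullet>out\<bullet>D)\<bullet>(bw\<bullet>\<Omega>\<bullet>El\<bullet>elp\<bullet>mk\<bullet>inn\<bullet>out\<bullet>ex\<bullet>D))"

lemma abstract_main: "holds abstract_main_ty"
  by (rule holdsI[where Ss = "[to_retract_ty, of_retract_ty, iff_sig_ty]"
      and t = "abstract_main_tm (hv 0) (hv 1) (hv 2)"],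
      simp only: list.pred_inject simp_thms to_retract of_retract iff_sig, code_simp)

definition "hElp A = hSnd 1 0 (hU 0) (hIsProp 0) A"

definition "elp_ty = (\<^bold>\<forall>A:hOmega. hIsProp 0 (hEl A))"

definition "elp_tm = (\<^bold>\<lambda>A:hOmega. hElp A)"

lemma omega_prop: "holds elp_ty"
  by (rule holdsI[where Ss = "[]" and t = "elp_tm"],
      simp only: list.pred_inject simp_thms, code_simp)

definition "main_tm gm oe ce = (gm\<bullet>hOmega\<bullet>(\<^bold>\<lambda>A:hOmega. hEl A)\<bullet>ce\<bullet>(\<^bold>\<lambda>P:hU 0.
    \<^bold>\<lambda>i:hIsProp 0 P. hmk P i)\<bullet>(\<^bold>\<lambda>P:hU 0. \<^bold>\<lambda>i:hIsProp 0 P. \<^bold>\<lambda>p:P. p)\<bullet>(\<^bold>\<lambda>P:hU 0. \<^bold>\<lambda>i:hIsProp 0 P.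
    \<^bold>\<lambda>p:P. p)\<bullet>oe)"

text \<open>The abstract \<open>\<Omega>\<close> becomes \<open>hOmega\<close>. Projections of pairs
  compute, so the two operations relating \<open>P\<close> to the carrier of \<open>hmk P i\<close>
  are identities. The statement, in its original definitions, is normalised by
  \<open>check\<close>.\<close>

lemma nat_level: "holds (\<lambda>_. Pi (Univ 0)
      (Iff (Suc 0) (Suc 0)
        (Prod 0 (Suc 0) (is_set 0 (Var 0)) (alg_injective 0 0 0 (Var 0)))
        (Sg (Suc 0) (Suc 0) (Univ 0) (retract 0 (Suc 0) (Var 1) (powerset 0 (Var 0))))))"
  by (rule holdsI[where Ss = "[abstract_main_ty, omega_ext_ty, elp_ty]"
      and t = "main_tm (hv 0) (hv 1) (hv 2)"],
      simp only: list.pred_inject simp_thms abstract_main omega_ext omega_prop, code_simp)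

lemma usuc_sup [simp]: "sup u (usuc u) = usuc (u :: 'l::universe_level)"
  using less_usuc[of u] by (simp add: sup_absorb2 less_imp_le)

theorem corollary33:
  fixes u :: "'l::universe_level"
  shows "inhabited_under propositional_resizing
    (Pi (Univ u)
      (Iff (usuc u) (usuc u)
        (Prod u (usuc u) (is_set u (Var 0)) (alg_injective u u u (Var 0)))
        (Sg (usuc u) (usuc u) (Univ u) (retract u (usuc u) (Var 1) (powerset u (Var 0))))))"
    (is "inhabited_under _ ?T")
proof -
  \<comment> \<open>Since \<open>n\<close> is sent to the \<open>n\<close>-th successor of
    \<open>u\<close>, the levels \<open>0\<close> and \<open>Suc 0\<close> become \<open>u\<close>
    and \<open>usuc u\<close>; \<open>usuc_sup\<close> simplifies the joins on the other
    side.\<close>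
  have "map_tm (\<lambda>n. (usuc ^^ n) u) (Pi (Univ 0)
      (Iff (Suc 0) (Suc 0)
        (Prod 0 (Suc 0) (is_set 0 (Var 0)) (alg_injective 0 0 0 (Var 0)))
        (Sg (Suc 0) (Suc 0) (Univ 0) (retract 0 (Suc 0) (Var 1) (powerset 0 (Var 0)))))) = ?T"
    by (simp add: tm_defs Iff_def is_set_def alg_injective_def Emb_def emb_map_def is_embedding_def
        fiber_def retract_def powerset_def Omega_def map_wk usuc_nat_def sup_nat_def)
  then obtain t where "[] \<turnstile> t \<Colon> ?T"
    using derivable_at_level[OF nat_level[unfolded holds_def], of u] by auto
  then show ?thesis unfolding inhabited_under_def by (intro exI[of _ "[]"]) auto
qed

end
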